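(* Let $S$ be a regular $F$-finite domain. Let $R\subseteq S$ be an extension of Noetherian rings, with $R$ $F$-finite, such that $R$ is a direct summand of $S$. Let $I\subseteq R$ be an ideal, and let $\lambda_1,\lambda_2\in\mathbb{R}_{>0}$. If $\tau_S((IS)^{\lambda_1})=\tau_S((IS)^{\lambda_2})$, then $\tau_R(I^{\lambda_1})=\tau_R(I^{\lambda_2})$.
   Context: Rings are commutative and contain a field of characteristic $p>0$. $F^e_*R$ is $R$ viewed as an $R$-module via the $e$-th iterate of Frobenius: $r\cdot F^e_*x=F^e_*(r^{p^e}x)$; $R$ is $F$-finite if $F^e_*R$ is a finitely generated $R$-module. $R$ is a direct summand of $S$ if there is an $R$-linear $\beta:S\to R$ with $\beta|_R=\mathrm{id}_R$; direct summands of regular $F$-finite domains are strongly $F$-regular. A $p^{-e}$-linear map is an additive map $\phi:R\to R$ with $\phi(r^{p^e}g)=r\phi(g)$; $\mathcal{C}^e_R$ is the set of all of them, and for an ideal $J$, $\mathcal{C}^e_RJ$ is the ideal generated by all $\phi(g)$ with $\phi\in\mathcal{C}^e_R$, $g\in J$. For $R$ strongly $F$-regular, an ideal $I\subseteq R$ and $\lambda\in\mathbb{R}_{>0}$, the test ideal is $\tau_R(I^\lambda)=\bigcup_{e\in\mathbb{N}}\mathcal{C}^e_R I^{\lceil p^e\lambda\rceil}$ (an increasing union). *)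

theory Defs
  imports "HOL-Library.Extended_Nat" "HOL-Computational_Algebra.Primes"
    "HOL-Algebra.Module" "HOL-Algebra.Ideal_Product"
    "HOL-Algebra.Ring_Divisibility" "HOL-Algebra.Subrings"
begin

section \<open>Localization and regular rings\<close>

text \<open>
  The fraction \<open>a/s\<close> with denominators in a multiplicative set \<open>M\<close>, as the set of all pairs
  \<open>(b, t)\<close> with \<open>u (t a - s b) = 0\<close> for some \<open>u\<close> in \<open>M\<close>. As for quotient rings in HOL-Algebra,
  the operations of the localization take the union over all representatives, all of which
  yield the same fraction.
\<close>

definition fraction :: "('a, 'm) ring_scheme \<Rightarrow> 'a set \<Rightarrow> 'a \<Rightarrow> 'a \<Rightarrow> ('a \<times> 'a) set"
  where "fraction R M a s =
    {(b, t). b \<in> carrier R \<and> t \<in> M \<and>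
       (\<exists>u\<in>M. u \<otimes>\<^bsub>R\<^esub> (t \<otimes>\<^bsub>R\<^esub> a \<ominus>\<^bsub>R\<^esub> s \<otimes>\<^bsub>R\<^esub> b) = \<zero>\<^bsub>R\<^esub>)}"

definition localization :: "('a, 'm) ring_scheme \<Rightarrow> 'a set \<Rightarrow> ('a \<times> 'a) set ring"
  where "localization R M =
    \<lparr> carrier = {fraction R M a s | a s. a \<in> carrier R \<and> s \<in> M},
      monoid.mult = (\<lambda>A B. \<Union>(a, s)\<in>A. \<Union>(b, t)\<in>B. fraction R M (a \<otimes>\<^bsub>R\<^esub> b) (s \<otimes>\<^bsub>R\<^esub> t)),
      one = fraction R M \<one>\<^bsub>R\<^esub> \<one>\<^bsub>R\<^esub>,
      ring.zero = fraction R M \<zero>\<^bsub>R\<^esub> \<one>\<^bsub>R\<^esub>,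
      add = (\<lambda>A B. \<Union>(a, s)\<in>A. \<Union>(b, t)\<in>B.
               fraction R M (t \<otimes>\<^bsub>R\<^esub> a \<oplus>\<^bsub>R\<^esub> s \<otimes>\<^bsub>R\<^esub> b) (s \<otimes>\<^bsub>R\<^esub> t)) \<rparr>"

definition localization_at :: "('a, 'm) ring_scheme \<Rightarrow> 'a set \<Rightarrow> ('a \<times> 'a) set ring"
  where "localization_at R P = localization R (carrier R - P)"

definition krull_dim :: "('a, 'm) ring_scheme \<Rightarrow> enat"
  where "krull_dim R =
    Sup {enat n | n. \<exists>P :: nat \<Rightarrow> 'a set.
           (\<forall>i\<le>n. primeideal (P i) R) \<and> (\<forall>i<n. P i \<subset> P (Suc i))}"

text \<open>Only meaningful for finitely generated ideals.\<close>

definition min_num_generators :: "('a, 'm) ring_scheme \<Rightarrow> 'a set \<Rightarrow> nat"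
  where "min_num_generators R I =
    (LEAST n. \<exists>A \<subseteq> carrier R. finite A \<and> card A = n \<and> I = Idl\<^bsub>R\<^esub> A)"

definition regular_local_ring :: "('a, 'm) ring_scheme \<Rightarrow> bool"
  where "regular_local_ring R \<longleftrightarrow>
    cring R \<and> noetherian_ring R \<and>
    (\<exists>m. maximalideal m R \<and> (\<forall>m'. maximalideal m' R \<longrightarrow> m' = m) \<and>
         enat (min_num_generators R m) = krull_dim R)"

definition regular_ring :: "('a, 'm) ring_scheme \<Rightarrow> bool"
  where "regular_ring R \<longleftrightarrow>
    cring R \<and> noetherian_ring R \<and>
    (\<forall>P. primeideal P R \<longrightarrow> regular_local_ring (localization_at R P))"


section \<open>Rings of characteristic \<open>p\<close>, Frobenius push-forwards and F-finiteness\<close>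

definition contains_field_of_char :: "nat \<Rightarrow> ('a, 'm) ring_scheme \<Rightarrow> bool"
  where "contains_field_of_char p R \<longleftrightarrow>
    (\<exists>K. subfield K R \<and> (\<forall>n::nat. [n] \<cdot>\<^bsub>R\<^esub> \<one>\<^bsub>R\<^esub> = \<zero>\<^bsub>R\<^esub> \<longleftrightarrow> p dvd n))"

definition frobenius_module :: "nat \<Rightarrow> nat \<Rightarrow> ('a, 'm) ring_scheme \<Rightarrow> ('a, 'a) module"
  where "frobenius_module p e R =
    \<lparr> carrier = carrier R, monoid.mult = monoid.mult R, one = \<one>\<^bsub>R\<^esub>, ring.zero = \<zero>\<^bsub>R\<^esub>, add = add R,
      smult = (\<lambda>r x. (r [^]\<^bsub>R\<^esub> (p ^ e)) \<otimes>\<^bsub>R\<^esub> x) \<rparr>"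

definition fin_gen_module :: "('a, 'm) ring_scheme \<Rightarrow> ('a, 'b, 'n) module_scheme \<Rightarrow> bool"
  where "fin_gen_module R M \<longleftrightarrow>
    (\<exists>A \<subseteq> carrier M. finite A \<and>
       (\<forall>x \<in> carrier M. \<exists>c \<in> A \<rightarrow> carrier R. x = (\<Oplus>\<^bsub>M\<^esub>a\<in>A. c a \<odot>\<^bsub>M\<^esub> a)))"

text \<open>
  Finite generation for one positive \<open>e\<close> is equivalent to finite generation for all \<open>e\<close>;
  for \<open>e = 0\<close> the condition is vacuous.
\<close>

definition F_finite :: "nat \<Rightarrow> ('a, 'm) ring_scheme \<Rightarrow> bool"
  where "F_finite p R \<longleftrightarrow> (\<exists>e>0. fin_gen_module R (frobenius_module p e R))"


section \<open>Direct summands\<close>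

definition direct_summand :: "'a set \<Rightarrow> ('a, 'm) ring_scheme \<Rightarrow> bool"
  where "direct_summand R S \<longleftrightarrow>
    (\<exists>\<beta> \<in> carrier S \<rightarrow> R.
       (\<forall>x \<in> carrier S. \<forall>y \<in> carrier S. \<beta> (x \<oplus>\<^bsub>S\<^esub> y) = \<beta> x \<oplus>\<^bsub>S\<^esub> \<beta> y) \<and>
       (\<forall>r \<in> R. \<forall>x \<in> carrier S. \<beta> (r \<otimes>\<^bsub>S\<^esub> x) = r \<otimes>\<^bsub>S\<^esub> \<beta> x) \<and>
       (\<forall>r \<in> R. \<beta> r = r))"


section \<open>Cartier operators and test ideals\<close>

definition cartier_maps :: "nat \<Rightarrow> nat \<Rightarrow> ('a, 'm) ring_scheme \<Rightarrow> ('a \<Rightarrow> 'a) set"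
  where "cartier_maps p e R =
    {\<phi> \<in> carrier R \<rightarrow> carrier R.
       (\<forall>x \<in> carrier R. \<forall>y \<in> carrier R. \<phi> (x \<oplus>\<^bsub>R\<^esub> y) = \<phi> x \<oplus>\<^bsub>R\<^esub> \<phi> y) \<and>
       (\<forall>r \<in> carrier R. \<forall>g \<in> carrier R.
          \<phi> ((r [^]\<^bsub>R\<^esub> (p ^ e)) \<otimes>\<^bsub>R\<^esub> g) = r \<otimes>\<^bsub>R\<^esub> \<phi> g)}"

definition cartier_ideal :: "nat \<Rightarrow> nat \<Rightarrow> ('a, 'm) ring_scheme \<Rightarrow> 'a set \<Rightarrow> 'a set"
  where "cartier_ideal p e R J = Idl\<^bsub>R\<^esub> {\<phi> g | \<phi> g. \<phi> \<in> cartier_maps p e R \<and> g \<in> J}"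

text \<open>
  Powers of ideals are powers in the multiplicative monoid of \<^term>\<open>ideals_set R\<close>.
  The formula for the test ideal is the one valid over strongly F-regular rings.
\<close>

definition test_ideal :: "nat \<Rightarrow> ('a, 'm) ring_scheme \<Rightarrow> 'a set \<Rightarrow> real \<Rightarrow> 'a set"
  where "test_ideal p R I l =
    (\<Union>e::nat. cartier_ideal p e R (I [^]\<^bsub>ideals_set R\<^esub> nat \<lceil>real p ^ e * l\<rceil>))"

end

theory Submission
  imports Defs
begin

text \<open>
  The heart of the matter is a comparison at one fixed level \<open>e\<close>, with \<open>q = p\<^sup>e\<close>: if \<open>J\<^sub>1, J\<^sub>2\<close> are
  sets of elements of the summand \<open>R\<close> (in the end, powers of \<open>I\<close>) and
  \<open>C\<^sup>e\<^sub>S (J\<^sub>1 S) \<subseteq> C\<^sup>e\<^sub>S (J\<^sub>2 S)\<close>, then \<open>C\<^sup>e\<^sub>R J\<^sub>1 \<subseteq> C\<^sup>e\<^sub>R J\<^sub>2\<close>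
  (\<open>cartier_ideal_descends_to_summand\<close>). Since \<open>S\<close> is regular, every \<open>g \<in> S\<close> lies in the ideal
  generated by the elements \<open>\<psi>(g)\<^sup>q\<close> with \<open>\<psi> \<in> C\<^sup>e\<^sub>S\<close>. If \<open>g \<in> J\<^sub>1\<close>, then \<open>\<psi>(g) \<in> C\<^sup>e\<^sub>S (J\<^sub>2 S)\<close>, so \<open>g\<close> is an
  \<open>S\<close>-linear combination of elements \<open>\<chi>(k b)\<^sup>q\<close> with \<open>\<chi> \<in> C\<^sup>e\<^sub>S\<close>, \<open>k \<in> S\<close> and \<open>b \<in> J\<^sub>2\<close>. Now let
  \<open>\<beta> : S \<rightarrow> R\<close> be the splitting and \<open>\<phi> \<in> C\<^sup>e\<^sub>R\<close>. Each map \<open>b \<mapsto> \<phi>(\<beta>(s \<chi>(k b)\<^sup>q))\<close> belongs to \<open>C\<^sup>e\<^sub>R\<close>, and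
  therefore \<open>\<phi>(g) = \<phi>(\<beta>(g))\<close> lies in \<open>C\<^sup>e\<^sub>R J\<^sub>2\<close>.

  To compare test ideals at a single level, the unions defining them have to be increasing. This
  holds over any ring with a Cartier map \<open>\<theta>\<close> of level \<open>1\<close> such that \<open>\<theta>(1) = 1\<close>. The generation property
  above, applied to \<open>g = 1\<close>, provides such a \<open>\<theta>\<close> on \<open>S\<close>, and \<open>\<beta> \<circ> \<theta>\<close> is one on \<open>R\<close>. As \<open>S\<close> is
  Noetherian, the union over \<open>S\<close> is attained at all large levels, and the comparison at these
  levels gives the theorem.

  It remains to see that \<open>g\<close> lies in the ideal of the \<open>\<psi>(g)\<^sup>q\<close>
  (\<open>mem_frobenius_power_of_cartier_values\<close>). By iteration \<open>q = p\<close> suffices, and the claim may be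
  checked near each maximal ideal \<open>N\<close>. There it follows from the freeness of \<open>S\<^sub>N\<close> over
  its subring of \<open>p\<close>-th powers: up to a denominator, the coefficients of \<open>g\<close> in a basis are values of Cartier maps at \<open>g\<close>
  (\<open>frobenius_dual_basis\<close>). This is the F-finite case of Kunz's theorem, proved here from
  the definition of regularity by embedding dimension. All arguments take place in \<open>S\<close> itself, with
  the ideals that are saturated with respect to \<open>N\<close>, that is, contracted from \<open>S\<^sub>N\<close>. Krull's
  principal ideal theorem, in the form \<open>prime_between\<close>, shows for a generating set \<open>X\<close> of \<open>N S\<^sub>N\<close>
  of size at most the height of \<open>N\<close> that every subset of \<open>X\<close> generates a prime ideal. Hence \<open>X\<close> is
  a regular sequence in every order, and so are the \<open>p\<close>-th powers of its elements. If finitely many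
  elements generate \<open>S\<^sub>N\<close> minimally over the \<open>p\<close>-th powers, then a
  \<open>p\<close>-linear relation between them modulo the \<open>p\<close>-th powers of \<open>X\<close> has its coefficients in \<open>N\<close>.
  Removing the elements of \<open>X\<close> one at a time, the regularity of the \<open>p\<close>-th powers shows that a
  relation modulo the \<open>p\<close>-th powers of \<open>T \<subseteq> X\<close> has its coefficients in the ideal of \<open>T\<close>; for
  \<open>T = {}\<close> this is linear independence (\<open>p_comb_coefficients_in_sat_hull\<close>).
\<close>

section \<open>Ideals saturated with respect to a prime ideal\<close>

lemma (in cring) ideal_if_closed:
  assumes "J \<subseteq> carrier R" "\<zero> \<in> J"
    and "\<And>a b. a \<in> J \<Longrightarrow> b \<in> J \<Longrightarrow> a \<oplus> b \<in> J"
    and mult: "\<And>r a. r \<in> carrier R \<Longrightarrow> a \<in> J \<Longrightarrow> r \<otimes> a \<in> J"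
  shows "ideal J R"
proof (rule idealI)
  show "ring R" by (rule ring_axioms)
  have "\<ominus> a \<in> J" if "a \<in> J" for a
    using mult[of "\<ominus> \<one>" a] that assms(1) by (simp add: subset_iff l_minus)
  then show "subgroup J (add_monoid R)"
    by (intro add.subgroupI) (use assms in \<open>auto simp: a_inv_def\<close>)
next
  fix a x assume "a \<in> J" "x \<in> carrier R"
  then show "x \<otimes> a \<in> J" by (rule mult[rotated])
  then show "a \<otimes> x \<in> J" using \<open>a \<in> J\<close> \<open>x \<in> carrier R\<close> assms(1) m_comm[of a x] by auto
qed

locale noetherian_cring = cring R + noetherian_ring R for R (structure)
begin

lemma maximal_ideal_in_family:
  assumes "F \<noteq> {}" "\<And>J. J \<in> F \<Longrightarrow> ideal J R"
  obtains M where "M \<in> F" "\<And>J. J \<in> F \<Longrightarrow> M \<subseteq> J \<Longrightarrow> J = M"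
proof -
  have "\<exists>M\<in>F. \<forall>X\<in>F. M \<subseteq> X \<longrightarrow> X = M"
  proof (rule subset_Zorn_nonempty)
    show "F \<noteq> {}" by fact
    fix C assume C: "C \<noteq> {}" "subset.chain F C"
    then have "subset.chain {I. ideal I R} C"
      using assms(2) by (auto simp: pred_on.chain_def)
    then have "\<Union>C \<in> C" using C(1) ideal_chain_is_trivial by blast
    then show "\<Union>C \<in> F" using C(2) by (auto simp: pred_on.chain_def)
  qed
  then show ?thesis using that by blast
qed

text \<open>
  These are the contractions to \<open>R\<close> of the ideals of the localization of \<open>R\<close> at \<open>N\<close>, when \<open>N\<close> is
  prime. Working with them replaces computations with fractions.
\<close>

definition sat_ideal :: "'a set \<Rightarrow> 'a set \<Rightarrow> bool"
  where "sat_ideal N J \<longleftrightarrow>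
    ideal J R \<and> (\<forall>s\<in>carrier R - N. \<forall>a\<in>carrier R. s \<otimes> a \<in> J \<longrightarrow> a \<in> J)"

definition sat_hull :: "'a set \<Rightarrow> 'a set \<Rightarrow> 'a set"
  where "sat_hull N Y = \<Inter>{J. sat_ideal N J \<and> Y \<subseteq> J}"

lemma sat_idealD:
  assumes "sat_ideal N J"
  shows "ideal J R" "\<And>s a. s \<in> carrier R \<Longrightarrow> s \<notin> N \<Longrightarrow> a \<in> carrier R \<Longrightarrow> s \<otimes> a \<in> J \<Longrightarrow> a \<in> J"
    "J \<subseteq> carrier R" "\<zero> \<in> J" "\<And>a b. a \<in> J \<Longrightarrow> b \<in> J \<Longrightarrow> a \<oplus> b \<in> J"
    "\<And>a b. a \<in> J \<Longrightarrow> b \<in> J \<Longrightarrow> a \<ominus> b \<in> J"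
    "\<And>r a. r \<in> carrier R \<Longrightarrow> a \<in> J \<Longrightarrow> r \<otimes> a \<in> J"
    "\<And>r a. r \<in> carrier R \<Longrightarrow> a \<in> J \<Longrightarrow> a \<otimes> r \<in> J"
proof -
  from assms interpret J: ideal J R by (simp add: sat_ideal_def)
  show "ideal J R" by (rule J.is_ideal)
  show "\<And>s a. s \<in> carrier R \<Longrightarrow> s \<notin> N \<Longrightarrow> a \<in> carrier R \<Longrightarrow> s \<otimes> a \<in> J \<Longrightarrow> a \<in> J"
    using assms unfolding sat_ideal_def by blast
  show "J \<subseteq> carrier R" by (rule J.a_subset)
  show "\<zero> \<in> J" by simp
  show "\<And>a b. a \<in> J \<Longrightarrow> b \<in> J \<Longrightarrow> a \<oplus> b \<in> J" by simp
  show "\<And>a b. a \<in> J \<Longrightarrow> b \<in> J \<Longrightarrow> a \<ominus> b \<in> J" by (simp add: a_minus_def)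
  show "\<And>r a. r \<in> carrier R \<Longrightarrow> a \<in> J \<Longrightarrow> r \<otimes> a \<in> J" by (rule J.I_l_closed)
  show "\<And>r a. r \<in> carrier R \<Longrightarrow> a \<in> J \<Longrightarrow> a \<otimes> r \<in> J" by (rule J.I_r_closed)
qed

lemma sat_ideal_carrier: "sat_ideal N (carrier R)"
  by (simp add: sat_ideal_def oneideal)

lemma sat_ideal_sat_hull:
  assumes "Y \<subseteq> carrier R"
  shows "sat_ideal N (sat_hull N Y)"
proof -
  have "ideal (sat_hull N Y) R"
    unfolding sat_hull_def
    by (rule i_Intersect) (use assms sat_ideal_carrier in \<open>auto simp: sat_ideal_def\<close>)
  moreover have "a \<in> sat_hull N Y"
    if *: "s \<in> carrier R" "s \<notin> N" "a \<in> carrier R" "s \<otimes> a \<in> sat_hull N Y" for s a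
    unfolding sat_hull_def
  proof
    fix J assume "J \<in> {J. sat_ideal N J \<and> Y \<subseteq> J}"
    then show "a \<in> J" using sat_idealD(2)[of N J s a] * by (auto simp: sat_hull_def)
  qed
  ultimately show ?thesis unfolding sat_ideal_def by blast
qed

lemma sat_hull_contains: "Y \<subseteq> sat_hull N Y"
  by (auto simp: sat_hull_def)

lemma sat_hull_minimal: "sat_ideal N J \<Longrightarrow> Y \<subseteq> J \<Longrightarrow> sat_hull N Y \<subseteq> J"
  by (auto simp: sat_hull_def)

lemma sat_hull_mono: "Y \<subseteq> Z \<Longrightarrow> sat_hull N Y \<subseteq> sat_hull N Z"
  by (auto simp: sat_hull_def)

lemma sat_hull_of_sat_ideal: "sat_ideal N J \<Longrightarrow> sat_hull N J = J"
  using sat_hull_contains[of J N] sat_hull_minimal[of N J J] by blast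

lemma primeD:
  assumes "primeideal P R"
  shows "P \<subseteq> carrier R" "\<one> \<notin> P" "\<And>a. a \<in> P \<Longrightarrow> a \<in> carrier R" "\<zero> \<in> P"
    "\<And>a b. a \<in> carrier R \<Longrightarrow> b \<in> carrier R \<Longrightarrow> a \<otimes> b \<in> P \<Longrightarrow> a \<in> P \<or> b \<in> P"
proof -
  interpret P: primeideal P R by fact
  show "P \<subseteq> carrier R" "\<And>a. a \<in> P \<Longrightarrow> a \<in> carrier R" using P.a_subset by auto
  show "\<one> \<notin> P" using P.one_imp_carrier P.I_notcarr by blast
  show "\<zero> \<in> P" by simp
  show "\<And>a b. a \<in> carrier R \<Longrightarrow> b \<in> carrier R \<Longrightarrow> a \<otimes> b \<in> P \<Longrightarrow> a \<in> P \<or> b \<in> P"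
    by (rule P.I_prime)
qed

lemma sat_ideal_prime:
  assumes "primeideal P R" "P \<subseteq> N"
  shows "sat_ideal N P"
  unfolding sat_ideal_def
proof (intro conjI ballI impI)
  show "ideal P R" using assms(1) by (rule primeideal.axioms(1))
  fix s a assume "s \<in> carrier R - N" "a \<in> carrier R" "s \<otimes> a \<in> P"
  then show "a \<in> P" using primeD(5)[OF assms(1), of s a] assms(2) by blast
qed

lemma prime_mult_notin:
  assumes "primeideal N R" "s \<in> carrier R - N" "t \<in> carrier R - N"
  shows "s \<otimes> t \<in> carrier R - N"
  using primeD(5)[OF assms(1), of s t] assms by auto

text \<open>
  The elements \<open>a\<close> that are multiples of \<open>x\<close> modulo the hull of \<open>Y\<close>, up to a denominator \<open>s\<close>, form a
  saturated ideal that contains \<open>x\<close> and \<open>Y\<close>.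
\<close>

lemma sat_hull_insertD:
  assumes N: "primeideal N R" and Y: "Y \<subseteq> carrier R" and x: "x \<in> carrier R"
    and a: "a \<in> sat_hull N (insert x Y)"
  obtains s r where "s \<in> carrier R - N" "r \<in> carrier R" "s \<otimes> a \<ominus> x \<otimes> r \<in> sat_hull N Y"
proof -
  define J where "J = sat_hull N Y"
  have J: "sat_ideal N J" using sat_ideal_sat_hull[OF Y] by (simp add: J_def)
  note J' = sat_idealD[OF J]
  define A where "A = {a \<in> carrier R. \<exists>s\<in>carrier R - N. \<exists>r\<in>carrier R. s \<otimes> a \<ominus> x \<otimes> r \<in> J}"
  have "ideal A R"
  proof (rule ideal_if_closed)
    show "A \<subseteq> carrier R" by (auto simp: A_def)
    show "\<zero> \<in> A" unfolding A_def using primeD(2)[OF N] x J'(4)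
      by (intro CollectI conjI bexI[of _ "\<one>"] bexI[of _ "\<zero>"]) (simp_all add: a_minus_def)
  next
    fix a b assume "a \<in> A" "b \<in> A"
    then obtain s r t q where *: "a \<in> carrier R" "s \<in> carrier R - N" "r \<in> carrier R" "s \<otimes> a \<ominus> x \<otimes> r \<in> J"
      "b \<in> carrier R" "t \<in> carrier R - N" "q \<in> carrier R" "t \<otimes> b \<ominus> x \<otimes> q \<in> J"
      by (auto simp: A_def)
    then have c: "s \<in> carrier R" "t \<in> carrier R" by auto
    have "t \<otimes> (s \<otimes> a \<ominus> x \<otimes> r) \<oplus> s \<otimes> (t \<otimes> b \<ominus> x \<otimes> q) \<in> J"
      using * c by (intro J'(5,7)) auto
    also have "t \<otimes> (s \<otimes> a \<ominus> x \<otimes> r) \<oplus> s \<otimes> (t \<otimes> b \<ominus> x \<otimes> q)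
        = (s \<otimes> t) \<otimes> (a \<oplus> b) \<ominus> x \<otimes> (t \<otimes> r \<oplus> s \<otimes> q)"
      using * c x by algebra
    finally show "a \<oplus> b \<in> A"
      unfolding A_def using * c prime_mult_notin[OF N *(2,6)]
      by (intro CollectI conjI bexI[of _ "s \<otimes> t"] bexI[of _ "t \<otimes> r \<oplus> s \<otimes> q"]) auto
  next
    fix u a assume "a \<in> A" and u: "u \<in> carrier R"
    then obtain s r where *: "a \<in> carrier R" "s \<in> carrier R - N" "r \<in> carrier R" "s \<otimes> a \<ominus> x \<otimes> r \<in> J"
      by (auto simp: A_def)
    then have c: "s \<in> carrier R" by auto
    have "u \<otimes> (s \<otimes> a \<ominus> x \<otimes> r) \<in> J" using * u by (intro J'(7)) auto
    also have "u \<otimes> (s \<otimes> a \<ominus> x \<otimes> r) = s \<otimes> (u \<otimes> a) \<ominus> x \<otimes> (u \<otimes> r)"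
      using * c x u by algebra
    finally show "u \<otimes> a \<in> A"
      unfolding A_def using * c u by auto
  qed
  moreover have "b \<in> A" if "t \<in> carrier R" "t \<notin> N" "b \<in> carrier R" "t \<otimes> b \<in> A" for t b
  proof -
    from that(4) obtain s r where *: "s \<in> carrier R - N" "r \<in> carrier R" "s \<otimes> (t \<otimes> b) \<ominus> x \<otimes> r \<in> J"
      by (auto simp: A_def)
    then have "(s \<otimes> t) \<otimes> b \<ominus> x \<otimes> r \<in> J" using that by (simp add: m_assoc)
    moreover have "s \<otimes> t \<in> carrier R - N" using prime_mult_notin[OF N] * that by blast
    ultimately show ?thesis unfolding A_def using * that by blast
  qed
  ultimately have A: "sat_ideal N A" by (auto simp: sat_ideal_def)
  have "x \<in> A"
    unfolding A_def using primeD(2)[OF N] x J'(4)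
    by (intro CollectI conjI bexI[of _ "\<one>"]) (simp_all add: a_minus_def r_neg)
  moreover have "y \<in> A" if "y \<in> Y" for y
  proof -
    have y: "y \<in> carrier R" "y \<in> J" using that Y sat_hull_contains[of Y N] by (auto simp: J_def)
    then have "\<one> \<otimes> y \<ominus> x \<otimes> \<zero> \<in> J" using x by (simp add: a_minus_def)
    then show ?thesis unfolding A_def using primeD(2)[OF N] y by blast
  qed
  ultimately have "sat_hull N (insert x Y) \<subseteq> A" using A by (intro sat_hull_minimal) auto
  with a have "a \<in> A" by blast
  then obtain s r where "s \<in> carrier R - N" "r \<in> carrier R" "s \<otimes> a \<ominus> x \<otimes> r \<in> J"
    unfolding A_def by blast
  then show ?thesis by (rule that[unfolded J_def[symmetric]])
qed

text \<open>
  This plays the role of Nakayama's lemma: if each member of a family is, modulo \<open>J\<close> and up to a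
  denominator, a multiple by \<open>x \<in> N\<close> of another member, then the family lies in \<open>J\<close>. The family need
  not be an ideal; below it also consists of single coefficients of tuples, which is why it is
  indexed. Among the ideals generated by \<open>J\<close> and a member outside \<open>J\<close> there is a maximal one. The
  next member \<open>b\<close> then generates the same ideal as the given member \<open>a\<close>, so \<open>b\<close> is a multiple of
  \<open>x b\<close> modulo \<open>J\<close>, and \<open>1 - x r\<close> is a unit at \<open>N\<close>.
\<close>

lemma saturated_descent:
  fixes T :: "'i set" and ev :: "'i \<Rightarrow> 'a"
  assumes N: "primeideal N R" and J: "sat_ideal N J" and x: "x \<in> N"
    and T: "\<And>t. t \<in> T \<Longrightarrow> ev t \<in> carrier R"
    and step: "\<And>t. t \<in> T \<Longrightarrow> \<exists>t'\<in>T. \<exists>s\<in>carrier R - N. s \<otimes> ev t \<ominus> x \<otimes> ev t' \<in> J"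
    and "t0 \<in> T"
  shows "ev t0 \<in> J"
proof (rule ccontr)
  assume "ev t0 \<notin> J"
  note J' = sat_idealD[OF J]
  have xc: "x \<in> carrier R" using primeD(1)[OF N] x by blast
  define L where "L t = sat_hull N (insert (ev t) J)" for t
  have L: "sat_ideal N (L t)" if "t \<in> T" for t
    unfolding L_def using that T J' by (intro sat_ideal_sat_hull) auto
  obtain M where M: "M \<in> {L t |t. t \<in> T \<and> ev t \<notin> J}"
    "\<And>K. K \<in> {L t |t. t \<in> T \<and> ev t \<notin> J} \<Longrightarrow> M \<subseteq> K \<Longrightarrow> K = M"
    by (rule maximal_ideal_in_family[of "{L t |t. t \<in> T \<and> ev t \<notin> J}"])
       (use \<open>t0 \<in> T\<close> \<open>ev t0 \<notin> J\<close> L sat_idealD(1) in auto)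
  then obtain t where t: "t \<in> T" "ev t \<notin> J" "M = L t" by auto
  obtain t' s where t': "t' \<in> T" "s \<in> carrier R - N" "s \<otimes> ev t \<ominus> x \<otimes> ev t' \<in> J"
    using step[OF t(1)] by auto
  have c: "ev t \<in> carrier R" "ev t' \<in> carrier R" "s \<in> carrier R" using T t t' by auto
  have eq: "(s \<otimes> ev t \<ominus> x \<otimes> ev t') \<oplus> x \<otimes> ev t' = s \<otimes> ev t"
    using c xc by algebra
  have "ev t' \<notin> J"
  proof
    assume "ev t' \<in> J"
    then have "x \<otimes> ev t' \<in> J" by (rule J'(7)[OF xc])
    then have "s \<otimes> ev t \<in> J" using J'(5)[OF t'(3), of "x \<otimes> ev t'"] unfolding eq by blast
    then show False using J'(2)[of s "ev t"] t' c t(2) by simp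
  qed
  note L' = sat_idealD[OF L[OF t'(1)]]
  have "J \<subseteq> L t'" "ev t' \<in> L t'" using sat_hull_contains[of "insert (ev t') J" N] by (auto simp: L_def)
  then have "s \<otimes> ev t \<in> L t'"
    using L'(5)[of "s \<otimes> ev t \<ominus> x \<otimes> ev t'" "x \<otimes> ev t'"] L'(7)[OF xc, of "ev t'"] t'(3)
    unfolding eq by blast
  then have "ev t \<in> L t'" using L'(2)[of s "ev t"] t' c by simp
  then have "L t \<subseteq> L t'"
    using \<open>J \<subseteq> L t'\<close> L[OF t'(1)] unfolding L_def[of t] by (intro sat_hull_minimal) auto
  then have "L t' = L t" using M(2)[of "L t'"] t t' \<open>ev t' \<notin> J\<close> by auto
  then have "ev t' \<in> sat_hull N (insert (ev t) J)" using \<open>ev t' \<in> L t'\<close> by (simp add: L_def)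
  then obtain u r where u: "u \<in> carrier R - N" "r \<in> carrier R" "u \<otimes> ev t' \<ominus> ev t \<otimes> r \<in> J"
    by (rule sat_hull_insertD[OF N J'(3) c(1), unfolded sat_hull_of_sat_ideal[OF J]])
  then have uc: "u \<in> carrier R" by simp
  have "s \<otimes> (u \<otimes> ev t' \<ominus> ev t \<otimes> r) \<oplus> r \<otimes> (s \<otimes> ev t \<ominus> x \<otimes> ev t') \<in> J"
    using u t' c by (intro J'(5,7)) auto
  also have "s \<otimes> (u \<otimes> ev t' \<ominus> ev t \<otimes> r) \<oplus> r \<otimes> (s \<otimes> ev t \<ominus> x \<otimes> ev t') = (s \<otimes> u \<ominus> x \<otimes> r) \<otimes> ev t'"
    using c xc u uc by algebra
  finally have "(s \<otimes> u \<ominus> x \<otimes> r) \<otimes> ev t' \<in> J" .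
  moreover have "s \<otimes> u \<ominus> x \<otimes> r \<notin> N"
  proof
    interpret N: primeideal N R by fact
    assume "s \<otimes> u \<ominus> x \<otimes> r \<in> N"
    then have "(s \<otimes> u \<ominus> x \<otimes> r) \<oplus> x \<otimes> r \<in> N" using N.I_r_closed[OF x u(2)] by simp
    also have "(s \<otimes> u \<ominus> x \<otimes> r) \<oplus> x \<otimes> r = s \<otimes> u" using c xc u uc by algebra
    finally show False using prime_mult_notin[OF N t'(2) u(1)] by simp
  qed
  ultimately have "ev t' \<in> J" using J'(2)[of "s \<otimes> u \<ominus> x \<otimes> r" "ev t'"] c xc uc u by auto
  then show False using \<open>ev t' \<notin> J\<close> by simp
qed

end

section \<open>The principal ideal theorem\<close>

lemma (in ideal) diff_mem_iff:
  assumes "a \<ominus> b \<in> I" "a \<in> carrier R" "b \<in> carrier R"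
  shows "a \<in> I \<longleftrightarrow> b \<in> I"
proof
  assume "a \<in> I"
  then have "a \<ominus> (a \<ominus> b) \<in> I" using assms(1) by (simp add: a_minus_def)
  also have "a \<ominus> (a \<ominus> b) = b"
    using assms(2,3) by (simp add: a_minus_def minus_add r_neg a_assoc[symmetric])
  finally show "b \<in> I" .
next
  assume "b \<in> I"
  then have "(a \<ominus> b) \<oplus> b \<in> I" using assms(1) by simp
  also have "(a \<ominus> b) \<oplus> b = a"
    using assms(2,3) by (simp add: a_minus_def a_assoc l_neg)
  finally show "a \<in> I" .
qed

context noetherian_cring
begin

lemmas sat_ideal_diff_mem_iff = ideal.diff_mem_iff[OF sat_idealD(1)]

lemma sat_ideal_mono: "sat_ideal Q J \<Longrightarrow> Q \<subseteq> N \<Longrightarrow> sat_ideal N J"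
  unfolding sat_ideal_def by blast

lemma sat_ideal_eq_carrier:
  assumes "sat_ideal N J" "s \<in> J" "s \<notin> N"
  shows "J = carrier R"
proof -
  have "s \<in> carrier R" using sat_idealD(3)[OF assms(1)] assms(2) by blast
  then have "\<one> \<in> J" using sat_idealD(2)[OF assms(1), of s \<one>] assms by simp
  then show ?thesis by (rule ideal.one_imp_carrier[OF sat_idealD(1)[OF assms(1)]])
qed

lemma sat_ideal_colon:
  assumes J: "sat_ideal N J" and b: "b \<in> carrier R"
  shows "sat_ideal N {c \<in> carrier R. b \<otimes> c \<in> J}"
  unfolding sat_ideal_def
proof (intro conjI ballI impI)
  note J' = sat_idealD[OF J]
  show "ideal {c \<in> carrier R. b \<otimes> c \<in> J} R"
  proof (rule ideal_if_closed)
    show "\<zero> \<in> {c \<in> carrier R. b \<otimes> c \<in> J}" using b J'(4) by simp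
  next
    fix c d assume "c \<in> {c \<in> carrier R. b \<otimes> c \<in> J}" "d \<in> {c \<in> carrier R. b \<otimes> c \<in> J}"
    then show "c \<oplus> d \<in> {c \<in> carrier R. b \<otimes> c \<in> J}"
      using b J'(5)[of "b \<otimes> c" "b \<otimes> d"] by (simp add: r_distr)
  next
    fix r c assume r: "r \<in> carrier R" and "c \<in> {c \<in> carrier R. b \<otimes> c \<in> J}"
    then show "r \<otimes> c \<in> {c \<in> carrier R. b \<otimes> c \<in> J}"
      using b J'(7)[of r "b \<otimes> c"] by (simp add: m_lcomm)
  qed auto
  fix s c assume "s \<in> carrier R - N" "c \<in> carrier R" "s \<otimes> c \<in> {c \<in> carrier R. b \<otimes> c \<in> J}"
  then show "c \<in> {c \<in> carrier R. b \<otimes> c \<in> J}"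
    using b J'(2)[of s "b \<otimes> c"] by (simp add: m_lcomm)
qed

text \<open>
  If \<open>N\<close> is the only prime ideal between \<open>J0\<close> and \<open>N\<close>, the localization at \<open>N\<close> modulo \<open>J0\<close> is Artinian.
  By Noetherian induction, take a maximal \<open>M\<close> above which some decreasing sequence does not become
  stationary. It is prime: if \<open>a b \<in> M\<close> with \<open>a, b \<notin> M\<close>, then \<open>M + (b)\<close> and \<open>M : b\<close> are
  larger, and a sequence \<open>f\<close> becomes stationary once both \<open>f + (b)\<close> and \<open>f : b\<close> do. Hence \<open>M = N\<close>,
  but there are only two saturated ideals containing \<open>N\<close>.
\<close>

lemma sat_ideal_dcc:
  assumes N: "primeideal N R" and J0: "sat_ideal N J0"
    and only: "\<And>K. primeideal K R \<Longrightarrow> J0 \<subseteq> K \<Longrightarrow> K \<subseteq> N \<Longrightarrow> K = N"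
    and f: "\<And>n. sat_ideal N (f n)" "\<And>n. J0 \<subseteq> f n" "\<And>n. f (Suc n) \<subseteq> f n"
  shows "\<exists>n. \<forall>m\<ge>n. f m = f n"
proof -
  \<comment> \<open>The property for which Noetherian induction is done: the descending chain condition above \<open>J\<close>.\<close>
  define good where "good J \<longleftrightarrow> (\<forall>f::nat \<Rightarrow> 'a set. (\<forall>n. sat_ideal N (f n) \<and> J \<subseteq> f n \<and> f (Suc n) \<subseteq> f n) \<longrightarrow>
    (\<exists>n. \<forall>m\<ge>n. f m = f n))" for J
  have "good J0"
  proof (rule ccontr)
    assume "\<not> good J0"
    then obtain M where M: "M \<in> {J. sat_ideal N J \<and> J0 \<subseteq> J \<and> \<not> good J}"
      and Mmax: "\<And>K. K \<in> {J. sat_ideal N J \<and> J0 \<subseteq> J \<and> \<not> good J} \<Longrightarrow> M \<subseteq> K \<Longrightarrow> K = M"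
      by (rule_tac maximal_ideal_in_family[of "{J. sat_ideal N J \<and> J0 \<subseteq> J \<and> \<not> good J}"])
         (use J0 sat_idealD(1) in auto)
    then have Ms: "sat_ideal N M" and M0: "J0 \<subseteq> M" and bad: "\<not> good M" by auto
    note M' = sat_idealD[OF Ms]
    obtain f where f: "\<And>n. sat_ideal N (f n)" "\<And>n. M \<subseteq> f n" "\<And>n. f (Suc n) \<subseteq> f n"
      and unstable: "\<not> (\<exists>n. \<forall>m\<ge>n. f m = f n)"
      using bad unfolding good_def by blast
    have anti: "f m \<subseteq> f n" if "n \<le> m" for m n
      using that by (rule lift_Suc_antimono_le[of f, OF f(3)])
    have "M \<subseteq> N"
    proof
      fix s assume "s \<in> M"
      show "s \<in> N"
      proof (rule ccontr)
        assume "s \<notin> N"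
        then have "f n = carrier R" for n
          using sat_ideal_eq_carrier[OF f(1)[of n], of s] f(2)[of n] \<open>s \<in> M\<close> by blast
        then show False using unstable by simp
      qed
    qed
    have "primeideal M R"
    proof (rule primeidealI)
      show "ideal M R" by (rule M')
      show "cring R" by (rule is_cring)
      show "carrier R \<noteq> M" using primeD(2)[OF N] \<open>M \<subseteq> N\<close> by auto
      fix a b assume a: "a \<in> carrier R" and b: "b \<in> carrier R" and ab: "a \<otimes> b \<in> M"
      show "a \<in> M \<or> b \<in> M"
      proof (rule ccontr)
        assume "\<not> (a \<in> M \<or> b \<in> M)"
        then have na: "a \<notin> M" and nb: "b \<notin> M" by auto
        define K1 where "K1 = sat_hull N (insert b M)"
        define K2 where "K2 = {c \<in> carrier R. b \<otimes> c \<in> M}"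
        have K1: "sat_ideal N K1" "M \<subseteq> K1" "b \<in> K1"
          using sat_ideal_sat_hull[of "insert b M" N] sat_hull_contains[of "insert b M" N] b M'(3)
          by (auto simp: K1_def)
        have K2: "sat_ideal N K2" "M \<subseteq> K2" "a \<in> K2"
          using sat_ideal_colon[OF Ms b] M'(3,7) a b ab by (auto simp: K2_def m_comm)
        have good: "good K1" "good K2"
          using Mmax[of K1] Mmax[of K2] K1 K2 M0 na nb by auto
        define g where "g n = sat_hull N (insert b (f n))" for n
        define h where "h n = {c \<in> carrier R. b \<otimes> c \<in> f n}" for n
        have fc: "insert b (f n) \<subseteq> carrier R" for n using b sat_idealD(3)[OF f(1)] by auto
        have "sat_ideal N (g n) \<and> K1 \<subseteq> g n \<and> g (Suc n) \<subseteq> g n" for n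
          unfolding g_def K1_def
          by (intro conjI sat_ideal_sat_hull fc sat_hull_mono insert_mono f)
        then obtain n1 where n1: "\<And>m. n1 \<le> m \<Longrightarrow> g m = g n1"
          using good(1) unfolding good_def by blast
        have "sat_ideal N (h n) \<and> K2 \<subseteq> h n \<and> h (Suc n) \<subseteq> h n" for n
          using sat_ideal_colon[OF f(1) b] f(2)[of n] f(3)[of n] unfolding h_def K2_def by blast
        then obtain n2 where n2: "\<And>m. n2 \<le> m \<Longrightarrow> h m = h n2"
          using good(2) unfolding good_def by blast
        define n where "n = max n1 n2"
        have "f m = f n" if "n \<le> m" for m
        proof
          show "f m \<subseteq> f n" by (rule anti[OF that])
          show "f n \<subseteq> f m"
          proof
            fix t assume t: "t \<in> f n"
            then have tc: "t \<in> carrier R" using sat_idealD(3)[OF f(1)] by blast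
            have "t \<in> g n" using t sat_hull_contains[of "insert b (f n)" N] by (auto simp: g_def)
            moreover have "g n = g m" using n1[of n] n1[of m] that by (auto simp: n_def)
            ultimately have "t \<in> g m" by simp
            then have "t \<in> sat_hull N (insert b (f m))" by (simp add: g_def)
            then obtain s r where sr: "s \<in> carrier R - N" "r \<in> carrier R" "s \<otimes> t \<ominus> b \<otimes> r \<in> f m"
              by (rule sat_hull_insertD[OF N sat_idealD(3)[OF f(1)] b, unfolded sat_hull_of_sat_ideal[OF f(1)]])
            then have "s \<otimes> t \<in> f n" "s \<otimes> t \<ominus> b \<otimes> r \<in> f n"
              using sat_idealD(7)[OF f(1)] t anti[OF that] by auto
            then have "b \<otimes> r \<in> f n"
              using sat_ideal_diff_mem_iff[OF f(1)[of n], of "s \<otimes> t" "b \<otimes> r"] sr tc b by auto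
            then have "r \<in> h n" using sr by (simp add: h_def)
            moreover have "h n = h m" using n2[of n] n2[of m] that by (auto simp: n_def)
            ultimately have "r \<in> h m" by simp
            then have "b \<otimes> r \<in> f m" by (simp add: h_def)
            then have "s \<otimes> t \<in> f m"
              using sat_ideal_diff_mem_iff[OF f(1)[of m], of "s \<otimes> t" "b \<otimes> r"] sr tc b by auto
            then show "t \<in> f m" using sat_idealD(2)[OF f(1), of s t] sr tc by auto
          qed
        qed
        then show False using unstable by blast
      qed
    qed
    then have "M = N" using only M0 \<open>M \<subseteq> N\<close> by blast
    have "f n = N \<or> f n = carrier R" for n
      using sat_ideal_eq_carrier[OF f(1)[of n]] f(2)[of n] \<open>M = N\<close> by blast
    moreover have "f m = N" if "f n = N" "n \<le> m" for m n
      using that anti[of n m] f(2)[of m] \<open>M = N\<close> by blast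
    ultimately show False using unstable by metis
  qed
  then show ?thesis using f unfolding good_def by blast
qed

text \<open>
  Krull's principal ideal theorem, as a statement on chains: an element of the top of a chain of
  three prime ideals can be moved into the middle one. If this fails, then \<open>N\<close> is minimal over
  \<open>P + (x)\<close>. In place of the symbolic powers of \<open>Q\<close>, the proof uses the decreasing ideals \<open>W n\<close>
  generated by \<open>P\<close> and \<open>y\<^sup>n\<close>, saturated at \<open>Q\<close>, for some \<open>y \<in> Q - P\<close>. Modulo \<open>x\<close> they become
  stationary by \<open>sat_ideal_dcc\<close>. Since \<open>x \<notin> Q\<close>, multiples of \<open>x\<close> in \<open>W n\<close> come from \<open>W n\<close>, and
  so descent gives \<open>W n = W (n + 1)\<close>; cancelling \<open>y\<^sup>n\<close> modulo \<open>P\<close> this contradicts \<open>y \<in> Q\<close>.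
\<close>

lemma prime_between:
  assumes P: "primeideal P R" and Q: "primeideal Q R" and N: "primeideal N R"
    and PQ: "P \<subset> Q" and QN: "Q \<subset> N" and x: "x \<in> N"
  obtains Q' where "primeideal Q' R" "P \<subset> Q'" "Q' \<subset> N" "x \<in> Q'"
proof (cases "x \<in> Q")
  case True
  then show ?thesis using that[of Q] Q PQ QN by blast
next
  case False
  note result = that
  have xc: "x \<in> carrier R" using primeD(1)[OF N] x by blast
  note Pc = primeD(1)[OF P] and Qc = primeD(1)[OF Q]
  from PQ obtain y where y: "y \<in> Q" "y \<notin> P" by blast
  then have yc: "y \<in> carrier R" using Qc by blast
  have ypow: "y [^] n \<notin> P" for n :: nat
  proof (induction n)
    case (Suc n)
    then show ?case using primeD(5)[OF P, of "y [^] n" y] y yc by auto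
  qed (use primeD(2)[OF P] in simp)
  define W where "W n = sat_hull Q (insert (y [^] (n::nat)) P)" for n
  have WQ: "sat_ideal Q (W n)" for n
    unfolding W_def by (rule sat_ideal_sat_hull) (use yc Pc in auto)
  have WN: "sat_ideal N (W n)" for n
    using sat_ideal_mono[OF WQ] QN by blast
  have PW: "P \<subseteq> W n" and yW: "y [^] n \<in> W n" for n
    using sat_hull_contains[of "insert (y [^] n) P" Q] by (auto simp: W_def)
  have Wanti: "W (Suc n) \<subseteq> W n" for n
    unfolding W_def[of "Suc n"]
    by (rule sat_hull_minimal[OF WQ]) (use PW yW sat_idealD(8)[OF WQ] yc in auto)
  show ?thesis
  proof (rule ccontr)
    assume none: "\<not> ?thesis"
    define F where "F n = sat_hull N (insert x (W n))" for n
    have "\<exists>n. \<forall>m\<ge>n. F m = F n"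
    proof (rule sat_ideal_dcc[OF N, of "sat_hull N (insert x P)"])
      show "sat_ideal N (sat_hull N (insert x P))"
        by (rule sat_ideal_sat_hull) (use xc Pc in auto)
      show "K = N" if K: "primeideal K R" "sat_hull N (insert x P) \<subseteq> K" "K \<subseteq> N" for K
      proof -
        have "insert x P \<subseteq> K" using sat_hull_contains[of "insert x P" N] K(2) by blast
        then have "P \<subset> K" "x \<in> K" using False PQ by auto
        then show ?thesis using none result[OF K(1)] K(3) by blast
      qed
      show "sat_ideal N (F n)" for n
        unfolding F_def by (rule sat_ideal_sat_hull) (use xc sat_idealD(3)[OF WQ] in auto)
      show "sat_hull N (insert x P) \<subseteq> F n" "F (Suc n) \<subseteq> F n" for n
        unfolding F_def by (intro sat_hull_mono insert_mono PW Wanti)+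
    qed
    then obtain n where n: "F (Suc n) = F n" using le_Suc_eq by blast
    have "y [^] n \<in> W (Suc n)"
    proof (rule saturated_descent[OF N WN x, where T = "W n" and ev = "\<lambda>t. t"])
      show "y [^] n \<in> W n" by (rule yW)
      fix t assume t: "t \<in> W n"
      show tc: "t \<in> carrier R" using t sat_idealD(3)[OF WQ] by blast
      have "t \<in> F (Suc n)" unfolding n using t sat_hull_contains[of "insert x (W n)" N] by (auto simp: F_def)
      then obtain s r where sr: "s \<in> carrier R - N" "r \<in> carrier R" "s \<otimes> t \<ominus> x \<otimes> r \<in> W (Suc n)"
        unfolding F_def
        by (rule sat_hull_insertD[OF N sat_idealD(3)[OF WN] xc, unfolded sat_hull_of_sat_ideal[OF WN]])
      have "x \<otimes> r \<in> W n"
        using sat_ideal_diff_mem_iff[OF WN[of n], of "s \<otimes> t" "x \<otimes> r"] sr tc xc Wanti[of n]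
          sat_idealD(7)[OF WN[of n], of s t] t by auto
      then have "r \<in> W n" using sat_idealD(2)[OF WQ[of n], of x r] xc False sr by blast
      then show "\<exists>t'\<in>W n. \<exists>s\<in>carrier R - N. s \<otimes> t \<ominus> x \<otimes> t' \<in> W (Suc n)"
        using sr by blast
    qed
    then obtain s r where sr: "s \<in> carrier R - Q" "r \<in> carrier R"
        "s \<otimes> y [^] n \<ominus> y [^] Suc n \<otimes> r \<in> sat_hull Q P"
      unfolding W_def by (rule sat_hull_insertD[OF Q Pc, rotated]) (use yc in auto)
    have "sat_hull Q P = P" using sat_hull_of_sat_ideal sat_ideal_prime[OF P] PQ by blast
    moreover have "s \<otimes> y [^] n \<ominus> y [^] Suc n \<otimes> r = y [^] n \<otimes> (s \<ominus> y \<otimes> r)"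
    proof -
      have "y [^] n \<in> carrier R" "s \<in> carrier R" using yc sr by auto
      then show ?thesis unfolding nat_pow_Suc using yc sr(2) by algebra
    qed
    ultimately have "y [^] n \<otimes> (s \<ominus> y \<otimes> r) \<in> P" using sr(3) by simp
    then have "s \<ominus> y \<otimes> r \<in> Q"
      using primeD(5)[OF P, of "y [^] n" "s \<ominus> y \<otimes> r"] ypow[of n] PQ yc sr by auto
    moreover have "y \<otimes> r \<in> Q" using ideal.I_r_closed[OF primeideal.axioms(1)[OF Q]] y sr by blast
    ultimately have "s \<in> Q"
      using ideal.diff_mem_iff[OF primeideal.axioms(1)[OF Q], of s "y \<otimes> r"] yc sr by auto
    then show False using sr by blast
  qed
qed

end

section \<open>Parameters that attain the height of a prime ideal\<close>

context noetherian_cring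
begin

inductive prime_chain :: "'a set \<Rightarrow> nat \<Rightarrow> 'a set \<Rightarrow> bool" where
  prime_chain_0: "primeideal P R \<Longrightarrow> prime_chain P 0 P"
| prime_chain_Suc: "prime_chain P n Q \<Longrightarrow> Q \<subset> N \<Longrightarrow> primeideal N R \<Longrightarrow> prime_chain P (Suc n) N"

lemma prime_chainD:
  assumes "prime_chain P n N"
  shows "primeideal P R" "primeideal N R" "P \<subseteq> N"
  using assms by (induction rule: prime_chain.induct) auto

lemma prime_chain_zeroD: "prime_chain P 0 N \<Longrightarrow> P = N"
  by (erule prime_chain.cases) auto

lemma prime_chain_SucE:
  assumes "prime_chain P (Suc n) N"
  obtains Q where "prime_chain P n Q" "Q \<subset> N" "primeideal N R"
  using assms by (cases rule: prime_chain.cases) auto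

text \<open>
  Moving \<open>x\<close> down the chain with \<open>prime_between\<close> until it lies in the second prime ideal. In other words,
  dividing by one element lowers the dimension by at most one.
\<close>

lemma prime_chain_shift:
  assumes "prime_chain P (Suc n) N" "x \<in> N"
  obtains P' where "P \<subset> P'" "x \<in> P'" "prime_chain P' n N"
  using assms
proof (induction n arbitrary: N thesis)
  case 0
  obtain Q where Q: "prime_chain P 0 Q" "Q \<subset> N" "primeideal N R"
    by (rule prime_chain_SucE[OF "0.prems"(2)])
  have "P \<subset> N" using Q(2) prime_chain_zeroD[OF Q(1)] by simp
  then show ?case by (rule "0.prems"(1)[OF _ "0.prems"(3) prime_chain_0[OF Q(3)]])
next
  case (Suc n)
  obtain Q where Q: "prime_chain P (Suc n) Q" "Q \<subset> N" "primeideal N R"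
    by (rule prime_chain_SucE[OF Suc.prems(2)])
  obtain Q1 where Q1: "prime_chain P n Q1" "Q1 \<subset> Q" "primeideal Q R"
    by (rule prime_chain_SucE[OF Q(1)])
  obtain Q' where Q': "primeideal Q' R" "Q1 \<subset> Q'" "Q' \<subset> N" "x \<in> Q'"
    by (rule prime_between[OF prime_chainD(2)[OF Q1(1)] Q1(3) Q(3) Q1(2) Q(2) Suc.prems(3)])
  obtain P' where P': "P \<subset> P'" "x \<in> P'" "prime_chain P' n Q'"
    by (rule Suc.IH[OF _ prime_chain_Suc[OF Q1(1) Q'(2,1)] Q'(4)])
  show ?case
    by (rule Suc.prems(1)[OF P'(1,2) prime_chain_Suc[OF P'(3) Q'(3) Q(3)]])
qed

text \<open>
  Here \<open>Y\<close> stands for the ideal that one would divide by: \<open>N\<close> is generated, locally at \<open>N\<close>, by \<open>Y\<close> and \<open>X\<close>,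
  and the chain starts above \<open>Y\<close>. An element of \<open>X\<close> is moved to \<open>Y\<close> at the cost of one step of
  the chain.
\<close>

lemma height_le_card_generators:
  assumes "finite X" "N \<subseteq> sat_hull N (Y \<union> X)" "Y \<union> X \<subseteq> N" "Y \<subseteq> P" "prime_chain P n N"
  shows "n \<le> card X"
  using assms
proof (induction X arbitrary: Y P n rule: finite_induct)
  case empty
  have "sat_hull N Y \<subseteq> P"
    using prime_chainD(1,3)[OF empty.prems(4)] empty.prems(3)
    by (intro sat_hull_minimal sat_ideal_prime)
  then have "N \<subseteq> P" using empty.prems(1) by simp
  show ?case
  proof (cases n)
    case (Suc m)
    obtain Q where "prime_chain P m Q" "Q \<subset> N"
      by (rule prime_chain_SucE[OF empty.prems(4)[unfolded Suc]])
    then have False using prime_chainD(3) \<open>N \<subseteq> P\<close> by blast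
    then show ?thesis ..
  qed simp
next
  case (insert x X)
  show ?case
  proof (cases n)
    case (Suc m)
    obtain P' where P': "P \<subset> P'" "x \<in> P'" "prime_chain P' m N"
      by (rule prime_chain_shift[OF insert.prems(4)[unfolded Suc], of x]) (use insert.prems(2) in auto)
    have "m \<le> card X"
      by (rule insert.IH[of "insert x Y" P']) (use insert.prems P' in auto)
    then show ?thesis using Suc insert.hyps by simp
  qed simp
qed

text \<open>
  If the number of remaining generators equals the length of the chain, the ideal divided by is
  prime, in analogy to "a regular local ring is a domain". For \<open>x\<close> in \<open>X\<close>, induction identifies
  the ideal generated by \<open>Y\<close> and \<open>x\<close> with the second prime ideal \<open>P'\<close> of a shifted chain. The height
  bound forces \<open>x \<notin> P\<close>, so every element of \<open>P \<subseteq> P'\<close> is a multiple by \<open>x\<close> of an element of \<open>P\<close>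
  modulo \<open>Y\<close>, and descent applies.
\<close>

lemma sat_hull_eq_prime:
  assumes "finite X" "N \<subseteq> sat_hull N (Y \<union> X)" "Y \<union> X \<subseteq> N" "Y \<subseteq> P" "prime_chain P (card X) N"
  shows "sat_hull N Y = P"
  using assms
proof (induction X arbitrary: Y P rule: finite_induct)
  case empty
  then have P: "P = N" "primeideal N R" using prime_chain_zeroD prime_chainD(2) by auto
  have "sat_hull N Y \<subseteq> P"
    using P empty.prems(3) by (intro sat_hull_minimal sat_ideal_prime) auto
  then show ?case using empty.prems(1) P by auto
next
  case (insert x X)
  note N = prime_chainD(2)[OF insert.prems(4)]
  have P: "primeideal P R" "P \<subseteq> N" by (rule prime_chainD[OF insert.prems(4)])+
  have x: "x \<in> N" using insert.prems(2) by auto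
  have xc: "x \<in> carrier R" using primeD(1)[OF N] x by blast
  have Yc: "Y \<subseteq> carrier R" using insert.prems(2) primeD(1)[OF N] by auto
  have chain: "prime_chain P (Suc (card X)) N" using insert.prems(4) insert.hyps by simp
  obtain P' where P': "P \<subset> P'" "x \<in> P'" "prime_chain P' (card X) N"
    by (rule prime_chain_shift[OF chain x])
  have *: "sat_hull N (insert x Y) = P'"
    by (rule insert.IH) (use insert.prems P' in auto)
  have "x \<notin> P"
  proof
    assume "x \<in> P"
    then have "Suc (card X) \<le> card X"
      by (intro height_le_card_generators[OF insert.hyps(1) _ _ _ chain, of "insert x Y"])
         (use insert.prems in auto)
    then show False by simp
  qed
  have YP: "sat_hull N Y \<subseteq> P"
    using insert.prems(3) P by (intro sat_hull_minimal sat_ideal_prime)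
  have "P \<subseteq> sat_hull N Y"
  proof
    fix q assume "q \<in> P"
    then show "q \<in> sat_hull N Y"
    proof (rule saturated_descent[OF N sat_ideal_sat_hull[OF Yc] x, where T = P and ev = "\<lambda>t. t", rotated 2])
      fix t assume t: "t \<in> P"
      show tc: "t \<in> carrier R" using t primeD(1)[OF P(1)] by blast
      have "t \<in> sat_hull N (insert x Y)" using * t P'(1) by blast
      then obtain s r where sr: "s \<in> carrier R - N" "r \<in> carrier R" "s \<otimes> t \<ominus> x \<otimes> r \<in> sat_hull N Y"
        by (rule sat_hull_insertD[OF N Yc xc])
      have "s \<otimes> t \<ominus> x \<otimes> r \<in> P" using sr(3) YP by blast
      then have "x \<otimes> r \<in> P"
        using sat_ideal_diff_mem_iff[OF sat_ideal_prime[OF P], of "s \<otimes> t" "x \<otimes> r"]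
          sat_idealD(7)[OF sat_ideal_prime[OF P], of s t] sr t tc xc by auto
      then have "r \<in> P" using primeD(5)[OF P(1) xc, of r] sr(2) \<open>x \<notin> P\<close> by blast
      then show "\<exists>t'\<in>P. \<exists>s\<in>carrier R - N. s \<otimes> t \<ominus> x \<otimes> t' \<in> sat_hull N Y"
        using sr by blast
    qed
  qed
  then show ?case using YP by blast
qed

lemma prime_chain_shift_set:
  assumes "finite T" "T \<subseteq> N" "card T \<le> n" "prime_chain P n N"
  obtains P' where "T \<subseteq> P'" "P \<subseteq> P'" "prime_chain P' (n - card T) N"
  using assms
proof (induction T arbitrary: n P thesis rule: finite_induct)
  case empty
  then show ?case by auto
next
  case (insert x T)
  obtain m where n: "n = Suc m" using insert.prems(3) insert.hyps by (cases n) auto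
  obtain P1 where P1: "P \<subset> P1" "x \<in> P1" "prime_chain P1 m N"
    by (rule prime_chain_shift[OF insert.prems(4)[unfolded n], of x]) (use insert.prems(2) in auto)
  obtain P' where P': "T \<subseteq> P'" "P1 \<subseteq> P'" "prime_chain P' (m - card T) N"
    by (rule insert.IH[OF _ _ _ P1(3)]) (use insert.prems insert.hyps n in auto)
  show ?case
    by (rule insert.prems(1)[of P']) (use P' P1 n insert.hyps in auto)
qed

text \<open>
  The elements \<open>f k\<close>, for \<open>k \<in> X\<close>, form a regular sequence at \<open>N\<close> in every order. The family is indexed
  by \<open>X\<close> so that its members can be replaced by powers one at a time.
\<close>

definition permutably_regular :: "'a set \<Rightarrow> 'a set \<Rightarrow> ('a \<Rightarrow> 'a) \<Rightarrow> bool"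
  where "permutably_regular N X f \<longleftrightarrow>
    (\<forall>T k a. T \<subseteq> X \<longrightarrow> k \<in> X - T \<longrightarrow> a \<in> carrier R \<longrightarrow>
       f k \<otimes> a \<in> sat_hull N (f ` T) \<longrightarrow> a \<in> sat_hull N (f ` T))"

text \<open>
  Every subset \<open>T\<close> of \<open>X\<close> generates a prime ideal by \<open>sat_hull_eq_prime\<close>, and by the height bound this
  prime ideal contains no further element of \<open>X\<close>.
\<close>

lemma permutably_regular_generators:
  assumes X: "finite X" "X \<subseteq> N" "N \<subseteq> sat_hull N X"
    and chain: "prime_chain P n N" and n: "card X \<le> n"
  shows "permutably_regular N X (\<lambda>x. x)"
  unfolding permutably_regular_def
proof (intro allI impI)
  fix T k a
  assume T: "T \<subseteq> X" and k: "k \<in> X - T" and a: "a \<in> carrier R"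
    and ka: "k \<otimes> a \<in> sat_hull N ((\<lambda>x. x) ` T)"
  note N = prime_chainD(2)[OF chain]
  have "n \<le> card X"
    by (rule height_le_card_generators[OF X(1) _ _ _ chain, of "{}"]) (use X in auto)
  with n have n: "n = card X" by simp
  have fT: "finite T" using T X(1) finite_subset by blast
  have cT: "card T \<le> card X" using T X(1) by (simp add: card_mono)
  obtain P' where P': "T \<subseteq> P'" "P \<subseteq> P'" "prime_chain P' (n - card T) N"
    by (rule prime_chain_shift_set[OF fT _ _ chain]) (use T X n cT in auto)
  have eq: "T \<union> (X - T) = X" using T by blast
  have T_hull: "sat_hull N T = P'"
    by (rule sat_hull_eq_prime[of "X - T"])
       (use X P' T n eq fT in \<open>auto simp: card_Diff_subset\<close>)
  have "k \<notin> P'"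
  proof
    assume kP: "k \<in> P'"
    have "insert k T \<union> (X - T - {k}) = X" using T k by blast
    then have "n - card T \<le> card (X - T - {k})"
      by (intro height_le_card_generators[OF _ _ _ _ P'(3), of _ "insert k T"])
         (use X P' kP in auto)
    also have "\<dots> < card (X - T)" using X(1) k by (intro card_Diff1_less) auto
    also have "card (X - T) = n - card T" using T fT n by (simp add: card_Diff_subset)
    finally show False by simp
  qed
  moreover have "k \<in> carrier R" using k X primeD(1)[OF N] by blast
  ultimately show "a \<in> sat_hull N ((\<lambda>x. x) ` T)"
    using ka primeD(5)[OF prime_chainD(1)[OF P'(3)] _ a, of k] by (simp add: T_hull)
qed

text \<open>
  If \<open>y\<close> is a nonzerodivisor modulo \<open>Y\<close> and \<open>x\<close> is one modulo \<open>Y + (y)\<close>, then \<open>x\<close> is one modulo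
  \<open>Y + (y\<^sup>n)\<close>. From \<open>x a \<in> Y + (y\<^sup>n\<^sup>+\<^sup>1)\<close> induction gives \<open>a = y\<^sup>n v\<close> modulo \<open>Y\<close>; cancelling \<open>y\<^sup>n\<close> shows
  \<open>x v \<in> Y + (y)\<close>, so \<open>v \<in> Y + (y)\<close>. In the proof \<open>s, t, u\<close> are denominators.
\<close>

lemma nonzerodivisor_mod_power:
  assumes N: "primeideal N R" and c: "Y \<subseteq> carrier R" "x \<in> carrier R" "y \<in> carrier R"
    and x_nzd: "\<And>a. a \<in> carrier R \<Longrightarrow> x \<otimes> a \<in> sat_hull N (insert y Y) \<Longrightarrow> a \<in> sat_hull N (insert y Y)"
    and y_nzd: "\<And>a. a \<in> carrier R \<Longrightarrow> y \<otimes> a \<in> sat_hull N Y \<Longrightarrow> a \<in> sat_hull N Y"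
    and a: "a \<in> carrier R" "x \<otimes> a \<in> sat_hull N (insert (y [^] (n::nat)) Y)"
  shows "a \<in> sat_hull N (insert (y [^] n) Y)"
  using a
proof (induction n arbitrary: a)
  case 0
  have "sat_hull N (insert \<one> Y) = carrier R"
    by (rule sat_ideal_eq_carrier[of N _ \<one>])
       (use sat_ideal_sat_hull[of "insert \<one> Y" N] c sat_hull_contains[of "insert \<one> Y" N] primeD(2)[OF N] in auto)
  then show ?case using 0 by simp
next
  case (Suc n)
  define H where "H i = sat_hull N (insert (y [^] (i::nat)) Y)" for i
  have H: "sat_ideal N (H i)" for i unfolding H_def by (rule sat_ideal_sat_hull) (use c in auto)
  have H1: "sat_hull N (insert y Y) = H 1" using c by (simp add: H_def)
  have H0: "sat_ideal N (sat_hull N Y)" by (rule sat_ideal_sat_hull[OF c(1)])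
  have YH: "sat_hull N Y \<subseteq> H i" for i unfolding H_def by (rule sat_hull_mono) auto
  have yH: "y [^] i \<in> H i" for i
    unfolding H_def using sat_hull_contains[of "insert (y [^] i) Y" N] by blast
  \<comment> \<open>So \<open>a = y\<^sup>n v\<close> modulo \<open>Y\<close>, up to the denominator \<open>s\<close>, by the induction hypothesis.\<close>
  have "H (Suc n) \<subseteq> H n"
    unfolding H_def[of "Suc n"]
    by (rule sat_hull_minimal[OF H])
       (use yH[of n] sat_idealD(8)[OF H[of n]] c YH[of n] sat_hull_contains[of Y N] in auto)
  with Suc.prems have "a \<in> H n" using Suc.IH[OF Suc.prems(1)] by (auto simp: H_def)
  then obtain s v where s: "s \<in> carrier R - N" "v \<in> carrier R" "s \<otimes> a \<ominus> y [^] n \<otimes> v \<in> sat_hull N Y"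
    unfolding H_def by (rule sat_hull_insertD[OF N c(1), rotated]) (use c in auto)
  obtain t b where t: "t \<in> carrier R - N" "b \<in> carrier R"
      "t \<otimes> (x \<otimes> a) \<ominus> y [^] Suc n \<otimes> b \<in> sat_hull N Y"
    by (rule sat_hull_insertD[OF N c(1) _ Suc.prems(2)]) (use c in auto)
  have sc: "s \<in> carrier R" "t \<in> carrier R" and yn: "y [^] n \<in> carrier R" using s t c by auto
  have "s \<otimes> (t \<otimes> (x \<otimes> a) \<ominus> y [^] Suc n \<otimes> b) \<ominus> (t \<otimes> x) \<otimes> (s \<otimes> a \<ominus> y [^] n \<otimes> v) \<in> sat_hull N Y"
    using sc c by (intro sat_idealD(6)[OF H0 sat_idealD(7)[OF H0 _ t(3)] sat_idealD(7)[OF H0 _ s(3)]]) auto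
  also have "s \<otimes> (t \<otimes> (x \<otimes> a) \<ominus> y [^] Suc n \<otimes> b) \<ominus> (t \<otimes> x) \<otimes> (s \<otimes> a \<ominus> y [^] n \<otimes> v)
      = y [^] n \<otimes> ((t \<otimes> x) \<otimes> v \<ominus> y \<otimes> (s \<otimes> b))"
    unfolding nat_pow_Suc using sc yn s(2) t(2) c Suc.prems(1) by algebra
  finally have *: "y [^] n \<otimes> ((t \<otimes> x) \<otimes> v \<ominus> y \<otimes> (s \<otimes> b)) \<in> sat_hull N Y" .
  have ypow: "d \<in> sat_hull N Y" if "d \<in> carrier R" "y [^] i \<otimes> d \<in> sat_hull N Y" for d and i :: nat
    using that
  proof (induction i arbitrary: d)
    case (Suc i)
    then have "y [^] i \<otimes> (y \<otimes> d) \<in> sat_hull N Y" using c by (simp add: m_assoc)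
    then show ?case using Suc.IH[of "y \<otimes> d"] y_nzd[of d] Suc.prems c by simp
  qed simp
  have "(t \<otimes> x) \<otimes> v \<ominus> y \<otimes> (s \<otimes> b) \<in> H 1"
    using ypow[OF _ *] sc s(2) t(2) c YH by auto
  then have "(t \<otimes> x) \<otimes> v \<in> H 1"
    using sat_ideal_diff_mem_iff[OF H[of 1], of "(t \<otimes> x) \<otimes> v" "y \<otimes> (s \<otimes> b)"]
      sat_idealD(8)[OF H[of 1], of "s \<otimes> b" y] yH[of 1] sc s(2) t(2) c by auto
  moreover have "(t \<otimes> x) \<otimes> v = t \<otimes> (x \<otimes> v)" using sc c s(2) by (simp add: m_assoc)
  ultimately have "x \<otimes> v \<in> H 1"
    using sat_idealD(2)[OF H[of 1], of t "x \<otimes> v"] t(1) sc c s(2) by auto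
  then have "v \<in> sat_hull N (insert y Y)" using x_nzd[of v] s(2) H1 by auto
  then obtain u w where u: "u \<in> carrier R - N" "w \<in> carrier R" "u \<otimes> v \<ominus> y \<otimes> w \<in> sat_hull N Y"
    by (rule sat_hull_insertD[OF N c(1) c(3)])
  have uc: "u \<in> carrier R" using u by blast
  have "y [^] n \<otimes> (u \<otimes> v \<ominus> y \<otimes> w) \<oplus> y [^] Suc n \<otimes> w \<in> H (Suc n)"
    using u yn YH[of "Suc n"]
    by (intro sat_idealD(5)[OF H] sat_idealD(7)[OF H yn] sat_idealD(8)[OF H _ yH]) auto
  also have "y [^] n \<otimes> (u \<otimes> v \<ominus> y \<otimes> w) \<oplus> y [^] Suc n \<otimes> w = u \<otimes> (y [^] n \<otimes> v)"
    unfolding nat_pow_Suc using uc yn u(2) s(2) c by algebra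
  finally have "y [^] n \<otimes> v \<in> H (Suc n)"
    using sat_idealD(2)[OF H, of u "y [^] n \<otimes> v"] u uc yn s(2) by auto
  then have "s \<otimes> a \<in> H (Suc n)"
    using sat_ideal_diff_mem_iff[OF H[of "Suc n"], of "s \<otimes> a" "y [^] n \<otimes> v"] s(3) YH[of "Suc n"]
      sc yn s(2) Suc.prems(1) by auto
  then have "a \<in> H (Suc n)"
    using sat_idealD(2)[OF H, of s a] s sc Suc.prems(1) by auto
  then show ?case by (simp only: H_def)
qed

lemma permutably_regular_upd_power:
  assumes N: "primeideal N R" and reg: "permutably_regular N X f" and f: "f ` X \<subseteq> carrier R" and j: "j \<in> X"
  shows "permutably_regular N X (f(j := f j [^] (n::nat)))"
  unfolding permutably_regular_def
proof (intro allI impI)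
  let ?g = "f(j := f j [^] n)"
  have regD: "a \<in> sat_hull N (f ` T)"
    if "T \<subseteq> X" "k \<in> X" "k \<notin> T" "a \<in> carrier R" "f k \<otimes> a \<in> sat_hull N (f ` T)" for T k a
    using reg that unfolding permutably_regular_def by blast
  fix T k a
  assume T: "T \<subseteq> X" and k: "k \<in> X - T" and a: "a \<in> carrier R" and ka: "?g k \<otimes> a \<in> sat_hull N (?g ` T)"
  have fj: "f j \<in> carrier R" using f j by auto
  show "a \<in> sat_hull N (?g ` T)"
  proof (cases "j \<in> T")
    case True
    define Y where "Y = f ` (T - {j})"
    have "f ` T = insert (f j) (f ` (T - {j}))" "?g ` T = insert (f j [^] n) (f ` (T - {j}))"
      using True by auto
    then have im: "insert (f j) Y = f ` T" "?g ` T = insert (f j [^] n) Y" by (simp_all add: Y_def)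
    have "k \<noteq> j" using k True by auto
    have "a \<in> sat_hull N (insert (f j [^] n) Y)"
    proof (rule nonzerodivisor_mod_power[OF N _ _ fj, of Y "f k"])
      show "Y \<subseteq> carrier R" using f T by (auto simp: Y_def)
      show "f k \<in> carrier R" using f k by auto
      show "b \<in> sat_hull N (insert (f j) Y)" if "b \<in> carrier R" "f k \<otimes> b \<in> sat_hull N (insert (f j) Y)" for b
        using regD[OF T _ _ that(1), of k] that(2) k im(1) by simp
      show "b \<in> sat_hull N Y" if "b \<in> carrier R" "f j \<otimes> b \<in> sat_hull N Y" for b
        using regD[of "T - {j}" j b] that T j unfolding Y_def by blast
      show "a \<in> carrier R" by fact
      show "f k \<otimes> a \<in> sat_hull N (insert (f j [^] n) Y)" using ka \<open>k \<noteq> j\<close> im(2) by simp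
    qed
    then show ?thesis using im(2) by simp
  next
    case False
    then have im: "?g ` T = f ` T" by auto
    show ?thesis
    proof (cases "k = j")
      case True
      have "d \<in> sat_hull N (f ` T)" if "d \<in> carrier R" "f j [^] i \<otimes> d \<in> sat_hull N (f ` T)" for d and i :: nat
        using that
      proof (induction i arbitrary: d)
        case (Suc i)
        then have "f j [^] i \<otimes> (f j \<otimes> d) \<in> sat_hull N (f ` T)" using fj by (simp add: m_assoc)
        then show ?case using Suc.IH[of "f j \<otimes> d"] regD[OF T j False, of d] Suc.prems fj by simp
      qed simp
      then show ?thesis using ka a True im by simp
    next
      case False
      then show ?thesis using regD[OF T _ _ a, of k] ka k im by simp
    qed
  qed
qed

lemma permutably_regular_power:
  assumes N: "primeideal N R" and reg: "permutably_regular N X (\<lambda>x. x)" and X: "X \<subseteq> carrier R" "finite X"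
  shows "permutably_regular N X (\<lambda>x. x [^] (n::nat))"
proof -
  have "permutably_regular N X (\<lambda>x. if x \<in> F then x [^] n else x)" if "finite F" "F \<subseteq> X" for F
    using that
  proof (induction F rule: finite_induct)
    case empty
    then show ?case using reg by simp
  next
    case (insert j F)
    define f where "f = (\<lambda>x. if x \<in> F then x [^] n else x)"
    have "f j = j" using insert.hyps by (simp add: f_def)
    then have "(\<lambda>x. if x \<in> insert j F then x [^] n else x) = f(j := f j [^] n)"
      by (auto simp: f_def)
    moreover have "f ` X \<subseteq> carrier R" using X by (auto simp: f_def)
    moreover have "permutably_regular N X f" using insert by (simp add: f_def)
    ultimately show ?case using permutably_regular_upd_power[OF N, of X f j n] insert.prems by simp
  qed
  from this[OF X(2) subset_refl] show ?thesis
    unfolding permutably_regular_def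
  proof (intro allI impI, goal_cases)
    case (1 T k a)
    then have "(\<lambda>x. if x \<in> X then x [^] n else x) ` T = (\<lambda>x. x [^] n) ` T"
      by (intro image_cong) auto
    with 1(1)[rule_format, of T k a] 1(2-5) show ?case by simp
  qed
qed

end

section \<open>The Frobenius endomorphism\<close>

text \<open>
  The induction step is Pascal's rule: \<open>A k\<close> and \<open>B k\<close> are the products of the \<open>k\<close>-th term with \<open>a\<close> and \<open>b\<close>.
\<close>

lemma (in cring) binomial:
  assumes a: "a \<in> carrier R" and b: "b \<in> carrier R"
  shows "(a \<oplus> b) [^] (n::nat) = (\<Oplus>k\<in>{..n}. [(n choose k)] \<cdot> (a [^] k \<otimes> b [^] (n - k)))"
proof (induction n)
  case 0
  then show ?case by simp
next
  case (Suc n)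
  define A where "A k = [(n choose k)] \<cdot> (a [^] Suc k \<otimes> b [^] (n - k))" for k
  define B where "B k = [(n choose k)] \<cdot> (a [^] k \<otimes> b [^] (Suc n - k))" for k
  have AB: "A k \<in> carrier R" "B k \<in> carrier R" for k using a b by (auto simp: A_def B_def)
  have "(a \<oplus> b) [^] Suc n = (\<Oplus>k\<in>{..n}. [(n choose k)] \<cdot> (a [^] k \<otimes> b [^] (n - k))) \<otimes> (a \<oplus> b)"
    by (simp add: Suc)
  also have "\<dots> = (\<Oplus>k\<in>{..n}. [(n choose k)] \<cdot> (a [^] k \<otimes> b [^] (n - k)) \<otimes> (a \<oplus> b))"
    by (rule finsum_ldistr) (use a b in auto)
  also have "\<dots> = (\<Oplus>k\<in>{..n}. A k \<oplus> B k)"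
  proof (rule finsum_cong')
    fix k assume "k \<in> {..n}"
    then have b_Suc: "b [^] (Suc n - k) = b [^] (n - k) \<otimes> b" by (simp add: Suc_diff_le)
    define w where "w = a [^] k \<otimes> b [^] (n - k)"
    have w: "w \<in> carrier R" using a b by (simp add: w_def)
    have "[(n choose k)] \<cdot> w \<otimes> (a \<oplus> b) = [(n choose k)] \<cdot> (w \<otimes> a) \<oplus> [(n choose k)] \<cdot> (w \<otimes> b)"
      using a b w by (simp add: r_distr add_pow_ldistr)
    also have "w \<otimes> a = a [^] Suc k \<otimes> b [^] (n - k)" using a b by (simp add: w_def m_ac)
    also have "w \<otimes> b = a [^] k \<otimes> b [^] (Suc n - k)" using a b by (simp add: w_def b_Suc m_ac)
    finally show "[(n choose k)] \<cdot> (a [^] k \<otimes> b [^] (n - k)) \<otimes> (a \<oplus> b) = A k \<oplus> B k"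
      by (simp add: A_def B_def w_def)
  qed (use AB in auto)
  also have "\<dots> = (\<Oplus>k\<in>{..n}. A k) \<oplus> (\<Oplus>k\<in>{..n}. B k)"
    by (rule finsum_addf) (use AB in auto)
  also have "(\<Oplus>k\<in>{..n}. B k) = (\<Oplus>k\<in>{..Suc n}. B k)"
  proof -
    have "B (Suc n) = \<zero>" by (simp add: B_def binomial_eq_0)
    then show ?thesis using AB finsum_Suc[of B n] by (simp add: finsum_closed Pi_iff)
  qed
  also have "\<dots> = (\<Oplus>k\<in>{..n}. B (Suc k)) \<oplus> B 0"
    by (rule finsum_Suc2) (use AB in auto)
  also have "(\<Oplus>k\<in>{..n}. A k) \<oplus> ((\<Oplus>k\<in>{..n}. B (Suc k)) \<oplus> B 0)
      = (\<Oplus>k\<in>{..n}. A k \<oplus> B (Suc k)) \<oplus> B 0"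
    using AB a b by (subst finsum_addf) (auto simp: a_assoc intro!: finsum_closed)
  also have "(\<Oplus>k\<in>{..n}. A k \<oplus> B (Suc k))
      = (\<Oplus>k\<in>{..n}. [(Suc n choose Suc k)] \<cdot> (a [^] Suc k \<otimes> b [^] (Suc n - Suc k)))"
    by (rule finsum_cong') (use a b in \<open>auto simp: A_def B_def add.nat_pow_mult\<close>)
  also have "\<dots> \<oplus> B 0 = (\<Oplus>k\<in>{..Suc n}. [(Suc n choose k)] \<cdot> (a [^] k \<otimes> b [^] (Suc n - k)))"
    using a b by (subst finsum_Suc2) (auto simp: B_def)
  finally show ?case .
qed

locale char_p_cring = cring R for R (structure) +
  fixes p :: nat
  assumes p_prime: "Factorial_Ring.prime p" and char_p: "[p] \<cdot> \<one> = \<zero>"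
begin

lemma frobenius_add_1:
  assumes a: "a \<in> carrier R" and b: "b \<in> carrier R"
  shows "(a \<oplus> b) [^] p = a [^] p \<oplus> b [^] p"
proof -
  have p: "p \<noteq> 0" using p_prime by auto
  have mult_p: "[(p * k)] \<cdot> x = \<zero>" if "x \<in> carrier R" for k x
  proof -
    have "[p] \<cdot> x = ([p] \<cdot> \<one>) \<otimes> x" using that by (simp add: add_pow_ldistr)
    then have "[p] \<cdot> x = \<zero>" using that by (simp add: char_p)
    then show ?thesis using add.nat_pow_pow[of x k p] that by simp
  qed
  define t where "t k = [(p choose k)] \<cdot> (a [^] k \<otimes> b [^] (p - k))" for k
  have t0: "t k = \<zero>" if "0 < k" "k < p" for k
  proof -
    have "p dvd p choose k" using that p_prime by (intro dvd_choose_prime) auto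
    then obtain m where "p choose k = p * m" ..
    then show ?thesis using a b by (simp add: t_def mult_p)
  qed
  have tc: "t k \<in> carrier R" for k using a b by (auto simp: t_def)
  have "(a \<oplus> b) [^] p = (\<Oplus>k\<in>{..p}. t k)" unfolding t_def by (rule binomial[OF a b])
  also have "\<dots> = (\<Oplus>k\<in>{0, p}. t k)"
    by (rule add.finprod_mono_neutral_cong_right) (use tc t0 in auto)
  also have "\<dots> = t 0 \<oplus> t p" using p tc by (subst finsum_insert) auto
  also have "\<dots> = a [^] p \<oplus> b [^] p" using a b by (simp add: t_def a_comm)
  finally show ?thesis .
qed

lemma frobenius_add:
  assumes "a \<in> carrier R" "b \<in> carrier R"
  shows "(a \<oplus> b) [^] (p ^ e) = a [^] (p ^ e) \<oplus> b [^] (p ^ e)"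
proof (induction e)
  case 0
  show ?case using assms by simp
next
  case (Suc e)
  have pow: "x [^] (p ^ Suc e) = (x [^] (p ^ e)) [^] p" if "x \<in> carrier R" for x
    using that by (simp add: nat_pow_pow mult.commute)
  show ?case using assms by (simp add: pow Suc frobenius_add_1 del: power_Suc)
qed

lemma frobenius_hom: "(\<lambda>x. x [^] (p ^ e)) \<in> ring_hom R R"
  using frobenius_add by (auto simp: ring_hom_def nat_pow_distrib)

lemma frobenius_ring_hom_cring: "ring_hom_cring R R (\<lambda>x. x [^] (p ^ e))"
  using frobenius_hom is_cring
  by (auto simp: ring_hom_cring_def ring_hom_cring_axioms_def)

lemma frobenius_zero: "\<zero> [^] (p ^ e) = \<zero>"
  using ring_hom_zero[OF frobenius_hom ring_axioms ring_axioms, of e] .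

lemma frobenius_vimage_ideal:
  assumes "ideal J R"
  shows "ideal {x \<in> carrier R. x [^] (p ^ e) \<in> J} R"
proof -
  interpret F: ring_hom_cring R R "\<lambda>x. x [^] (p ^ e)" by (rule frobenius_ring_hom_cring)
  show ?thesis by (rule F.ring.ideal_vimage[OF assms])
qed

text \<open>
  Linear combinations of the elements of \<open>U\<close> in \<open>R\<close> as a module over itself through Frobenius: the
  scalar \<open>c u\<close> acts by its \<open>p\<close>-th power.
\<close>

definition p_comb :: "'a set \<Rightarrow> ('a \<Rightarrow> 'a) \<Rightarrow> 'a"
  where "p_comb U c = (\<Oplus>u\<in>U. c u [^] p \<otimes> u)"

lemma p_comb_closed: "U \<subseteq> carrier R \<Longrightarrow> c \<in> U \<rightarrow> carrier R \<Longrightarrow> p_comb U c \<in> carrier R"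
  unfolding p_comb_def by (rule finsum_closed) (auto simp: Pi_iff subset_iff)

lemma p_comb_cong:
  "(\<And>u. u \<in> U \<Longrightarrow> c u = d u) \<Longrightarrow> U \<subseteq> carrier R \<Longrightarrow> d \<in> U \<rightarrow> carrier R \<Longrightarrow> p_comb U c = p_comb U d"
  unfolding p_comb_def by (rule finsum_cong') (auto simp: Pi_iff subset_iff)

lemma p_comb_add:
  assumes "U \<subseteq> carrier R" "c \<in> U \<rightarrow> carrier R" "d \<in> U \<rightarrow> carrier R"
  shows "p_comb U (\<lambda>u. c u \<oplus> d u) = p_comb U c \<oplus> p_comb U d"
proof -
  have "p_comb U (\<lambda>u. c u \<oplus> d u) = (\<Oplus>u\<in>U. c u [^] p \<otimes> u \<oplus> d u [^] p \<otimes> u)"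
    unfolding p_comb_def
    by (rule finsum_cong') (use assms in \<open>auto simp: Pi_iff subset_iff frobenius_add_1 l_distr\<close>)
  also have "\<dots> = p_comb U c \<oplus> p_comb U d"
    unfolding p_comb_def by (rule finsum_addf) (use assms in \<open>auto simp: Pi_iff subset_iff\<close>)
  finally show ?thesis .
qed

lemma p_comb_smult:
  assumes "U \<subseteq> carrier R" "c \<in> U \<rightarrow> carrier R" "r \<in> carrier R"
  shows "p_comb U (\<lambda>u. r \<otimes> c u) = r [^] p \<otimes> p_comb U c"
proof -
  have "p_comb U (\<lambda>u. r \<otimes> c u) = (\<Oplus>u\<in>U. r [^] p \<otimes> (c u [^] p \<otimes> u))"
    unfolding p_comb_def
    by (rule finsum_cong') (use assms in \<open>auto simp: Pi_iff subset_iff nat_pow_distrib m_assoc\<close>)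
  also have "\<dots> = r [^] p \<otimes> p_comb U c"
  proof (cases "finite U")
    case True
    show ?thesis unfolding p_comb_def
      by (rule finsum_rdistr[symmetric]) (use assms True in \<open>auto simp: Pi_iff subset_iff\<close>)
  next
    case False
    then show ?thesis using assms(3) by (simp add: p_comb_def finsum_infinite)
  qed
  finally show ?thesis .
qed

lemma p_comb_diff:
  assumes "U \<subseteq> carrier R" "c \<in> U \<rightarrow> carrier R" "d \<in> U \<rightarrow> carrier R"
  shows "p_comb U (\<lambda>u. c u \<ominus> d u) = p_comb U c \<ominus> p_comb U d"
proof -
  have "p_comb U (\<lambda>u. c u \<ominus> d u) \<oplus> p_comb U d = p_comb U (\<lambda>u. (c u \<ominus> d u) \<oplus> d u)"
    by (rule p_comb_add[symmetric]) (use assms in auto)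
  also have "\<dots> = p_comb U c"
    by (rule p_comb_cong) (use assms in \<open>auto simp: a_minus_def a_assoc l_neg Pi_iff\<close>)
  finally have "p_comb U (\<lambda>u. c u \<ominus> d u) \<oplus> p_comb U d = p_comb U c" .
  note sum = this
  have "p_comb U (\<lambda>u. c u \<ominus> d u) \<in> carrier R" "p_comb U d \<in> carrier R"
    using assms by (auto intro!: p_comb_closed)
  then have "p_comb U (\<lambda>u. c u \<ominus> d u) = (p_comb U (\<lambda>u. c u \<ominus> d u) \<oplus> p_comb U d) \<ominus> p_comb U d"
    by (simp add: a_minus_def a_assoc r_neg)
  also note sum
  finally show ?thesis .
qed

lemma p_comb_remove:
  assumes "U \<subseteq> carrier R" "c \<in> U \<rightarrow> carrier R" "finite U" "v \<in> U" "c v = \<zero>"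
  shows "p_comb (U - {v}) c = p_comb U c"
  unfolding p_comb_def
  by (rule add.finprod_mono_neutral_cong_left)
     (use assms frobenius_zero[of 1] in \<open>auto simp: subset_iff\<close>)

lemma p_comb_mem:
  assumes "ideal J R" "U \<subseteq> carrier R" "finite U" "\<And>u. u \<in> U \<Longrightarrow> c u [^] p \<otimes> u \<in> J"
  shows "p_comb U c \<in> J"
proof -
  interpret J: ideal J R by fact
  show ?thesis
    using assms(3,4,2) unfolding p_comb_def
  proof (induction U rule: finite_induct)
    case (insert u U)
    then show ?case by (subst finsum_insert) auto
  qed simp
qed

end

section \<open>Local freeness over the ring of \<open>p\<close>-th powers\<close>

locale noetherian_char_p_domain = noetherian_cring R + domain R + char_p_cring R p for R (structure) and p
begin

lemma power_notin_prime:
  assumes "primeideal N R" "s \<in> carrier R - N"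
  shows "s [^] (n::nat) \<in> carrier R - N"
proof (induction n)
  case (Suc n)
  then show ?case using prime_mult_notin[OF assms(1) _ assms(2), of "s [^] n"] by simp
qed (use primeD(2)[OF assms(1)] in simp)

lemma power_mem_sat_hull_of_powers:
  assumes Y: "Y \<subseteq> carrier R" and a: "a \<in> sat_hull N Y" and N: "primeideal N R"
  shows "a [^] p \<in> sat_hull N ((\<lambda>x. x [^] p) ` Y)"
proof -
  define H where "H = sat_hull N ((\<lambda>x. x [^] p) ` Y)"
  have H: "sat_ideal N H" unfolding H_def by (rule sat_ideal_sat_hull) (use Y in auto)
  have "sat_ideal N {x \<in> carrier R. x [^] p \<in> H}"
    unfolding sat_ideal_def
  proof (intro conjI ballI impI)
    show "ideal {x \<in> carrier R. x [^] p \<in> H} R"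
      using frobenius_vimage_ideal[OF sat_idealD(1)[OF H], of 1] by simp
    fix s x assume s: "s \<in> carrier R - N" and x: "x \<in> carrier R" "s \<otimes> x \<in> {x \<in> carrier R. x [^] p \<in> H}"
    have "s [^] p \<in> carrier R - N" by (rule power_notin_prime[OF N s])
    then show "x \<in> {x \<in> carrier R. x [^] p \<in> H}"
      using x s sat_idealD(2)[OF H, of "s [^] p" "x [^] p"] by (auto simp: nat_pow_distrib)
  qed
  moreover have "Y \<subseteq> {x \<in> carrier R. x [^] p \<in> H}"
    using Y sat_hull_contains[of "(\<lambda>x. x [^] p) ` Y" N] by (auto simp: H_def)
  ultimately have "sat_hull N Y \<subseteq> {x \<in> carrier R. x [^] p \<in> H}" by (rule sat_hull_minimal)
  then show ?thesis using a by (auto simp: H_def)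
qed

text \<open>
  After inverting \<open>s\<close>, the set \<open>U\<close> generates the Frobenius push-forward.
\<close>

definition p_spans :: "'a \<Rightarrow> 'a set \<Rightarrow> bool"
  where "p_spans s U \<longleftrightarrow> (\<forall>y\<in>carrier R. \<exists>c\<in>U \<rightarrow> carrier R. s \<otimes> y = p_comb U c)"

text \<open>
  A relation with a coefficient outside \<open>N\<close>, a unit at \<open>N\<close>, is what allows a generator to be eliminated.
\<close>

definition p_minimal :: "'a set \<Rightarrow> 'a set \<Rightarrow> bool"
  where "p_minimal N U \<longleftrightarrow>
    (\<forall>c\<in>U \<rightarrow> carrier R. p_comb U c = \<zero> \<longrightarrow> (\<forall>v\<in>U. c v \<in> N))"

text \<open>
  A generating set of smallest size will do: a relation with a coefficient \<open>c v \<notin> N\<close> at \<open>v\<close> allows to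
  eliminate \<open>v\<close>, after multiplying by the \<open>p\<close>-th power of \<open>c v\<close>.
\<close>

lemma minimal_p_spanning_set:
  assumes N: "primeideal N R" and G: "finite G" "G \<subseteq> carrier R" "p_spans \<one> G"
  obtains U s where "U \<subseteq> G" "s \<in> carrier R - N" "p_spans s U"
    "p_minimal N U"
proof -
  define good where "good U \<longleftrightarrow> U \<subseteq> G \<and> (\<exists>s\<in>carrier R - N. p_spans s U)" for U
  have "good G" unfolding good_def using G(3) primeD(2)[OF N] by auto
  then obtain U where U: "good U" and min: "\<And>V. good V \<Longrightarrow> card U \<le> card V"
    using ex_has_least_nat[of good G card] by blast
  then obtain s where s: "s \<in> carrier R - N" "p_spans s U" and UG: "U \<subseteq> G" by (auto simp: good_def)
  have fU: "finite U" and Uc: "U \<subseteq> carrier R" using UG G finite_subset by auto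
  have "c v \<in> N" if c: "c \<in> U \<rightarrow> carrier R" "p_comb U c = \<zero>" and v: "v \<in> U" for c v
  proof (rule ccontr)
    assume "c v \<notin> N"
    then have w: "c v \<in> carrier R - N" using c v by auto
    have "p_spans (c v [^] p \<otimes> s) (U - {v})"
      unfolding p_spans_def
    proof
      fix y assume y: "y \<in> carrier R"
      obtain b where b: "b \<in> U \<rightarrow> carrier R" "s \<otimes> y = p_comb U b"
        using s(2) y unfolding p_spans_def by blast
      \<comment> \<open>Subtracting a multiple of the relation \<open>c\<close> makes the coefficient at \<open>v\<close> vanish.\<close>
      define d where "d u = c v \<otimes> b u \<ominus> b v \<otimes> c u" for u
      have cb: "c u \<in> carrier R" "b u \<in> carrier R" if "u \<in> U" for u using b c that by auto
      have dc: "d \<in> U \<rightarrow> carrier R" using cb v by (auto simp: d_def)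
      have "p_comb U d = p_comb U (\<lambda>u. c v \<otimes> b u) \<ominus> p_comb U (\<lambda>u. b v \<otimes> c u)"
        unfolding d_def by (rule p_comb_diff) (use cb v Uc in auto)
      also have "\<dots> = c v [^] p \<otimes> p_comb U b \<ominus> b v [^] p \<otimes> p_comb U c"
        using p_comb_smult[OF Uc b(1), of "c v"] p_comb_smult[OF Uc c(1), of "b v"] cb v by simp
      also have "\<dots> = (c v [^] p \<otimes> s) \<otimes> y"
        using s(1) y cb[OF v] by (simp add: c(2) b(2)[symmetric] a_minus_def m_assoc)
      finally have "(c v [^] p \<otimes> s) \<otimes> y = p_comb U d" ..
      also have "\<dots> = p_comb (U - {v}) d"
        by (rule p_comb_remove[OF Uc dc fU v, symmetric])
           (use cb[OF v] in \<open>simp add: d_def a_minus_def r_neg m_comm\<close>)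
      finally show "\<exists>d\<in>U - {v} \<rightarrow> carrier R. (c v [^] p \<otimes> s) \<otimes> y = p_comb (U - {v}) d"
        using dc by auto
    qed
    moreover have "c v [^] p \<otimes> s \<in> carrier R - N"
      by (intro prime_mult_notin power_notin_prime N w s)
    ultimately have "good (U - {v})" using UG by (auto simp: good_def)
    then have "card U \<le> card (U - {v})" by (rule min)
    then show False using fU v by (metis card_Diff1_less linorder_not_le)
  qed
  then have "p_minimal N U" unfolding p_minimal_def by blast
  then show ?thesis by (rule that[OF UG s])
qed

text \<open>
  Nakayama's lemma for a minimal generating set: a relation modulo \<open>p\<close>-th powers of elements of \<open>N\<close> has
  its coefficients in \<open>N\<close>. The set \<open>K\<close> consists of the combinations with coefficients in \<open>N\<close>, and \<open>E\<close> is
  its saturation; since \<open>U\<close> spans, \<open>E\<close> is an ideal that contains all \<open>p\<close>-th powers of elements of \<open>X\<close>. Up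
  to a denominator, an element of \<open>E\<close> can be written with coefficients in \<open>N\<close>, so subtracting turns the
  given combination into a true relation.
\<close>

lemma p_comb_coefficients_in_prime:
  assumes N: "primeideal N R" and U: "finite U" "U \<subseteq> carrier R"
    and s: "s \<in> carrier R - N" "p_spans s U"
    and min: "p_minimal N U"
    and X: "X \<subseteq> N"
    and c: "c \<in> U \<rightarrow> carrier R" "p_comb U c \<in> sat_hull N ((\<lambda>x. x [^] p) ` X)" and v: "v \<in> U"
  shows "c v \<in> N"
proof -
  interpret N: primeideal N R by (rule N)
  have Nc: "a \<in> carrier R" if "a \<in> N" for a using that primeD(1)[OF N] by blast
  have sc: "s \<in> carrier R" using s by simp
  have p0: "p \<noteq> 0" using p_prime by auto
  have pow_p: "x [^] p = x \<otimes> x [^] (p - 1)" if "x \<in> carrier R" for x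
    using p0 nat_pow_Suc2[OF that, of "p - 1"] by simp
  define K where "K = {p_comb U c | c. c \<in> U \<rightarrow> N}"
  have NU: "c \<in> U \<rightarrow> carrier R" if "c \<in> U \<rightarrow> N" for c using that Nc by (auto simp: Pi_iff)
  have Kc: "z \<in> carrier R" if "z \<in> K" for z
    using that NU U p_comb_closed by (auto simp: K_def)
  have K_add: "y \<oplus> z \<in> K" if "y \<in> K" "z \<in> K" for y z
  proof -
    from that obtain c d where cd: "c \<in> U \<rightarrow> N" "y = p_comb U c" "d \<in> U \<rightarrow> N" "z = p_comb U d"
      by (auto simp: K_def)
    then have "y \<oplus> z = p_comb U (\<lambda>u. c u \<oplus> d u)" using p_comb_add[OF U(2) NU NU] by simp
    moreover have "(\<lambda>u. c u \<oplus> d u) \<in> U \<rightarrow> N" using cd by auto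
    ultimately show ?thesis unfolding K_def by blast
  qed
  have K_smult: "r [^] p \<otimes> z \<in> K" if "r \<in> carrier R" "z \<in> K" for r z
  proof -
    from that obtain c where c: "c \<in> U \<rightarrow> N" "z = p_comb U c"
      by (auto simp: K_def)
    then have "r [^] p \<otimes> z = p_comb U (\<lambda>u. r \<otimes> c u)" using p_comb_smult[OF U(2) NU that(1)] by simp
    moreover have "(\<lambda>u. r \<otimes> c u) \<in> U \<rightarrow> N" using c that(1) N.I_l_closed by auto
    ultimately show ?thesis unfolding K_def by blast
  qed
  have K_gen: "a [^] p \<otimes> (s [^] p \<otimes> y) \<in> K" if "a \<in> N" "y \<in> carrier R" for a y
  proof -
    note y = \<open>y \<in> carrier R\<close>
    obtain d where d: "d \<in> U \<rightarrow> carrier R" "s \<otimes> (s [^] (p - 1) \<otimes> y) = p_comb U d"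
      using s(2) sc y unfolding p_spans_def by blast
    have "s [^] p \<otimes> y = p_comb U d" using d(2) sc that(2) pow_p[OF sc] by (simp add: m_assoc)
    then have "a [^] p \<otimes> (s [^] p \<otimes> y) = p_comb U (\<lambda>u. a \<otimes> d u)"
      using p_comb_smult[OF U(2) d(1) Nc[OF that(1)]] by simp
    moreover have "(\<lambda>u. a \<otimes> d u) \<in> U \<rightarrow> N" using d that(1) N.I_r_closed by auto
    ultimately show ?thesis unfolding K_def by blast
  qed
  have K_zero: "\<zero> \<in> K"
    using K_gen[of \<zero> \<zero>] sc by simp
  define E where "E = {z \<in> carrier R. \<exists>t\<in>carrier R - N. t [^] p \<otimes> z \<in> K}"
  have E: "ideal E R"
  proof (rule ideal_if_closed)
    show "E \<subseteq> carrier R" by (auto simp: E_def)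
    have "\<one> [^] p \<otimes> \<zero> \<in> K" using K_zero by simp
    then show "\<zero> \<in> E" using primeD(2)[OF N] unfolding E_def by blast
  next
    fix y z assume "y \<in> E" "z \<in> E"
    then obtain t t' where t: "y \<in> carrier R" "t \<in> carrier R - N" "t [^] p \<otimes> y \<in> K"
      "z \<in> carrier R" "t' \<in> carrier R - N" "t' [^] p \<otimes> z \<in> K" by (auto simp: E_def)
    then have "t' [^] p \<otimes> (t [^] p \<otimes> y) \<oplus> t [^] p \<otimes> (t' [^] p \<otimes> z) \<in> K"
      by (intro K_add K_smult[OF _ t(3)] K_smult[OF _ t(6)]) auto
    also have "t' [^] p \<otimes> (t [^] p \<otimes> y) \<oplus> t [^] p \<otimes> (t' [^] p \<otimes> z) = (t \<otimes> t') [^] p \<otimes> (y \<oplus> z)"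
      using t by (simp add: nat_pow_distrib r_distr m_ac)
    finally show "y \<oplus> z \<in> E"
      unfolding E_def using t prime_mult_notin[OF N t(2,5)] by blast
  next
    fix r z assume r: "r \<in> carrier R" and "z \<in> E"
    then obtain t c where t: "z \<in> carrier R" "t \<in> carrier R - N" "c \<in> U \<rightarrow> N" "t [^] p \<otimes> z = p_comb U c"
      by (auto simp: E_def K_def)
    have cu: "c u \<in> carrier R" "u \<in> carrier R" if "u \<in> U" for u using NU[OF t(3)] U(2) that by auto
    have "(s \<otimes> t) [^] p \<otimes> (r \<otimes> z) = (s [^] p \<otimes> r) \<otimes> (t [^] p \<otimes> z)"
      using t(1,2) r sc by (simp add: nat_pow_distrib m_ac)
    also have "\<dots> = (\<Oplus>u\<in>U. (s [^] p \<otimes> r) \<otimes> (c u [^] p \<otimes> u))"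
      unfolding t(4) p_comb_def by (rule finsum_rdistr) (use U sc r cu in auto)
    also have "\<dots> = (\<Oplus>u\<in>U. c u [^] p \<otimes> (s [^] p \<otimes> (r \<otimes> u)))"
      by (rule finsum_cong') (use sc r cu in \<open>auto simp: m_ac\<close>)
    also have "\<dots> \<in> K"
    proof -
      have "(\<Oplus>u\<in>V. c u [^] p \<otimes> (s [^] p \<otimes> (r \<otimes> u))) \<in> K" if "finite V" "V \<subseteq> U" for V
        using that
      proof (induction V rule: finite_induct)
        case empty
        show ?case using K_zero by simp
      next
        case (insert u V)
        then have "c u [^] p \<otimes> (s [^] p \<otimes> (r \<otimes> u)) \<in> K"
          using t(3) cu r by (intro K_gen) auto
        then show ?case
          using insert K_add Kc by (subst finsum_insert) (use sc r cu in \<open>auto simp: subset_iff Pi_iff\<close>)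
      qed
      then show ?thesis using U(1) by blast
    qed
    finally show "r \<otimes> z \<in> E"
      unfolding E_def using r t(1) prime_mult_notin[OF N s(1) t(2)] by blast
  qed
  have "sat_ideal N E"
    unfolding sat_ideal_def
  proof (intro conjI ballI impI)
    show "ideal E R" by (rule E)
    fix r z assume r: "r \<in> carrier R - N" and z: "z \<in> carrier R" and rz: "r \<otimes> z \<in> E"
    have rc: "r \<in> carrier R" using r by simp
    have "r [^] (p - 1) \<otimes> (r \<otimes> z) \<in> E" using ideal.I_l_closed[OF E rz] rc by simp
    then have "r [^] p \<otimes> z \<in> E" using rc z pow_p[OF rc] by (simp add: m_ac)
    then obtain t where t: "t \<in> carrier R - N" "t [^] p \<otimes> (r [^] p \<otimes> z) \<in> K" by (auto simp: E_def)
    have "(t \<otimes> r) [^] p \<otimes> z \<in> K" using t rc z by (simp add: nat_pow_distrib m_assoc)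
    then show "z \<in> E" unfolding E_def using z prime_mult_notin[OF N t(1) r] by blast
  qed
  moreover have "(\<lambda>x. x [^] p) ` X \<subseteq> E"
  proof
    fix z assume "z \<in> (\<lambda>x. x [^] p) ` X"
    then obtain x where x: "x \<in> N" "z = x [^] p" using X by auto
    have "s [^] p \<otimes> z \<in> K"
      using K_gen[OF x(1), of \<one>] Nc[OF x(1)] sc x(2) by (simp add: m_comm)
    then show "z \<in> E" unfolding E_def using s(1) x Nc by auto
  qed
  ultimately have "p_comb U c \<in> E" using c(2) sat_hull_minimal by blast
  then obtain t e where t: "t \<in> carrier R - N" "e \<in> U \<rightarrow> N" "t [^] p \<otimes> p_comb U c = p_comb U e"
    by (auto simp: E_def K_def)
  have tc: "t \<in> carrier R" using t by simp
  have "p_comb U (\<lambda>u. t \<otimes> c u \<ominus> e u) = p_comb U (\<lambda>u. t \<otimes> c u) \<ominus> p_comb U e"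
    by (rule p_comb_diff) (use U tc c(1) NU[OF t(2)] in auto)
  also have "\<dots> = \<zero>"
    using p_comb_smult[OF U(2) c(1) tc] t(3) p_comb_closed[OF U(2) NU[OF t(2)]]
    by (simp add: a_minus_def r_neg)
  finally have "t \<otimes> c v \<ominus> e v \<in> N"
    by (intro min[unfolded p_minimal_def, rule_format, OF _ _ v, of "\<lambda>u. t \<otimes> c u \<ominus> e u"])
       (use tc c(1) NU[OF t(2)] in auto)
  then have "t \<otimes> c v \<in> N"
    using N.diff_mem_iff[of "t \<otimes> c v" "e v"] t(2) NU[OF t(2)] c(1) v tc by auto
  then show ?thesis using primeD(5)[OF N tc, of "c v"] c(1) v t(1) by auto
qed

lemma common_denominator:
  assumes N: "primeideal N R" and J: "sat_ideal N J" and x: "x \<in> carrier R"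
    and "finite U" and "\<And>u. u \<in> U \<Longrightarrow> c u \<in> carrier R"
    and "\<And>u. u \<in> U \<Longrightarrow> \<exists>s\<in>carrier R - N. \<exists>r\<in>carrier R. s \<otimes> c u \<ominus> x \<otimes> r \<in> J"
  shows "\<exists>s\<in>carrier R - N. \<forall>u\<in>U. \<exists>r\<in>carrier R. s \<otimes> c u \<ominus> x \<otimes> r \<in> J"
  using assms(4-6)
proof (induction U rule: finite_induct)
  case empty
  then show ?case using primeD(2)[OF N] by auto
next
  case (insert v U)
  have mult: "\<exists>r'\<in>carrier R. (t \<otimes> s) \<otimes> a \<ominus> x \<otimes> r' \<in> J"
    if "\<exists>r\<in>carrier R. s \<otimes> a \<ominus> x \<otimes> r \<in> J" "s \<in> carrier R" "t \<in> carrier R" "a \<in> carrier R" for s t a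
  proof -
    from that(1) obtain r where r: "r \<in> carrier R" "s \<otimes> a \<ominus> x \<otimes> r \<in> J" by blast
    have "t \<otimes> (s \<otimes> a \<ominus> x \<otimes> r) \<in> J" by (rule sat_idealD(7)[OF J that(3) r(2)])
    also have "t \<otimes> (s \<otimes> a \<ominus> x \<otimes> r) = (t \<otimes> s) \<otimes> a \<ominus> x \<otimes> (t \<otimes> r)"
      using that x r by algebra
    finally show ?thesis using that r by blast
  qed
  obtain s where s: "s \<in> carrier R - N" "\<forall>u\<in>U. \<exists>r\<in>carrier R. s \<otimes> c u \<ominus> x \<otimes> r \<in> J"
    using insert.IH insert.prems by auto
  obtain t where t: "t \<in> carrier R - N" "\<exists>r\<in>carrier R. t \<otimes> c v \<ominus> x \<otimes> r \<in> J"
    using insert.prems(2)[of v] by auto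
  have sc: "s \<in> carrier R" "t \<in> carrier R" using s t by auto
  have "\<exists>r\<in>carrier R. (s \<otimes> t) \<otimes> c u \<ominus> x \<otimes> r \<in> J" if u: "u \<in> insert v U" for u
  proof (cases "u = v")
    case True
    then show ?thesis using mult[OF t(2) sc(2,1)] insert.prems(1) by simp
  next
    case False
    then show ?thesis using mult[of s "c u" t] s(2) sc insert.prems(1) u by (simp add: m_comm[of s t])
  qed
  then show ?case using prime_mult_notin[OF N s(1) t(1)] by blast
qed

text \<open>
  By induction on the number of elements of \<open>X\<close> outside \<open>T\<close>, starting from \<open>p_comb_coefficients_in_prime\<close>
  at \<open>T = X\<close>. For \<open>x \<in> X - T\<close>, the coefficients of a relation modulo \<open>p\<close>-th powers of \<open>T\<close> lie in the ideal of
  \<open>T\<close> and \<open>x\<close> by induction, that is, \<open>c = x d\<close> modulo \<open>T\<close>. Then \<open>x\<^sup>p\<close> times the combination with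
  coefficients \<open>d\<close> vanishes modulo the \<open>p\<close>-th powers of \<open>T\<close>, where \<open>x\<^sup>p\<close> is a nonzerodivisor. Thus \<open>d\<close>
  is again a relation, and descent applies to each coefficient.
\<close>

lemma p_comb_coefficients_in_sat_hull:
  assumes N: "primeideal N R" and U: "finite U" "U \<subseteq> carrier R"
    and s: "s \<in> carrier R - N" "p_spans s U"
    and min: "p_minimal N U"
    and X: "finite X" "X \<subseteq> N" "N \<subseteq> sat_hull N X"
    and reg: "permutably_regular N X (\<lambda>x. x [^] p)"
    and T: "T \<subseteq> X"
    and c: "c \<in> U \<rightarrow> carrier R" "p_comb U c \<in> sat_hull N ((\<lambda>x. x [^] p) ` T)" and v: "v \<in> U"
  shows "c v \<in> sat_hull N T"
  using T c v
proof (induction "card (X - T)" arbitrary: T c v rule: less_induct)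
  case less
  note Nc = primeD(1)[OF N]
  have Tc: "T \<subseteq> carrier R" using less.prems(1) X(2) Nc by blast
  show ?case
  proof (cases "T = X")
    case True
    then have "c v \<in> N"
      using p_comb_coefficients_in_prime[OF N U s min X(2) less.prems(2) _ less.prems(4)]
        less.prems(3) by simp
    then show ?thesis using X(3) True by blast
  next
    case False
    then obtain x where x: "x \<in> X" "x \<notin> T" using less.prems(1) by blast
    have xN: "x \<in> N" and xc: "x \<in> carrier R" using x X(2) Nc by auto
    define J where "J = sat_hull N T"
    define H where "H = sat_hull N ((\<lambda>x. x [^] p) ` T)"
    have J: "sat_ideal N J" unfolding J_def by (rule sat_ideal_sat_hull[OF Tc])
    have H: "sat_ideal N H" unfolding H_def by (rule sat_ideal_sat_hull) (use Tc in auto)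
    have card: "card (X - insert x T) < card (X - T)"
      using x X(1) by (intro psubset_card_mono) auto
    define \<C> where "\<C> = {c \<in> U \<rightarrow> carrier R. p_comb U c \<in> H}"
    have "c v \<in> J"
    proof (rule saturated_descent[OF N J xN, where T = \<C> and ev = "\<lambda>c. c v"])
      show "c \<in> \<C>" using less.prems(2,3) by (simp add: \<C>_def H_def)
    next
      fix c assume "c \<in> \<C>"
      then have c: "c \<in> U \<rightarrow> carrier R" "p_comb U c \<in> H" by (auto simp: \<C>_def)
      show "c v \<in> carrier R" using c less.prems(4) by auto
      have "H \<subseteq> sat_hull N ((\<lambda>x. x [^] p) ` insert x T)"
        unfolding H_def by (rule sat_hull_mono) auto
      then have ch: "p_comb U c \<in> sat_hull N ((\<lambda>x. x [^] p) ` insert x T)" using c by blast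
      have "c u \<in> sat_hull N (insert x T)" if "u \<in> U" for u
        using less.hyps[OF card _ c(1) ch that] less.prems(1) x by simp
      then have "\<exists>s\<in>carrier R - N. \<exists>r\<in>carrier R. s \<otimes> c u \<ominus> x \<otimes> r \<in> J" if "u \<in> U" for u
        unfolding J_def by (rule sat_hull_insertD[OF N Tc xc]) (use that in blast)+
      then obtain t where t: "t \<in> carrier R - N" "\<forall>u\<in>U. \<exists>r\<in>carrier R. t \<otimes> c u \<ominus> x \<otimes> r \<in> J"
        using common_denominator[OF N J xc U(1), of c] c(1) by auto
      from t(2) have "\<exists>d. \<forall>u\<in>U. d u \<in> carrier R \<and> t \<otimes> c u \<ominus> x \<otimes> d u \<in> J"
        by (intro bchoice) blast
      then obtain d where d: "\<And>u. u \<in> U \<Longrightarrow> d u \<in> carrier R" "\<And>u. u \<in> U \<Longrightarrow> t \<otimes> c u \<ominus> x \<otimes> d u \<in> J"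
        by blast
      have dU: "d \<in> U \<rightarrow> carrier R" using d by auto
      have tc: "t \<in> carrier R" using t by simp
      have "(t \<otimes> c u \<ominus> x \<otimes> d u) [^] p \<otimes> u \<in> H" if u: "u \<in> U" for u
      proof -
        have "(t \<otimes> c u \<ominus> x \<otimes> d u) [^] p \<in> H"
          unfolding H_def
          by (rule power_mem_sat_hull_of_powers[OF Tc _ N]) (use d(2)[OF u] in \<open>simp add: J_def\<close>)
        then show ?thesis using sat_idealD(8)[OF H] U(2) u by blast
      qed
      then have "p_comb U (\<lambda>u. t \<otimes> c u \<ominus> x \<otimes> d u) \<in> H"
        by (rule p_comb_mem[OF sat_idealD(1)[OF H] U(2,1)])
      also have "p_comb U (\<lambda>u. t \<otimes> c u \<ominus> x \<otimes> d u) = t [^] p \<otimes> p_comb U c \<ominus> x [^] p \<otimes> p_comb U d"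
        using p_comb_diff[OF U(2), of "\<lambda>u. t \<otimes> c u" "\<lambda>u. x \<otimes> d u"]
          p_comb_smult[OF U(2) c(1) tc] p_comb_smult[OF U(2) dU xc] c(1) dU tc xc by (auto simp: Pi_iff)
      finally have "x [^] p \<otimes> p_comb U d \<in> H"
        using sat_ideal_diff_mem_iff[OF H, of "t [^] p \<otimes> p_comb U c" "x [^] p \<otimes> p_comb U d"]
          sat_idealD(7)[OF H _ c(2), of "t [^] p"] p_comb_closed[OF U(2) c(1)] p_comb_closed[OF U(2) dU] tc xc
        by simp
      then have "p_comb U d \<in> H"
        using reg less.prems(1) x p_comb_closed[OF U(2) dU] unfolding permutably_regular_def H_def by blast
      then have "d \<in> \<C>" using dU by (simp add: \<C>_def)
      moreover have "t \<otimes> c v \<ominus> x \<otimes> d v \<in> J" using d(2) less.prems(4) by blast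
      ultimately show "\<exists>d\<in>\<C>. \<exists>t\<in>carrier R - N. t \<otimes> c v \<ominus> x \<otimes> d v \<in> J" using t(1) by blast
    qed
    then show ?thesis by (simp add: J_def)
  qed
qed

text \<open>
  Kunz's theorem at \<open>N\<close>: if \<open>N\<close> is generated locally by at most as many elements as a chain of prime
  ideals below it has steps, then the Frobenius push-forward is free at \<open>N\<close>. The element \<open>s\<close>
  is a common denominator, and the coordinates of \<open>s y\<close> in a basis \<open>U\<close> are Cartier maps of \<open>y\<close> because
  they are unique.
\<close>

lemma frobenius_dual_basis:
  assumes N: "primeideal N R" and G: "finite G" "G \<subseteq> carrier R" "p_spans \<one> G"
    and X: "finite X" "X \<subseteq> N" "N \<subseteq> sat_hull N X"
    and chain: "prime_chain P n N" "card X \<le> n"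
  obtains U s \<phi> where "finite U" "U \<subseteq> carrier R" "s \<in> carrier R - N"
    "\<And>u. u \<in> U \<Longrightarrow> \<phi> u \<in> cartier_maps p 1 R"
    "\<And>y. y \<in> carrier R \<Longrightarrow> s \<otimes> y = (\<Oplus>u\<in>U. \<phi> u y [^] p \<otimes> u)"
proof -
  obtain U s where UG: "U \<subseteq> G" and s: "s \<in> carrier R - N" "p_spans s U"
    and min: "p_minimal N U"
    by (rule minimal_p_spanning_set[OF N G])
  have U: "finite U" "U \<subseteq> carrier R" using UG G finite_subset by auto
  have Xc: "X \<subseteq> carrier R" using X(2) primeD(1)[OF N] by blast
  have reg: "permutably_regular N X (\<lambda>x. x [^] p)"
    by (intro permutably_regular_power permutably_regular_generators[OF X chain] N Xc X)
  have "sat_ideal N {\<zero>}"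
    unfolding sat_ideal_def using zeroideal primeD(4)[OF N] integral by blast
  then have hull0: "sat_hull N {} = {\<zero>}"
    using sat_hull_minimal[of N "{\<zero>}" "{}"] sat_idealD(4)[OF sat_ideal_sat_hull[of "{}" N]] by auto
  have indep: "c v = \<zero>" if "c \<in> U \<rightarrow> carrier R" "p_comb U c = \<zero>" "v \<in> U" for c v
    using p_comb_coefficients_in_sat_hull[OF N U s min X reg, of "{}" c v] that hull0 by simp
  have unique: "c v = d v"
    if "c \<in> U \<rightarrow> carrier R" "d \<in> U \<rightarrow> carrier R" "p_comb U c = p_comb U d" "v \<in> U" for c d v
  proof -
    have "p_comb U (\<lambda>u. c u \<ominus> d u) = \<zero>"
      using p_comb_diff[OF U(2) that(1,2)] that(3) p_comb_closed[OF U(2) that(2)] by (simp add: a_minus_def r_neg)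
    then have "c v \<ominus> d v = \<zero>" using indep[of "\<lambda>u. c u \<ominus> d u" v] that by auto
    then show ?thesis using that(1,2,4) by (metis Pi_iff r_right_minus_eq)
  qed
  have "\<exists>C. \<forall>y\<in>carrier R. C y \<in> U \<rightarrow> carrier R \<and> s \<otimes> y = p_comb U (C y)"
    using s(2) unfolding p_spans_def by (intro bchoice) blast
  then obtain C where C: "\<And>y. y \<in> carrier R \<Longrightarrow> C y \<in> U \<rightarrow> carrier R"
    "\<And>y. y \<in> carrier R \<Longrightarrow> s \<otimes> y = p_comb U (C y)" by blast
  have sc: "s \<in> carrier R" using s by simp
  have "(\<lambda>y. C y u) \<in> cartier_maps p 1 R" if u: "u \<in> U" for u
    unfolding cartier_maps_def
  proof (intro CollectI conjI ballI)
    show "(\<lambda>y. C y u) \<in> carrier R \<rightarrow> carrier R" using C(1) u by auto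
  next
    fix x y assume x: "x \<in> carrier R" and y: "y \<in> carrier R"
    have "p_comb U (C (x \<oplus> y)) = p_comb U (\<lambda>u. C x u \<oplus> C y u)"
      using C[OF x] C[OF y] C(2)[of "x \<oplus> y"] p_comb_add[OF U(2), of "C x" "C y"] sc x y by (simp add: r_distr)
    then show "C (x \<oplus> y) u = C x u \<oplus> C y u"
      using unique[of "C (x \<oplus> y)" "\<lambda>u. C x u \<oplus> C y u" u] C(1) x y u by auto
  next
    fix r y assume r: "r \<in> carrier R" and y: "y \<in> carrier R"
    have "p_comb U (C (r [^] p \<otimes> y)) = s \<otimes> (r [^] p \<otimes> y)" using C(2)[of "r [^] p \<otimes> y"] r y by simp
    also have "\<dots> = r [^] p \<otimes> (s \<otimes> y)" using sc r y by (simp add: m_lcomm)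
    also have "\<dots> = p_comb U (\<lambda>u. r \<otimes> C y u)"
      unfolding C(2)[OF y] by (rule p_comb_smult[OF U(2) C(1)[OF y] r, symmetric])
    finally have "p_comb U (C (r [^] p \<otimes> y)) = p_comb U (\<lambda>u. r \<otimes> C y u)" .
    then show "C (r [^] (p ^ 1) \<otimes> y) u = r \<otimes> C y u"
      using unique[of "C (r [^] p \<otimes> y)" "\<lambda>u. r \<otimes> C y u" u] C(1) r y u by auto
  qed
  then show ?thesis
    using that[of U s "\<lambda>u y. C y u"] U s(1) C(2) unfolding p_comb_def by blast
qed

end

section \<open>Parameters from a regular localization\<close>

lemma (in domain) fraction_iff:
  assumes P: "primeideal P R" and a: "a \<in> carrier R" and s: "s \<in> carrier R - P"
  shows "(b, t) \<in> fraction R (carrier R - P) a s \<longleftrightarrow>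
    b \<in> carrier R \<and> t \<in> carrier R - P \<and> t \<otimes> a = s \<otimes> b"
proof -
  interpret P: primeideal P R by (rule P)
  have "(\<exists>u\<in>carrier R - P. u \<otimes> (t \<otimes> a \<ominus> s \<otimes> b) = \<zero>) \<longleftrightarrow> t \<otimes> a = s \<otimes> b"
    if b: "b \<in> carrier R" "t \<in> carrier R"
  proof
    assume "\<exists>u\<in>carrier R - P. u \<otimes> (t \<otimes> a \<ominus> s \<otimes> b) = \<zero>"
    then obtain u where u: "u \<in> carrier R" "u \<notin> P" "u \<otimes> (t \<otimes> a \<ominus> s \<otimes> b) = \<zero>" by auto
    have "u \<noteq> \<zero>" using u(2) P.zero_closed by metis
    then have "t \<otimes> a \<ominus> s \<otimes> b = \<zero>" using u integral[OF u(3)] b a s by auto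
    then show "t \<otimes> a = s \<otimes> b" using a b s by (auto simp: r_right_minus_eq)
  next
    assume "t \<otimes> a = s \<otimes> b"
    then have "\<one> \<otimes> (t \<otimes> a \<ominus> s \<otimes> b) = \<zero>" using a b s by (simp add: a_minus_def r_neg)
    moreover have "\<one> \<in> carrier R - P" using P.one_imp_carrier P.I_notcarr by blast
    ultimately show "\<exists>u\<in>carrier R - P. u \<otimes> (t \<otimes> a \<ominus> s \<otimes> b) = \<zero>" by blast
  qed
  then show ?thesis unfolding fraction_def by blast
qed

lemma (in domain) fraction_eqI:
  assumes P: "primeideal P R" and "a \<in> carrier R" "s \<in> carrier R - P" "b \<in> carrier R" "t \<in> carrier R - P"
    and eq: "t \<otimes> a = s \<otimes> b"
  shows "fraction R (carrier R - P) a s = fraction R (carrier R - P) b t"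
proof -
  interpret P: primeideal P R by (rule P)
  have *: "fraction R (carrier R - P) a s \<subseteq> fraction R (carrier R - P) b t"
    if a: "a \<in> carrier R" and s: "s \<in> carrier R - P" and b: "b \<in> carrier R" and t: "t \<in> carrier R - P"
      and eq: "t \<otimes> a = s \<otimes> b" for a b s t
  proof (rule subrelI)
    fix c w assume "(c, w) \<in> fraction R (carrier R - P) a s"
    then have c: "c \<in> carrier R" "w \<in> carrier R - P" "w \<otimes> a = s \<otimes> c"
      using fraction_iff[OF P a s] by auto
    have "s \<otimes> (w \<otimes> b) = w \<otimes> (t \<otimes> a)" using c s b t eq by (simp add: m_lcomm)
    also have "\<dots> = t \<otimes> (w \<otimes> a)" using c t a by (simp add: m_lcomm)
    also have "\<dots> = s \<otimes> (t \<otimes> c)" using c t s by (simp add: m_lcomm)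
    finally have "w \<otimes> b = t \<otimes> c"
      using m_lcancel[of s "w \<otimes> b" "t \<otimes> c"] s c t b P.zero_closed by (metis DiffE m_closed)
    then show "(c, w) \<in> fraction R (carrier R - P) b t" using fraction_iff[OF P b t] c by auto
  qed
  show ?thesis using *[of a s b t] *[of b t a s] assms by (metis subset_antisym)
qed

lemma UN_pairs_constant:
  assumes eq: "\<And>a s b t. (a, s) \<in> F \<Longrightarrow> (b, t) \<in> G \<Longrightarrow> f a s b t = C"
    and "(a0, s0) \<in> F" "(b0, t0) \<in> G"
  shows "(\<Union>(a, s)\<in>F. \<Union>(b, t)\<in>G. f a s b t) = C"
proof
  show "(\<Union>(a, s)\<in>F. \<Union>(b, t)\<in>G. f a s b t) \<subseteq> C"
    using eq by (intro UN_least) (auto simp: split_beta)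
  show "C \<subseteq> (\<Union>(a, s)\<in>F. \<Union>(b, t)\<in>G. f a s b t)"
    using eq[OF assms(2,3)] assms(2,3) by blast
qed

text \<open>
  Apart from its regularity, only these properties of the localization and of the map \<open>a \<mapsto> a/1\<close> are used: every
  element becomes a numerator after multiplication by a denominator, denominators are units, and no
  nonzero element of a domain is lost.
\<close>

lemma (in domain) localization_at_canonical_map:
  assumes P: "primeideal P R"
  obtains h :: "'a \<Rightarrow> ('a \<times> 'a) set" where "h \<in> ring_hom R (localization_at R P)"
    "\<And>z. z \<in> carrier (localization_at R P) \<Longrightarrow>
      \<exists>s\<in>carrier R - P. \<exists>a\<in>carrier R. h s \<otimes>\<^bsub>localization_at R P\<^esub> z = h a"
    "\<And>s. s \<in> carrier R - P \<Longrightarrow>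
      \<exists>z\<in>carrier (localization_at R P). h s \<otimes>\<^bsub>localization_at R P\<^esub> z = \<one>\<^bsub>localization_at R P\<^esub>"
    "inj_on h (carrier R)"
proof -
  interpret P: primeideal P R by (rule P)
  let ?A = "localization_at R P"
  define M where "M = carrier R - P"
  let ?fr = "fraction R M"
  have M1: "\<one> \<in> M" using P.one_imp_carrier P.I_notcarr by (auto simp: M_def)
  have Mm: "s \<otimes> t \<in> M" if "s \<in> M" "t \<in> M" for s t using that P.I_prime by (auto simp: M_def)
  have Mc: "s \<in> carrier R" if "s \<in> M" for s using that by (simp add: M_def)
  note fr_iff = fraction_iff[OF P, folded M_def] and fr_eq = fraction_eqI[OF P, folded M_def]
  have self: "(a, s) \<in> ?fr a s" if "a \<in> carrier R" "s \<in> M" for a s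
    using that fr_iff by (auto simp: Mc m_comm)
  have mult: "?fr a s \<otimes>\<^bsub>?A\<^esub> ?fr b t = ?fr (a \<otimes> b) (s \<otimes> t)"
    if "a \<in> carrier R" "s \<in> M" "b \<in> carrier R" "t \<in> M" for a s b t
  proof -
    have "?fr (a' \<otimes> b') (s' \<otimes> t') = ?fr (a \<otimes> b) (s \<otimes> t)"
      if "(a', s') \<in> ?fr a s" "(b', t') \<in> ?fr b t" for a' s' b' t'
    proof -
      from that have 1: "a' \<in> carrier R" "s' \<in> M" "s' \<otimes> a = s \<otimes> a'" "b' \<in> carrier R" "t' \<in> M" "t' \<otimes> b = t \<otimes> b'"
        using fr_iff \<open>a \<in> carrier R\<close> \<open>s \<in> M\<close> \<open>b \<in> carrier R\<close> \<open>t \<in> M\<close> by auto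
      note c = 1 \<open>a \<in> carrier R\<close> \<open>s \<in> M\<close> \<open>b \<in> carrier R\<close> \<open>t \<in> M\<close>
      have "(s \<otimes> t) \<otimes> (a' \<otimes> b') = (s \<otimes> a') \<otimes> (t \<otimes> b')" using c Mc by (simp add: m_ac)
      also have "\<dots> = (s' \<otimes> a) \<otimes> (t' \<otimes> b)" using 1(3,6) by simp
      also have "\<dots> = (s' \<otimes> t') \<otimes> (a \<otimes> b)" using c(1,2,4,5,7-) Mc by (simp add: m_ac)
      finally show ?thesis using c Mm by (intro fr_eq) auto
    qed
    moreover have "(a, s) \<in> ?fr a s" "(b, t) \<in> ?fr b t" using self that by auto
    ultimately have "(\<Union>(a', s')\<in>?fr a s. \<Union>(b', t')\<in>?fr b t. ?fr (a' \<otimes> b') (s' \<otimes> t'))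
        = ?fr (a \<otimes> b) (s \<otimes> t)"
      by (rule UN_pairs_constant)
    then show ?thesis by (simp add: localization_at_def localization_def M_def)
  qed
  have add: "?fr a s \<oplus>\<^bsub>?A\<^esub> ?fr b t = ?fr (t \<otimes> a \<oplus> s \<otimes> b) (s \<otimes> t)"
    if "a \<in> carrier R" "s \<in> M" "b \<in> carrier R" "t \<in> M" for a s b t
  proof -
    have "?fr (t' \<otimes> a' \<oplus> s' \<otimes> b') (s' \<otimes> t') = ?fr (t \<otimes> a \<oplus> s \<otimes> b) (s \<otimes> t)"
      if "(a', s') \<in> ?fr a s" "(b', t') \<in> ?fr b t" for a' s' b' t'
    proof -
      from that have 1: "a' \<in> carrier R" "s' \<in> M" "s' \<otimes> a = s \<otimes> a'" "b' \<in> carrier R" "t' \<in> M" "t' \<otimes> b = t \<otimes> b'"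
        using fr_iff \<open>a \<in> carrier R\<close> \<open>s \<in> M\<close> \<open>b \<in> carrier R\<close> \<open>t \<in> M\<close> by auto
      note c = 1 \<open>a \<in> carrier R\<close> \<open>s \<in> M\<close> \<open>b \<in> carrier R\<close> \<open>t \<in> M\<close>
      have "(s \<otimes> t) \<otimes> (t' \<otimes> a' \<oplus> s' \<otimes> b') = (t \<otimes> t') \<otimes> (s \<otimes> a') \<oplus> (s \<otimes> s') \<otimes> (t \<otimes> b')"
        using c(1,2,4,5,7-) Mc by (simp add: m_ac r_distr)
      also have "\<dots> = (t \<otimes> t') \<otimes> (s' \<otimes> a) \<oplus> (s \<otimes> s') \<otimes> (t' \<otimes> b)" using 1(3,6) by simp
      also have "\<dots> = (s' \<otimes> t') \<otimes> (t \<otimes> a \<oplus> s \<otimes> b)" using c(1,2,4,5,7-) Mc by (simp add: m_ac r_distr)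
      finally show ?thesis using c Mm Mc by (intro fr_eq) auto
    qed
    moreover have "(a, s) \<in> ?fr a s" "(b, t) \<in> ?fr b t" using self that by auto
    ultimately have "(\<Union>(a', s')\<in>?fr a s. \<Union>(b', t')\<in>?fr b t. ?fr (t' \<otimes> a' \<oplus> s' \<otimes> b') (s' \<otimes> t'))
        = ?fr (t \<otimes> a \<oplus> s \<otimes> b) (s \<otimes> t)"
      by (rule UN_pairs_constant)
    then show ?thesis by (simp add: localization_at_def localization_def M_def)
  qed
  have carr: "carrier ?A = {?fr a s | a s. a \<in> carrier R \<and> s \<in> M}" and one: "\<one>\<^bsub>?A\<^esub> = ?fr \<one> \<one>"
    by (simp_all add: localization_at_def localization_def M_def)
  define h where "h a = ?fr a \<one>" for a
  show ?thesis
  proof (rule that[of h, folded M_def])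
    show "h \<in> ring_hom R ?A"
      unfolding ring_hom_def h_def
      using mult[OF _ M1 _ M1] add[OF _ M1 _ M1] M1 by (auto simp: carr one)
    show "\<exists>s\<in>M. \<exists>a\<in>carrier R. h s \<otimes>\<^bsub>?A\<^esub> z = h a" if "z \<in> carrier ?A" for z
    proof -
      from that obtain a s where a: "z = ?fr a s" "a \<in> carrier R" "s \<in> M" by (auto simp: carr)
      have "h s \<otimes>\<^bsub>?A\<^esub> z = ?fr (s \<otimes> a) (\<one> \<otimes> s)" using mult[of s \<one> a s] a M1 Mc by (simp add: h_def)
      also have "\<dots> = h a" unfolding h_def using a M1 Mc by (intro fr_eq) (auto simp: m_comm)
      finally show ?thesis using a by blast
    qed
    show "\<exists>z\<in>carrier ?A. h s \<otimes>\<^bsub>?A\<^esub> z = \<one>\<^bsub>?A\<^esub>" if s: "s \<in> M" for s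
    proof
      show "?fr \<one> s \<in> carrier ?A" using s by (auto simp: carr)
      have "h s \<otimes>\<^bsub>?A\<^esub> ?fr \<one> s = ?fr (s \<otimes> \<one>) (\<one> \<otimes> s)"
        using mult[of s \<one> \<one> s] s M1 Mc by (simp add: h_def)
      also have "\<dots> = ?fr \<one> \<one>" using s M1 Mc by (intro fr_eq) auto
      finally show "h s \<otimes>\<^bsub>?A\<^esub> ?fr \<one> s = \<one>\<^bsub>?A\<^esub>" by (simp add: one)
    qed
    show "inj_on h (carrier R)"
    proof (rule inj_onI)
      fix a b assume ab: "a \<in> carrier R" "b \<in> carrier R" "h a = h b"
      then have "(b, \<one>) \<in> ?fr a \<one>" using self[of b \<one>] M1 by (simp add: h_def)
      then show "a = b" using fr_iff[OF ab(1) M1] ab by simp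
    qed
  qed
qed

lemma Sup_enat_attained:
  assumes "Sup {enat n | n. \<phi> n} = enat d" "d \<noteq> 0"
  shows "\<phi> d"
proof -
  let ?K = "{enat n | n. \<phi> n}"
  have ne: "?K \<noteq> {}"
  proof
    assume "?K = {}"
    then have "Sup ?K = 0" unfolding Sup_enat_def by (rule if_P)
    then show False using assms by (simp add: zero_enat_def)
  qed
  then have Sup: "Sup ?K = (if finite ?K then Max ?K else \<infinity>)" unfolding Sup_enat_def by (rule if_not_P)
  then have "finite ?K" using assms(1) by (metis enat.distinct(1))
  then have "Sup ?K = Max ?K" using Sup by presburger
  then have "Max ?K = enat d" using assms(1) by simp
  then have "enat d \<in> ?K" using Max_in[OF \<open>finite ?K\<close> ne] by argo
  then show ?thesis by auto
qed

text \<open>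
  The equality of embedding dimension and dimension of the localization \<open>A\<close>, expressed in \<open>R\<close>: \<open>X\<close> consists
  of numerators of a smallest generating set of the maximal ideal, and the chain is contracted from a
  longest chain in \<open>A\<close>. The weak inequality \<open>card X \<le> n\<close> suffices and is easier: numerators might
  coincide, and a contracted chain that ends below \<open>P\<close> is prolonged by \<open>P\<close>.
\<close>

lemma (in noetherian_cring) regular_local_parameters:
  fixes A :: "('c, 'd) ring_scheme" and h :: "'a \<Rightarrow> 'c"
  assumes P: "primeideal P R" and A: "regular_local_ring A" and h: "h \<in> ring_hom R A"
    and frac: "\<And>z. z \<in> carrier A \<Longrightarrow> \<exists>s\<in>carrier R - P. \<exists>a\<in>carrier R. h s \<otimes>\<^bsub>A\<^esub> z = h a"
    and unit: "\<And>s. s \<in> carrier R - P \<Longrightarrow> \<exists>z\<in>carrier A. h s \<otimes>\<^bsub>A\<^esub> z = \<one>\<^bsub>A\<^esub>"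
    and inj: "inj_on h (carrier R)"
  obtains X n P' where "finite X" "X \<subseteq> P" "P \<subseteq> sat_hull P X" "prime_chain P' n P" "card X \<le> n"
proof -
  interpret A: cring A using A by (simp add: regular_local_ring_def)
  interpret A: noetherian_ring A using A by (simp add: regular_local_ring_def)
  interpret h: ring_hom_ring R A h
    by (rule ring_hom_ringI2[OF ring_axioms A.ring_axioms h])
  obtain m where m: "maximalideal m A" and dim: "enat (min_num_generators A m) = krull_dim A"
    using A unfolding regular_local_ring_def by blast
  interpret m: maximalideal m A by (rule m)
  interpret P: primeideal P R by (rule P)
  have Pc: "a \<in> carrier R" if "a \<in> P" for a using that primeD(1)[OF P] by blast
  have unit_notin: "h s \<notin> Q" if "ideal Q A" "Q \<noteq> carrier A" "s \<in> carrier R - P" for Q s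
  proof
    assume "h s \<in> Q"
    from unit[OF that(3)] obtain z where z: "z \<in> carrier A" "h s \<otimes>\<^bsub>A\<^esub> z = \<one>\<^bsub>A\<^esub>" by blast
    have "\<one>\<^bsub>A\<^esub> \<in> Q" using ideal.I_r_closed[OF that(1) \<open>h s \<in> Q\<close> z(1)] z(2) by simp
    then show False using ideal.one_imp_carrier[OF that(1)] that(2) by blast
  qed
  \<comment> \<open>The extension of an ideal \<open>J\<close> of \<open>R\<close> to \<open>A\<close>.\<close>
  define E where "E J = {z \<in> carrier A. \<exists>s\<in>carrier R - P. \<exists>a\<in>J. h s \<otimes>\<^bsub>A\<^esub> z = h a}" for J
  have E: "ideal (E J) A" if J: "ideal J R" for J
  proof (rule A.ideal_if_closed)
    interpret J: ideal J R by (rule J)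
    show "E J \<subseteq> carrier A" by (auto simp: E_def)
    have "h \<one> \<otimes>\<^bsub>A\<^esub> \<zero>\<^bsub>A\<^esub> = h \<zero>" by simp
    then show "\<zero>\<^bsub>A\<^esub> \<in> E J" unfolding E_def using primeD(2)[OF P] J.zero_closed by blast
  next
    interpret J: ideal J R by (rule J)
    have Jc: "a \<in> carrier R" if "a \<in> J" for a using that J.a_subset by blast
    fix y z assume "y \<in> E J" "z \<in> E J"
    then obtain s a t b where y: "y \<in> carrier A" "s \<in> carrier R - P" "a \<in> J" "h s \<otimes>\<^bsub>A\<^esub> y = h a"
      and z: "z \<in> carrier A" "t \<in> carrier R - P" "b \<in> J" "h t \<otimes>\<^bsub>A\<^esub> z = h b" by (auto simp: E_def)
    have c: "s \<in> carrier R" "t \<in> carrier R" "a \<in> carrier R" "b \<in> carrier R" using y z Jc by auto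
    have "h (s \<otimes> t) \<otimes>\<^bsub>A\<^esub> (y \<oplus>\<^bsub>A\<^esub> z) = h t \<otimes>\<^bsub>A\<^esub> (h s \<otimes>\<^bsub>A\<^esub> y) \<oplus>\<^bsub>A\<^esub> h s \<otimes>\<^bsub>A\<^esub> (h t \<otimes>\<^bsub>A\<^esub> z)"
      using c y(1) z(1) by (simp add: A.r_distr A.m_ac)
    also have "\<dots> = h (t \<otimes> a \<oplus> s \<otimes> b)" using c by (simp add: y(4) z(4))
    finally have eq: "h (s \<otimes> t) \<otimes>\<^bsub>A\<^esub> (y \<oplus>\<^bsub>A\<^esub> z) = h (t \<otimes> a \<oplus> s \<otimes> b)" .
    have "t \<otimes> a \<oplus> s \<otimes> b \<in> J" using J.I_l_closed y(3) z(3) c by simp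
    then show "y \<oplus>\<^bsub>A\<^esub> z \<in> E J"
      unfolding E_def using eq A.a_closed[OF y(1) z(1)] prime_mult_notin[OF P y(2) z(2)] by blast
  next
    interpret J: ideal J R by (rule J)
    have Jc: "a \<in> carrier R" if "a \<in> J" for a using that J.a_subset by blast
    fix r z assume r: "r \<in> carrier A" and "z \<in> E J"
    then obtain t b where z: "z \<in> carrier A" "t \<in> carrier R - P" "b \<in> J" "h t \<otimes>\<^bsub>A\<^esub> z = h b" by (auto simp: E_def)
    obtain s a where s: "s \<in> carrier R - P" "a \<in> carrier R" "h s \<otimes>\<^bsub>A\<^esub> r = h a" using frac[OF r] by blast
    have c: "s \<in> carrier R" "t \<in> carrier R" "b \<in> carrier R" using s z Jc by auto
    have "h (s \<otimes> t) \<otimes>\<^bsub>A\<^esub> (r \<otimes>\<^bsub>A\<^esub> z) = (h s \<otimes>\<^bsub>A\<^esub> r) \<otimes>\<^bsub>A\<^esub> (h t \<otimes>\<^bsub>A\<^esub> z)"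
      using c r z(1) by (simp add: A.m_ac)
    also have "\<dots> = h (a \<otimes> b)" using c s(2) by (simp add: s(3) z(4))
    finally have "h (s \<otimes> t) \<otimes>\<^bsub>A\<^esub> (r \<otimes>\<^bsub>A\<^esub> z) = h (a \<otimes> b)" .
    then show "r \<otimes>\<^bsub>A\<^esub> z \<in> E J"
      unfolding E_def
      using A.m_closed[OF r z(1)] prime_mult_notin[OF P s(1) z(2)] J.I_l_closed[OF z(3) s(2)] by blast
  qed
  \<comment> \<open>The maximal ideal consists of the fractions with numerator in \<open>P\<close>.\<close>
  have mE: "m \<subseteq> E P"
  proof
    fix z assume z: "z \<in> m"
    then have zc: "z \<in> carrier A" using m.a_subset by blast
    obtain s a where s: "s \<in> carrier R - P" "a \<in> carrier R" "h s \<otimes>\<^bsub>A\<^esub> z = h a" using frac[OF zc] by blast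
    have "h a \<in> m" using m.I_l_closed[OF z, of "h s"] s by auto
    then have "a \<in> P" using unit_notin[OF m.is_ideal m.I_notcarr[symmetric], of a] s(2) by blast
    then show "z \<in> E P" using s zc by (auto simp: E_def)
  qed
  have "\<one>\<^bsub>A\<^esub> \<notin> E P"
  proof
    assume "\<one>\<^bsub>A\<^esub> \<in> E P"
    then obtain s a where s: "s \<in> carrier R - P" "a \<in> P" "h s \<otimes>\<^bsub>A\<^esub> \<one>\<^bsub>A\<^esub> = h a" by (auto simp: E_def)
    then have "h s = h a" by simp
    then have "s = a" using inj_onD[OF inj] s Pc by blast
    then show False using s by blast
  qed
  then have "E P \<noteq> carrier A" using A.one_closed by metis
  moreover have "E P = m \<or> E P = carrier A"
    by (rule m.I_maximal[OF E mE]) (auto simp: P.is_ideal E_def)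
  ultimately have Em: "E P = m" by blast
  have hm: "h a \<in> m" if a: "a \<in> P" for a
  proof -
    have "h \<one> \<otimes>\<^bsub>A\<^esub> h a = h a" using Pc[OF a] by simp
    moreover have "\<one> \<in> carrier R - P" using primeD(2)[OF P] by simp
    ultimately have "h a \<in> E P" unfolding E_def using a h.hom_closed[OF Pc[OF a]] by blast
    then show ?thesis using Em by simp
  qed
  define d where "d = min_num_generators A m"
  have "\<exists>Y\<subseteq>carrier A. finite Y \<and> card Y = d \<and> m = Idl\<^bsub>A\<^esub> Y"
    unfolding d_def min_num_generators_def
    by (rule LeastI_ex) (use A.finetely_gen[OF m.is_ideal] in blast)
  then obtain Y where Y: "Y \<subseteq> carrier A" "finite Y" "card Y = d" "m = Idl\<^bsub>A\<^esub> Y" by blast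
  have "Y \<subseteq> E P" using A.genideal_self[OF Y(1)] mE Y(4) by simp
  then have "\<forall>y\<in>Y. \<exists>a. a \<in> P \<and> (\<exists>s\<in>carrier R - P. h s \<otimes>\<^bsub>A\<^esub> y = h a)"
    unfolding E_def by blast
  then obtain num where num: "\<And>y. y \<in> Y \<Longrightarrow> num y \<in> P \<and> (\<exists>s\<in>carrier R - P. h s \<otimes>\<^bsub>A\<^esub> y = h (num y))"
    by metis
  define X where "X = num ` Y"
  have X: "finite X" "X \<subseteq> P" "card X \<le> d"
    using num Y card_image_le[of Y num] by (auto simp: X_def)
  have Xc: "X \<subseteq> carrier R" using X(2) Pc by blast
  have "Y \<subseteq> E (Idl X)"
    unfolding E_def using num Y(1) genideal_self[OF Xc] unfolding X_def by blast
  then have "m \<subseteq> E (Idl X)"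
    unfolding Y(4) by (rule A.genideal_minimal[OF E[OF genideal_ideal[OF Xc]]])
  have PX: "P \<subseteq> sat_hull P X"
  proof
    fix a assume a: "a \<in> P"
    then obtain s b where s: "s \<in> carrier R - P" "b \<in> Idl X" "h s \<otimes>\<^bsub>A\<^esub> h a = h b"
      using hm[OF a] \<open>m \<subseteq> E (Idl X)\<close> unfolding E_def by blast
    have bc: "b \<in> carrier R" using s(2) ideal.Icarr[OF genideal_ideal[OF Xc]] by blast
    have "h (s \<otimes> a) = h b" using s Pc[OF a] by simp
    then have "s \<otimes> a = b" using inj_onD[OF inj] s(1) bc Pc[OF a] by blast
    note H = sat_ideal_sat_hull[OF Xc, of P]
    have "Idl X \<subseteq> sat_hull P X"
      by (rule genideal_minimal[OF sat_idealD(1)[OF H] sat_hull_contains])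
    then show "a \<in> sat_hull P X"
      using sat_idealD(2)[OF H, of s a] s Pc[OF a] \<open>s \<otimes> a = b\<close> by blast
  qed
  have "\<exists>P' n. prime_chain P' n P \<and> d \<le> n"
  proof (cases "d = 0")
    case True
    then show ?thesis using prime_chain_0[OF P] by blast
  next
    case False
    have "Sup {enat n | n. \<exists>C :: nat \<Rightarrow> 'c set. (\<forall>i\<le>n. primeideal (C i) A) \<and> (\<forall>i<n. C i \<subset> C (Suc i))} = enat d"
      using dim by (simp add: krull_dim_def d_def)
    from Sup_enat_attained[OF this False] obtain C :: "nat \<Rightarrow> 'c set"
      where C: "\<And>i. i \<le> d \<Longrightarrow> primeideal (C i) A" "\<And>i. i < d \<Longrightarrow> C i \<subset> C (Suc i)" by blast
    define Q where "Q i = {a \<in> carrier R. h a \<in> C i}" for i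
    have Q: "primeideal (Q i) R" if "i \<le> d" for i
      unfolding Q_def by (rule h.primeideal_vimage[OF is_cring C(1)[OF that]])
    have QP: "Q i \<subseteq> P" if "i \<le> d" for i
      using unit_notin[OF primeideal.axioms(1)[OF C(1)[OF that]]] primeideal.I_notcarr[OF C(1)[OF that]]
      by (auto simp: Q_def)
    have strict: "Q i \<subset> Q (Suc i)" if i: "i < d" for i
    proof -
      obtain z where z: "z \<in> C (Suc i)" "z \<notin> C i" using C(2)[OF i] by blast
      interpret C1: primeideal "C i" A using C(1) i by simp
      interpret C2: primeideal "C (Suc i)" A using C(1) i by simp
      have zc: "z \<in> carrier A" using z C2.a_subset by blast
      obtain s a where s: "s \<in> carrier R - P" "a \<in> carrier R" "h s \<otimes>\<^bsub>A\<^esub> z = h a" using frac[OF zc] by blast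
      have "h a \<in> C (Suc i)" using C2.I_l_closed[OF z(1), of "h s"] s by auto
      moreover have "h a \<notin> C i"
        using C1.I_prime[of "h s" z] s z(2) zc unit_notin[OF C1.is_ideal C1.I_notcarr[symmetric] s(1)] by auto
      ultimately show ?thesis using C(2)[OF i] s(2) by (auto simp: Q_def)
    qed
    have chain: "i \<le> d \<Longrightarrow> prime_chain (Q 0) i (Q i)" for i
    proof (induction i)
      case 0
      show ?case by (rule prime_chain_0[OF Q]) simp
    next
      case (Suc i)
      then show ?case by (intro prime_chain_Suc[OF _ strict Q]) auto
    qed
    show ?thesis
    proof (cases "Q d = P")
      case True
      then show ?thesis using chain[of d] by blast
    next
      case False
      then have "prime_chain (Q 0) (Suc d) P"
        using QP[of d] by (intro prime_chain_Suc[OF chain _ P]) auto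
      then show ?thesis by (intro exI[of _ "Q 0"] exI[of _ "Suc d"]) simp
    qed
  qed
  then show ?thesis using that X PX by (meson order_trans)
qed

section \<open>Cartier maps on F-finite regular domains\<close>

text \<open>
  Finite generation over the \<open>p\<^sup>e\<close>-th powers for some \<open>e > 0\<close> implies finite generation over the larger ring of
  \<open>p\<close>-th powers.
\<close>

lemma (in char_p_cring) p_spans_if_F_finite:
  assumes "F_finite p R"
  obtains G where "finite G" "G \<subseteq> carrier R"
    "\<And>y. y \<in> carrier R \<Longrightarrow> \<exists>c\<in>G \<rightarrow> carrier R. y = p_comb G c"
proof -
  obtain e where e: "e > 0" "fin_gen_module R (frobenius_module p e R)"
    using assms unfolding F_finite_def by blast
  obtain d where d: "e = Suc d" using e(1) by (cases e) auto
  let ?M = "frobenius_module p e R"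
  have sum: "finsum ?M f A = finsum R f A" for f :: "'a \<Rightarrow> 'a" and A
    by (simp add: finsum_def finprod_def frobenius_module_def)
  obtain G where G: "G \<subseteq> carrier R" "finite G"
      "\<And>x. x \<in> carrier R \<Longrightarrow> \<exists>c\<in>G \<rightarrow> carrier R. x = finsum ?M (\<lambda>a. c a \<odot>\<^bsub>?M\<^esub> a) G"
    using e(2) unfolding fin_gen_module_def by (auto simp: frobenius_module_def)
  have "\<exists>c\<in>G \<rightarrow> carrier R. y = p_comb G c" if y: "y \<in> carrier R" for y
  proof -
    obtain c where c: "c \<in> G \<rightarrow> carrier R" "y = finsum ?M (\<lambda>a. c a \<odot>\<^bsub>?M\<^esub> a) G" using G(3)[OF y] by blast
    have "y = (\<Oplus>a\<in>G. c a [^] (p ^ e) \<otimes> a)"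
      unfolding c(2) sum by (simp add: frobenius_module_def)
    also have "\<dots> = p_comb G (\<lambda>a. c a [^] (p ^ d))"
      unfolding p_comb_def
      by (rule finsum_cong') (use c(1) G(1) in \<open>auto simp: d Pi_iff subset_iff nat_pow_pow mult.commute\<close>)
    finally show ?thesis using c(1) by (intro bexI[of _ "\<lambda>a. c a [^] (p ^ d)"]) auto
  qed
  then show ?thesis using that G by blast
qed

text \<open>
  If the claim fails, the ideal of all \<open>r\<close> with \<open>x r\<close> in the ideal in question is contained in a maximal
  ideal \<open>N\<close>. The expansion of \<open>s x\<close> in a dual basis at \<open>N\<close> shows that it contains some \<open>s \<notin> N\<close>.
\<close>

lemma (in noetherian_char_p_domain) mem_frobenius_ideal_of_cartier_values:
  assumes reg: "regular_ring R" and fin: "F_finite p R" and x: "x \<in> carrier R"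
  shows "x \<in> Idl {\<phi> x [^] p | \<phi>. \<phi> \<in> cartier_maps p 1 R}"
proof (rule ccontr)
  let ?B = "{\<phi> x [^] p | \<phi>. \<phi> \<in> cartier_maps p 1 R}"
  assume notin: "x \<notin> Idl ?B"
  have Bc: "?B \<subseteq> carrier R" using x by (auto simp: cartier_maps_def)
  define \<cc> where "\<cc> = {r \<in> carrier R. x \<otimes> r \<in> Idl ?B}"
  have "sat_ideal (carrier R) (Idl ?B)" using genideal_ideal[OF Bc] by (simp add: sat_ideal_def)
  then have c: "ideal \<cc> R" unfolding \<cc>_def using sat_ideal_colon[OF _ x] sat_idealD(1) by blast
  have "\<one> \<notin> \<cc>" using notin x by (simp add: \<cc>_def)
  define F where "F = {J. ideal J R \<and> \<cc> \<subseteq> J \<and> \<one> \<notin> J}"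
  obtain N where N: "N \<in> F" and max: "\<And>J. J \<in> F \<Longrightarrow> N \<subseteq> J \<Longrightarrow> J = N"
    by (rule maximal_ideal_in_family[of F]) (use c \<open>\<one> \<notin> \<cc>\<close> in \<open>auto simp: F_def\<close>)
  have "maximalideal N R"
  proof (rule maximalidealI)
    show "ideal N R" using N by (simp add: F_def)
    show "carrier R \<noteq> N" using N by (auto simp: F_def)
    fix J assume J: "ideal J R" "N \<subseteq> J" "J \<subseteq> carrier R"
    show "J = N \<or> J = carrier R"
    proof (cases "\<one> \<in> J")
      case True
      then show ?thesis using ideal.one_imp_carrier[OF J(1)] by simp
    next
      case False
      then have "J \<in> F" using J N by (auto simp: F_def)
      then show ?thesis using max J(2) by blast
    qed
  qed
  then have prime: "primeideal N R" by (rule maximalideal_prime)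
  obtain h :: "'a \<Rightarrow> ('a \<times> 'a) set" where h: "h \<in> ring_hom R (localization_at R N)"
    "\<And>z. z \<in> carrier (localization_at R N) \<Longrightarrow>
      \<exists>s\<in>carrier R - N. \<exists>a\<in>carrier R. h s \<otimes>\<^bsub>localization_at R N\<^esub> z = h a"
    "\<And>s. s \<in> carrier R - N \<Longrightarrow>
      \<exists>z\<in>carrier (localization_at R N). h s \<otimes>\<^bsub>localization_at R N\<^esub> z = \<one>\<^bsub>localization_at R N\<^esub>"
    "inj_on h (carrier R)"
    by (rule localization_at_canonical_map[OF prime]) blast
  have loc: "regular_local_ring (localization_at R N)"
    using reg prime unfolding regular_ring_def by blast
  obtain X n P where X: "finite X" "X \<subseteq> N" "N \<subseteq> sat_hull N X" "prime_chain P n N" "card X \<le> n"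
    by (rule regular_local_parameters[OF prime loc h])
  obtain G where G: "finite G" "G \<subseteq> carrier R"
    "\<And>y. y \<in> carrier R \<Longrightarrow> \<exists>c\<in>G \<rightarrow> carrier R. y = p_comb G c"
    using p_spans_if_F_finite[OF fin] by blast
  then have "p_spans \<one> G" unfolding p_spans_def by simp
  then obtain U s \<phi> where U: "finite U" "U \<subseteq> carrier R" and s: "s \<in> carrier R - N"
    and \<phi>: "\<And>u. u \<in> U \<Longrightarrow> \<phi> u \<in> cartier_maps p 1 R"
    and eq: "\<And>y. y \<in> carrier R \<Longrightarrow> s \<otimes> y = (\<Oplus>u\<in>U. \<phi> u y [^] p \<otimes> u)"
    using frobenius_dual_basis[OF prime G(1,2) _ X] by blast
  interpret B: ideal "Idl ?B" R by (rule genideal_ideal[OF Bc])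
  have "s \<otimes> x \<in> Idl ?B"
    unfolding eq[OF x] p_comb_def[of U "\<lambda>u. \<phi> u x", symmetric]
  proof (rule p_comb_mem[OF B.is_ideal U(2,1)])
    fix u assume u: "u \<in> U"
    then have "\<phi> u x [^] p \<in> Idl ?B" using \<phi> genideal_self[OF Bc] by blast
    then show "\<phi> u x [^] p \<otimes> u \<in> Idl ?B" using B.I_r_closed U(2) u by blast
  qed
  then have "s \<in> \<cc>" using s x by (simp add: \<cc>_def m_comm)
  then show False using N s by (auto simp: F_def)
qed

context char_p_cring
begin

lemma cartier_mapsD:
  assumes "\<phi> \<in> cartier_maps p e R"
  shows "\<And>x. x \<in> carrier R \<Longrightarrow> \<phi> x \<in> carrier R"
    "\<And>x y. x \<in> carrier R \<Longrightarrow> y \<in> carrier R \<Longrightarrow> \<phi> (x \<oplus> y) = \<phi> x \<oplus> \<phi> y"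
    "\<And>r x. r \<in> carrier R \<Longrightarrow> x \<in> carrier R \<Longrightarrow> \<phi> (r [^] (p ^ e) \<otimes> x) = r \<otimes> \<phi> x"
  using assms by (auto simp: cartier_maps_def)

lemma cartier_map_zero:
  assumes "\<phi> \<in> cartier_maps p e R"
  shows "\<phi> \<zero> = \<zero>"
  using cartier_mapsD(3)[OF assms, of \<zero> \<zero>] cartier_mapsD(1)[OF assms, of \<zero>] by simp

lemma cartier_maps_comp:
  assumes \<phi>: "\<phi> \<in> cartier_maps p a R" and \<psi>: "\<psi> \<in> cartier_maps p b R"
  shows "(\<lambda>x. \<psi> (\<phi> x)) \<in> cartier_maps p (a + b) R"
proof -
  have "\<psi> (\<phi> (r [^] (p ^ (a + b)) \<otimes> g)) = r \<otimes> \<psi> (\<phi> g)" if "r \<in> carrier R" "g \<in> carrier R" for r g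
  proof -
    have "r [^] (p ^ (a + b)) = (r [^] (p ^ b)) [^] (p ^ a)"
      using that by (simp add: nat_pow_pow power_add mult.commute)
    then show ?thesis
      using that cartier_mapsD[OF \<phi>] cartier_mapsD[OF \<psi>] by simp
  qed
  then show ?thesis
    using cartier_mapsD[OF \<phi>] cartier_mapsD[OF \<psi>] by (auto simp: cartier_maps_def)
qed

text \<open>
  The case \<open>e = 1\<close> is iterated: it is applied to \<open>\<phi> x\<close> for \<open>\<phi> \<in> C\<^sup>e\<close>, and the result is raised to the
  power \<open>p\<^sup>e\<close>.
\<close>

lemma mem_frobenius_power_of_cartier_values:
  assumes one: "\<And>x. x \<in> carrier R \<Longrightarrow> x \<in> Idl {\<phi> x [^] p | \<phi>. \<phi> \<in> cartier_maps p 1 R}"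
    and x: "x \<in> carrier R"
  shows "x \<in> Idl {\<phi> x [^] (p ^ e) | \<phi>. \<phi> \<in> cartier_maps p e R}"
proof (induction e)
  case 0
  have "(\<lambda>y. y) \<in> cartier_maps p 0 R" by (simp add: cartier_maps_def)
  then have "x \<in> {\<phi> x [^] (p ^ 0) | \<phi>. \<phi> \<in> cartier_maps p 0 R}" using x by force
  moreover have "{\<phi> x [^] (p ^ 0) | \<phi>. \<phi> \<in> cartier_maps p 0 R} \<subseteq> carrier R"
    using x by (auto simp: cartier_mapsD(1))
  ultimately show ?case using genideal_self by blast
next
  case (Suc e)
  let ?B = "\<lambda>e x. {\<phi> x [^] (p ^ e) | \<phi>. \<phi> \<in> cartier_maps p e R}"
  have Bc: "?B e y \<subseteq> carrier R" if "y \<in> carrier R" for e y using that by (auto simp: cartier_mapsD(1))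
  have ideal: "ideal (Idl ?B (Suc e) x) R" by (rule genideal_ideal[OF Bc[OF x]])
  have "\<phi> x [^] (p ^ e) \<in> Idl ?B (Suc e) x" if \<phi>: "\<phi> \<in> cartier_maps p e R" for \<phi>
  proof -
    have y: "\<phi> x \<in> carrier R" using cartier_mapsD(1)[OF \<phi> x] .
    have "{\<psi> (\<phi> x) [^] p | \<psi>. \<psi> \<in> cartier_maps p 1 R} \<subseteq> {z \<in> carrier R. z [^] (p ^ e) \<in> Idl ?B (Suc e) x}"
    proof
      fix z assume "z \<in> {\<psi> (\<phi> x) [^] p | \<psi>. \<psi> \<in> cartier_maps p 1 R}"
      then obtain \<psi> where \<psi>: "z = \<psi> (\<phi> x) [^] p" "\<psi> \<in> cartier_maps p 1 R" by blast
      have w: "\<psi> (\<phi> x) \<in> carrier R" by (rule cartier_mapsD(1)[OF \<psi>(2) y])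
      have "(\<lambda>x. \<psi> (\<phi> x)) \<in> cartier_maps p (Suc e) R" using cartier_maps_comp[OF \<phi> \<psi>(2)] by simp
      then have "\<psi> (\<phi> x) [^] (p ^ Suc e) \<in> ?B (Suc e) x"
        by (intro CollectI exI[of _ "\<lambda>x. \<psi> (\<phi> x)"] conjI refl)
      then have "\<psi> (\<phi> x) [^] (p ^ Suc e) \<in> Idl ?B (Suc e) x" using genideal_self[OF Bc[OF x]] by blast
      then show "z \<in> {z \<in> carrier R. z [^] (p ^ e) \<in> Idl ?B (Suc e) x}"
        using \<psi>(1) w by (simp add: nat_pow_pow)
    qed
    then have "Idl {\<psi> (\<phi> x) [^] p | \<psi>. \<psi> \<in> cartier_maps p 1 R}
        \<subseteq> {z \<in> carrier R. z [^] (p ^ e) \<in> Idl ?B (Suc e) x}"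
      by (rule genideal_minimal[OF frobenius_vimage_ideal[OF ideal]])
    then show ?thesis using one[OF y] by blast
  qed
  then have "?B e x \<subseteq> Idl ?B (Suc e) x" by blast
  then have "Idl ?B e x \<subseteq> Idl ?B (Suc e) x" by (rule genideal_minimal[OF ideal])
  then show ?case using Suc by blast
qed

text \<open>
  The values at \<open>1\<close> of Cartier maps form an ideal, since Cartier maps can be added and multiplied by ring
  elements. It contains the \<open>p\<close>-th powers of its elements, hence \<open>1\<close>.
\<close>

lemma frobenius_splitting:
  assumes "\<one> \<in> Idl {\<phi> \<one> [^] p | \<phi>. \<phi> \<in> cartier_maps p 1 R}"
  obtains \<theta> where "\<theta> \<in> cartier_maps p 1 R" "\<theta> \<one> = \<one>"
proof -
  define V where "V = {\<phi> \<one> | \<phi>. \<phi> \<in> cartier_maps p 1 R}"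
  have V: "ideal V R"
  proof (rule ideal_if_closed)
    show "V \<subseteq> carrier R" by (auto simp: V_def cartier_mapsD(1))
    have "(\<lambda>x. \<zero>) \<in> cartier_maps p 1 R" by (simp add: cartier_maps_def)
    then show "\<zero> \<in> V" unfolding V_def by force
  next
    fix a b assume "a \<in> V" "b \<in> V"
    then obtain \<phi> \<psi> where *: "a = \<phi> \<one>" "b = \<psi> \<one>" "\<phi> \<in> cartier_maps p 1 R" "\<psi> \<in> cartier_maps p 1 R"
      by (auto simp: V_def)
    have "(\<lambda>x. \<phi> x \<oplus> \<psi> x) \<in> cartier_maps p 1 R"
      using cartier_mapsD[OF *(3)] cartier_mapsD[OF *(4)]
      by (auto simp: cartier_maps_def r_distr a_ac)
    then show "a \<oplus> b \<in> V" unfolding V_def using * by force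
  next
    fix r a assume r: "r \<in> carrier R" and "a \<in> V"
    then obtain \<phi> where *: "a = \<phi> \<one>" "\<phi> \<in> cartier_maps p 1 R" by (auto simp: V_def)
    have "(\<lambda>x. r \<otimes> \<phi> x) \<in> cartier_maps p 1 R"
      using cartier_mapsD[OF *(2)] r by (auto simp: cartier_maps_def r_distr m_lcomm)
    then show "r \<otimes> a \<in> V" unfolding V_def using * by force
  qed
  have p0: "p = Suc (p - 1)" using prime_gt_0_nat[OF p_prime] by simp
  \<comment> \<open>Here \<open>p > 0\<close> matters: a positive power of an element of \<open>V\<close> is in \<open>V\<close>.\<close>
  have "{\<phi> \<one> [^] p | \<phi>. \<phi> \<in> cartier_maps p 1 R} \<subseteq> V"
  proof
    fix z assume "z \<in> {\<phi> \<one> [^] p | \<phi>. \<phi> \<in> cartier_maps p 1 R}"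
    then obtain \<phi> where \<phi>: "z = \<phi> \<one> [^] p" "\<phi> \<in> cartier_maps p 1 R" by blast
    have "\<phi> \<one> \<in> V" "\<phi> \<one> \<in> carrier R" using \<phi>(2) by (auto simp: V_def cartier_mapsD(1))
    then have "\<phi> \<one> [^] (p - 1) \<otimes> \<phi> \<one> \<in> V" using ideal.I_l_closed[OF V] by simp
    then show "z \<in> V" using \<phi>(1) p0 nat_pow_Suc by metis
  qed
  then have "\<one> \<in> V" using assms genideal_minimal[OF V] by blast
  then show ?thesis using that by (auto simp: V_def)
qed

end

section \<open>Powers of ideals\<close>

lemma (in cring)
  assumes I: "ideal I R"
  shows ideal_power_ideal: "ideal (I [^]\<^bsub>ideals_set R\<^esub> (n::nat)) R"
    and ideal_power_Suc: "I [^]\<^bsub>ideals_set R\<^esub> Suc n = (I [^]\<^bsub>ideals_set R\<^esub> n) \<cdot> I"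
    and ideal_power_0: "I [^]\<^bsub>ideals_set R\<^esub> (0::nat) = carrier R"
proof -
  show *: "I [^]\<^bsub>ideals_set R\<^esub> Suc n = (I [^]\<^bsub>ideals_set R\<^esub> n) \<cdot> I" for n :: nat
    by (simp add: ideals_set_def)
  show 0: "I [^]\<^bsub>ideals_set R\<^esub> (0::nat) = carrier R" by (simp add: ideals_set_def)
  show "ideal (I [^]\<^bsub>ideals_set R\<^esub> (n::nat)) R"
  proof (induction n)
    case (Suc n)
    then show ?case using ideal_prod_is_ideal[OF _ I] by (simp only: *)
  qed (simp only: 0 oneideal)
qed

lemma (in cring) ideal_power_antimono:
  assumes I: "ideal I R" and "n \<le> m"
  shows "I [^]\<^bsub>ideals_set R\<^esub> (m::nat) \<subseteq> I [^]\<^bsub>ideals_set R\<^esub> n"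
  using assms(2)
proof (rule lift_Suc_antimono_le[rotated])
  fix k show "I [^]\<^bsub>ideals_set R\<^esub> Suc k \<subseteq> I [^]\<^bsub>ideals_set R\<^esub> k"
    using ideal_prod_inter[OF ideal_power_ideal[OF I] I] unfolding ideal_power_Suc[OF I] by blast
qed

lemma (in cring) element_power_mem_ideal_power:
  assumes I: "ideal I R" and g: "g \<in> I [^]\<^bsub>ideals_set R\<^esub> (n::nat)"
  shows "g [^] (k::nat) \<in> I [^]\<^bsub>ideals_set R\<^esub> (n * k)"
proof (induction k)
  case 0
  then show ?case by (simp add: ideals_set_def)
next
  case (Suc k)
  interpret M: comm_monoid "ideals_set R" by (rule ideals_set_is_comm_monoid)
  have "I \<in> carrier (ideals_set R)" using I by (simp add: ideals_set_def)
  then have "I [^]\<^bsub>ideals_set R\<^esub> (n * Suc k)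
      = (I [^]\<^bsub>ideals_set R\<^esub> (n * k)) \<otimes>\<^bsub>ideals_set R\<^esub> (I [^]\<^bsub>ideals_set R\<^esub> n)"
    by (simp add: M.nat_pow_mult add.commute)
  also have "\<dots> = (I [^]\<^bsub>ideals_set R\<^esub> (n * k)) \<cdot> (I [^]\<^bsub>ideals_set R\<^esub> n)"
    by (simp add: ideals_set_def)
  finally show ?case using ideal_prod.prod[OF Suc g, of R] by simp
qed

text \<open>
  Both inclusions reduce to products of elements. In the inclusion from right to left, the two factors
  of a product of elements of extended ideals are replaced by elements of \<open>B\<close> one after the other,
  because \<open>{c. b c \<in> K}\<close> is an ideal.
\<close>

lemma (in cring) extension_ideal_power:
  assumes B: "subcring B R" and I: "ideal I (R\<lparr>carrier := B\<rparr>)"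
  shows "Idl (I [^]\<^bsub>ideals_set (R\<lparr>carrier := B\<rparr>)\<^esub> (n::nat)) = (Idl I) [^]\<^bsub>ideals_set R\<^esub> n"
proof -
  let ?B = "R\<lparr>carrier := B\<rparr>"
  have Bc: "B \<subseteq> carrier R" and B1: "\<one> \<in> B" using subcringE[OF B] by auto
  interpret B: cring ?B using subcring_iff[OF Bc] B by blast
  let ?p = "\<lambda>n. I [^]\<^bsub>ideals_set ?B\<^esub> (n::nat)" and ?q = "\<lambda>n. (Idl I) [^]\<^bsub>ideals_set R\<^esub> (n::nat)"
  have pB: "?p n \<subseteq> B" for n
    using additive_subgroup.a_subset[OF ideal.axioms(1)[OF B.ideal_power_ideal[OF I, of n]]] by simp
  have pc: "?p n \<subseteq> carrier R" for n using pB Bc by blast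
  have Ic: "I \<subseteq> carrier R"
    using additive_subgroup.a_subset[OF ideal.axioms(1)[OF I]] Bc by auto
  have IdI: "ideal (Idl I) R" by (rule genideal_ideal[OF Ic])
  note qi = ideal_power_ideal[OF IdI]
  have colon: "ideal {c \<in> carrier R. b \<otimes> c \<in> J} R" if J: "ideal J R" and b: "b \<in> carrier R" for J b
  proof -
    interpret J: ideal J R by (rule J)
    show ?thesis
      by (rule ideal_if_closed) (use b J.I_l_closed in \<open>auto simp: r_distr m_lcomm\<close>)
  qed
  have "?p n \<subseteq> ?q n" for n
  proof (induction n)
    case 0
    show ?case using Bc unfolding B.ideal_power_0[OF I] ideal_power_0[OF IdI] by simp
  next
    case (Suc n)
    show ?case
    proof
      fix z assume "z \<in> ?p (Suc n)"
      then have "z \<in> ideal_prod ?B (?p n) I" by (simp only: B.ideal_power_Suc[OF I])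
      then have "z \<in> ideal_prod R (?q n) (Idl I)"
      proof (induction z rule: ideal_prod.induct)
        case (prod i j)
        have "i \<in> ?q n" "j \<in> Idl I" using prod Suc genideal_self[OF Ic] by auto
        then show ?case using ideal_prod.prod[of i "?q n" j "Idl I" R] by simp
      next
        case (sum a b)
        then show ?case using ideal_prod.sum[of a R] by simp
      qed
      then show "z \<in> ?q (Suc n)" by (simp only: ideal_power_Suc[OF IdI])
    qed
  qed
  then have 1: "Idl (?p n) \<subseteq> ?q n" for n by (rule genideal_minimal[OF qi])
  have 2: "?q n \<subseteq> Idl (?p n)" for n
  proof (induction n)
    case 0
    have "\<one> \<in> Idl (?p 0)" using genideal_self[OF pc, of 0] B1 B.ideal_power_0[OF I] by auto
    then show ?case
      using ideal.one_imp_carrier[OF genideal_ideal[OF pc]] unfolding ideal_power_0[OF IdI] by blast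
  next
    case (Suc n)
    define K where "K = Idl (?p (Suc n))"
    have K: "ideal K R" unfolding K_def by (rule genideal_ideal[OF pc])
    have aj: "a \<otimes> j \<in> K" if a: "a \<in> ?p n" and j: "j \<in> Idl I" for a j
    proof -
      have ac: "a \<in> carrier R" using a pc by blast
      have "I \<subseteq> {c \<in> carrier R. a \<otimes> c \<in> K}"
      proof
        fix i assume i: "i \<in> I"
        have "a \<otimes>\<^bsub>?B\<^esub> i \<in> ?p (Suc n)"
          unfolding B.ideal_power_Suc[OF I] by (rule ideal_prod.prod[OF a i])
        then show "i \<in> {c \<in> carrier R. a \<otimes> c \<in> K}"
          using i Ic genideal_self[OF pc, of "Suc n"] by (auto simp: K_def)
      qed
      then have "Idl I \<subseteq> {c \<in> carrier R. a \<otimes> c \<in> K}" by (rule genideal_minimal[OF colon[OF K ac]])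
      then show ?thesis using j by blast
    qed
    have ij: "i \<otimes> j \<in> K" if i: "i \<in> ?q n" and j: "j \<in> Idl I" for i j
    proof -
      have jc: "j \<in> carrier R" using j ideal.Icarr[OF IdI] by blast
      have "?p n \<subseteq> {c \<in> carrier R. j \<otimes> c \<in> K}"
      proof
        fix a assume a: "a \<in> ?p n"
        then have "a \<in> carrier R" using pc by blast
        then show "a \<in> {c \<in> carrier R. j \<otimes> c \<in> K}" using aj[OF a j] jc by (simp add: m_comm)
      qed
      then have "Idl (?p n) \<subseteq> {c \<in> carrier R. j \<otimes> c \<in> K}" by (rule genideal_minimal[OF colon[OF K jc]])
      then have "i \<in> carrier R" "j \<otimes> i \<in> K" using i Suc by blast+
      then show ?thesis using m_comm[OF jc, of i] by simp
    qed
    have "z \<in> K" if "z \<in> ideal_prod R (?q n) (Idl I)" for z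
      using that
    proof (induction z rule: ideal_prod.induct)
      case (sum a b)
      then show ?case by (intro additive_subgroup.a_closed[OF ideal.axioms(1)[OF K]])
    qed (rule ij)
    then show ?case unfolding ideal_power_Suc[OF IdI] K_def by blast
  qed
  show ?thesis using 1 2 by blast
qed

section \<open>Test ideals of direct summands\<close>

lemma (in char_p_cring)
  assumes "J \<subseteq> carrier R"
  shows ideal_cartier_ideal: "ideal (cartier_ideal p e R J) R"
    and cartier_map_mem_cartier_ideal: "\<And>\<phi> g. \<phi> \<in> cartier_maps p e R \<Longrightarrow> g \<in> J \<Longrightarrow> \<phi> g \<in> cartier_ideal p e R J"
proof -
  have c: "{\<phi> g | \<phi> g. \<phi> \<in> cartier_maps p e R \<and> g \<in> J} \<subseteq> carrier R"
    using assms cartier_mapsD(1) by blast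
  show "ideal (cartier_ideal p e R J) R" unfolding cartier_ideal_def by (rule genideal_ideal[OF c])
  show "\<And>\<phi> g. \<phi> \<in> cartier_maps p e R \<Longrightarrow> g \<in> J \<Longrightarrow> \<phi> g \<in> cartier_ideal p e R J"
    unfolding cartier_ideal_def using genideal_self[OF c] by blast
qed

text \<open>
  For \<open>\<phi> \<in> C\<^sup>e\<close> one has \<open>\<phi>(g) = \<phi>(\<theta>(g\<^sup>p))\<close>, where \<open>\<phi> \<circ> \<theta>\<close> has level \<open>e + 1\<close> and \<open>g\<^sup>p\<close> lies in the required
  power of \<open>I\<close> because \<open>\<lceil>p y\<rceil> \<le> p \<lceil>y\<rceil>\<close>.
\<close>

lemma (in char_p_cring) cartier_ideal_Suc_mono:
  assumes \<theta>: "\<theta> \<in> cartier_maps p 1 R" "\<theta> \<one> = \<one>"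
    and I: "ideal I R"
  shows "cartier_ideal p e R (I [^]\<^bsub>ideals_set R\<^esub> nat \<lceil>real p ^ e * l\<rceil>)
    \<subseteq> cartier_ideal p (Suc e) R (I [^]\<^bsub>ideals_set R\<^esub> nat \<lceil>real p ^ Suc e * l\<rceil>)"
proof -
  let ?n = "\<lambda>e. nat \<lceil>real p ^ e * l\<rceil>" and ?I = "\<lambda>n. I [^]\<^bsub>ideals_set R\<^esub> (n::nat)"
  have Ic: "?I n \<subseteq> carrier R" for n
    by (rule additive_subgroup.a_subset[OF ideal.axioms(1)[OF ideal_power_ideal[OF I]]])
  have "real p * (real p ^ e * l) \<le> real p * real (?n e)"
    by (intro mult_left_mono real_nat_ceiling_ge) simp
  then have n: "?n (Suc e) \<le> ?n e * p" by (simp add: nat_ceiling_le_eq mult_ac)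
  have "\<phi> g \<in> cartier_ideal p (Suc e) R (?I (?n (Suc e)))"
    if \<phi>: "\<phi> \<in> cartier_maps p e R" and g: "g \<in> ?I (?n e)" for \<phi> g
  proof -
    have gc: "g \<in> carrier R" using g Ic by blast
    have "g [^] p \<in> ?I (?n (Suc e))"
      using element_power_mem_ideal_power[OF I g, of p] ideal_power_antimono[OF I n] by blast
    moreover have "(\<lambda>x. \<phi> (\<theta> x)) \<in> cartier_maps p (Suc e) R"
      using cartier_maps_comp[OF \<theta>(1) \<phi>] by simp
    ultimately have "\<phi> (\<theta> (g [^] p)) \<in> cartier_ideal p (Suc e) R (?I (?n (Suc e)))"
      using cartier_map_mem_cartier_ideal[OF Ic] by blast
    moreover have "\<theta> (g [^] p) = g" using cartier_mapsD(3)[OF \<theta>(1) gc, of \<one>] \<theta>(2) gc by simp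
    ultimately show ?thesis by simp
  qed
  then show ?thesis
    unfolding cartier_ideal_def[of p e]
    by (intro genideal_minimal[OF ideal_cartier_ideal[OF Ic]]) blast
qed

text \<open>
  Fix \<open>\<phi> \<in> C\<^sup>e\<close> over \<open>B\<close> and put \<open>f = \<phi> \<circ> \<beta>\<close>. The ideal \<open>V\<close> of all \<open>z\<close> with \<open>f (s z) \<in> C\<close> for all \<open>s\<close>, where \<open>C\<close> is the
  Cartier ideal of \<open>J2\<close> over \<open>B\<close>, contains \<open>(\<chi> h)\<^sup>q\<close> for all \<open>\<chi> \<in> C\<^sup>e\<close> over \<open>R\<close> and all \<open>h\<close> in the extension of
  \<open>J2\<close>: for \<open>h = k b\<close> with \<open>b \<in> J2\<close> the map \<open>b \<mapsto> f (s (\<chi> (k b))\<^sup>q)\<close> is a Cartier map of \<open>B\<close>. By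
  hypothesis \<open>V\<close> then contains \<open>(\<psi> g)\<^sup>q\<close> for all \<open>g \<in> J1\<close> and \<open>\<psi> \<in> C\<^sup>e\<close>, hence \<open>g\<close> itself, and
  \<open>\<phi> g = f g\<close>.
\<close>

lemma (in char_p_cring) cartier_ideal_descends_to_summand:
  assumes B: "subcring B R"
    and \<beta>: "\<beta> \<in> carrier R \<rightarrow> B"
      "\<And>x y. x \<in> carrier R \<Longrightarrow> y \<in> carrier R \<Longrightarrow> \<beta> (x \<oplus> y) = \<beta> x \<oplus> \<beta> y"
      "\<And>r x. r \<in> B \<Longrightarrow> x \<in> carrier R \<Longrightarrow> \<beta> (r \<otimes> x) = r \<otimes> \<beta> x"
      "\<And>r. r \<in> B \<Longrightarrow> \<beta> r = r"
    and charB: "char_p_cring (R\<lparr>carrier := B\<rparr>) p"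
    and generated: "\<And>x. x \<in> carrier R \<Longrightarrow> x \<in> Idl {\<phi> x [^] (p ^ e) | \<phi>. \<phi> \<in> cartier_maps p e R}"
    and J: "J1 \<subseteq> B" "J2 \<subseteq> B"
    and le: "cartier_ideal p e R (Idl J1) \<subseteq> cartier_ideal p e R (Idl J2)"
  shows "cartier_ideal p e (R\<lparr>carrier := B\<rparr>) J1 \<subseteq> cartier_ideal p e (R\<lparr>carrier := B\<rparr>) J2"
proof -
  let ?B = "R\<lparr>carrier := B\<rparr>"
  interpret B: char_p_cring ?B p by (rule charB)
  have Bc: "B \<subseteq> carrier R" using subcringE[OF B] by auto
  note Bcl = subcringE(5-7)[OF B]
  have J2c: "J2 \<subseteq> carrier ?B" "J1 \<subseteq> carrier R" "J2 \<subseteq> carrier R" using J Bc by auto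
  have pow: "x [^]\<^bsub>?B\<^esub> (n::nat) = x [^] n" for x n by (simp add: nat_pow_consistent[symmetric])
  have powB: "x [^] (n::nat) \<in> B" if "x \<in> B" for x n using B.nat_pow_closed[of x n] that by (simp add: pow)
  define C where "C = cartier_ideal p e ?B J2"
  interpret C: ideal C ?B unfolding C_def by (rule B.ideal_cartier_ideal[OF J2c(1)])
  have CB: "C \<subseteq> B" using C.a_subset by simp
  have C0: "\<zero> \<in> C" and C_add: "\<And>a b. a \<in> C \<Longrightarrow> b \<in> C \<Longrightarrow> a \<oplus> b \<in> C"
    using C.zero_closed C.a_closed by simp_all
  have ideal1: "ideal (Idl J1) R" and ideal2: "ideal (Idl J2) R" using genideal_ideal J2c by auto
  have "\<phi> g \<in> C" if \<phi>: "\<phi> \<in> cartier_maps p e ?B" and g: "g \<in> J1" for \<phi> g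
  proof -
    have \<phi>c: "\<phi> x \<in> B" if "x \<in> B" for x using B.cartier_mapsD(1)[OF \<phi>] that by simp
    have \<phi>_add: "\<phi> (x \<oplus> y) = \<phi> x \<oplus> \<phi> y" if "x \<in> B" "y \<in> B" for x y
      using B.cartier_mapsD(2)[OF \<phi>] that by simp
    have \<phi>_lin: "\<phi> (r [^] (p ^ e) \<otimes> x) = r \<otimes> \<phi> x" if "r \<in> B" "x \<in> B" for r x
      using B.cartier_mapsD(3)[OF \<phi>] that by (simp add: pow)
    have \<phi>0: "\<phi> \<zero> = \<zero>" using B.cartier_map_zero[OF \<phi>] by simp
    have \<beta>c: "\<beta> x \<in> B" if "x \<in> carrier R" for x using \<beta>(1) that by blast
    have \<beta>0: "\<beta> \<zero> = \<zero>" using \<beta>(4)[of \<zero>] subcringE(2)[OF B] by simp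
    define f where "f x = \<phi> (\<beta> x)" for x
    have f0: "f \<zero> = \<zero>" by (simp add: f_def \<beta>0 \<phi>0)
    have f_add: "f (x \<oplus> y) = f x \<oplus> f y" if "x \<in> carrier R" "y \<in> carrier R" for x y
      using that by (simp add: f_def \<beta>(2) \<phi>_add \<beta>c)
    have f_lin: "f (r [^] (p ^ e) \<otimes> x) = r \<otimes> f x" if "r \<in> B" "x \<in> carrier R" for r x
      using that by (simp add: f_def \<beta>(3)[OF powB] \<phi>_lin \<beta>c)
    have f_closed: "f x \<in> B" if "x \<in> carrier R" for x using that by (simp add: f_def \<phi>c \<beta>c)
    define V where "V = {z \<in> carrier R. \<forall>s\<in>carrier R. f (s \<otimes> z) \<in> C}"
    have V: "ideal V R"
    proof (rule ideal_if_closed)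
      show "V \<subseteq> carrier R" by (auto simp: V_def)
      show "\<zero> \<in> V" using C0 f0 by (simp add: V_def)
      show "a \<oplus> b \<in> V" if "a \<in> V" "b \<in> V" for a b
        using that C_add by (auto simp: V_def r_distr f_add)
      show "r \<otimes> a \<in> V" if "r \<in> carrier R" "a \<in> V" for r a
        using that by (auto simp: V_def m_assoc[symmetric])
    qed
    have \<chi>V: "\<chi> h [^] (p ^ e) \<in> V" if \<chi>: "\<chi> \<in> cartier_maps p e R" and h: "h \<in> Idl J2" for \<chi> h
    proof -
      note \<chi>' = cartier_mapsD[OF \<chi>]
      have hc: "h \<in> carrier R" using h ideal.Icarr[OF ideal2] by blast
      have "f (s \<otimes> \<chi> h [^] (p ^ e)) \<in> C" if s: "s \<in> carrier R" for s
      proof -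
        \<comment> \<open>The quantifier over \<open>k\<close> makes \<open>W\<close> an ideal: \<open>\<chi>\<close> is not \<open>R\<close>-linear.\<close>
        define W where "W = {h \<in> carrier R. \<forall>k\<in>carrier R. f (s \<otimes> \<chi> (k \<otimes> h) [^] (p ^ e)) \<in> C}"
        have "ideal W R"
        proof (rule ideal_if_closed)
          show "W \<subseteq> carrier R" by (auto simp: W_def)
          show "\<zero> \<in> W" using C0 f0 s cartier_map_zero[OF \<chi>] frobenius_zero[of e] by (simp add: W_def)
          show "a \<oplus> b \<in> W" if "a \<in> W" "b \<in> W" for a b
          proof -
            have "f (s \<otimes> \<chi> (k \<otimes> (a \<oplus> b)) [^] (p ^ e)) \<in> C" if k: "k \<in> carrier R" for k
            proof -
              have ab: "a \<in> carrier R" "b \<in> carrier R"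
                "f (s \<otimes> \<chi> (k \<otimes> a) [^] (p ^ e)) \<in> C" "f (s \<otimes> \<chi> (k \<otimes> b) [^] (p ^ e)) \<in> C"
                using \<open>a \<in> W\<close> \<open>b \<in> W\<close> k by (auto simp: W_def)
              have "s \<otimes> \<chi> (k \<otimes> (a \<oplus> b)) [^] (p ^ e)
                  = s \<otimes> \<chi> (k \<otimes> a) [^] (p ^ e) \<oplus> s \<otimes> \<chi> (k \<otimes> b) [^] (p ^ e)"
                using ab(1,2) k s \<chi>'(1) by (simp add: r_distr \<chi>'(2) frobenius_add)
              then show ?thesis using ab k s \<chi>'(1) C_add by (simp add: f_add)
            qed
            then show ?thesis using that by (auto simp: W_def)
          qed
          show "r \<otimes> a \<in> W" if "r \<in> carrier R" "a \<in> W" for r a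
            using that by (auto simp: W_def m_assoc[symmetric])
        qed
        moreover have "J2 \<subseteq> W"
        proof
          fix j assume j: "j \<in> J2"
          then have jB: "j \<in> B" and jc: "j \<in> carrier R" using J Bc by auto
          have "f (s \<otimes> \<chi> (k \<otimes> j) [^] (p ^ e)) \<in> C" if k: "k \<in> carrier R" for k
          proof -
            have "(\<lambda>b. f (s \<otimes> \<chi> (k \<otimes> b) [^] (p ^ e))) \<in> cartier_maps p e ?B"
              unfolding cartier_maps_def
            proof (intro CollectI conjI ballI)
              show "(\<lambda>b. f (s \<otimes> \<chi> (k \<otimes> b) [^] (p ^ e))) \<in> carrier ?B \<rightarrow> carrier ?B"
                using s k \<chi>'(1) Bc by (auto intro!: f_closed)
            next
              fix x y assume "x \<in> carrier ?B" "y \<in> carrier ?B"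
              then have xy: "x \<in> carrier R" "y \<in> carrier R" using Bc by auto
              then have "s \<otimes> \<chi> (k \<otimes> (x \<oplus> y)) [^] (p ^ e)
                  = s \<otimes> \<chi> (k \<otimes> x) [^] (p ^ e) \<oplus> s \<otimes> \<chi> (k \<otimes> y) [^] (p ^ e)"
                using k s \<chi>'(1) by (simp add: r_distr \<chi>'(2) frobenius_add)
              then show "f (s \<otimes> \<chi> (k \<otimes> (x \<oplus>\<^bsub>?B\<^esub> y)) [^] (p ^ e)) =
                  f (s \<otimes> \<chi> (k \<otimes> x) [^] (p ^ e)) \<oplus>\<^bsub>?B\<^esub> f (s \<otimes> \<chi> (k \<otimes> y) [^] (p ^ e))"
                using xy k s \<chi>'(1) by (simp add: f_add)
            next
              fix r x assume "r \<in> carrier ?B" "x \<in> carrier ?B"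
              then have rB: "r \<in> B" and rc: "r \<in> carrier R" and xc: "x \<in> carrier R" using Bc by auto
              have "k \<otimes> (r [^] (p ^ e) \<otimes> x) = r [^] (p ^ e) \<otimes> (k \<otimes> x)"
                using k rc xc by (simp add: m_lcomm)
              then have "\<chi> (k \<otimes> (r [^] (p ^ e) \<otimes> x)) = r \<otimes> \<chi> (k \<otimes> x)"
                using \<chi>'(3)[OF rc m_closed[OF k xc]] by simp
              then have "s \<otimes> \<chi> (k \<otimes> (r [^] (p ^ e) \<otimes> x)) [^] (p ^ e)
                  = s \<otimes> (r \<otimes> \<chi> (k \<otimes> x)) [^] (p ^ e)" by (rule arg_cong)
              also have "\<dots> = r [^] (p ^ e) \<otimes> (s \<otimes> \<chi> (k \<otimes> x) [^] (p ^ e))"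
                using k rc xc s \<chi>'(1) by (simp add: nat_pow_distrib m_lcomm)
              finally have "s \<otimes> \<chi> (k \<otimes> (r [^] (p ^ e) \<otimes> x)) [^] (p ^ e)
                  = r [^] (p ^ e) \<otimes> (s \<otimes> \<chi> (k \<otimes> x) [^] (p ^ e))" .
              then show "f (s \<otimes> \<chi> (k \<otimes> (r [^]\<^bsub>?B\<^esub> (p ^ e) \<otimes>\<^bsub>?B\<^esub> x)) [^] (p ^ e)) =
                  r \<otimes>\<^bsub>?B\<^esub> f (s \<otimes> \<chi> (k \<otimes> x) [^] (p ^ e))"
                using f_lin[OF rB, of "s \<otimes> \<chi> (k \<otimes> x) [^] (p ^ e)"] k xc s \<chi>'(1) by (simp add: pow)
            qed
            then show ?thesis
              unfolding C_def using B.cartier_map_mem_cartier_ideal[OF J2c(1) _ j] by blast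
          qed
          then show "j \<in> W" using jc by (simp add: W_def)
        qed
        ultimately have "Idl J2 \<subseteq> W" by (rule genideal_minimal)
        then have "f (s \<otimes> \<chi> (\<one> \<otimes> h) [^] (p ^ e)) \<in> C" using h by (auto simp: W_def)
        then show ?thesis using hc by simp
      qed
      then show ?thesis using \<chi>'(1) hc by (simp add: V_def)
    qed
    have "cartier_ideal p e R (Idl J2) \<subseteq> {y \<in> carrier R. y [^] (p ^ e) \<in> V}"
      unfolding cartier_ideal_def
    proof (rule genideal_minimal[OF frobenius_vimage_ideal[OF V]])
      show "{\<chi> h | \<chi> h. \<chi> \<in> cartier_maps p e R \<and> h \<in> Idl J2} \<subseteq> {y \<in> carrier R. y [^] (p ^ e) \<in> V}"
        using \<chi>V cartier_mapsD(1) ideal.Icarr[OF ideal2] by auto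
    qed
    then have le': "cartier_ideal p e R (Idl J1) \<subseteq> {y \<in> carrier R. y [^] (p ^ e) \<in> V}"
      using le by blast
    have gJ: "g \<in> Idl J1" "g \<in> carrier R" "g \<in> B" using g genideal_self[OF J2c(2)] J2c(2) J(1) by auto
    have "{\<psi> g [^] (p ^ e) | \<psi>. \<psi> \<in> cartier_maps p e R} \<subseteq> V"
    proof
      fix z assume "z \<in> {\<psi> g [^] (p ^ e) | \<psi>. \<psi> \<in> cartier_maps p e R}"
      then obtain \<psi> where \<psi>: "z = \<psi> g [^] (p ^ e)" "\<psi> \<in> cartier_maps p e R" by blast
      have "\<psi> g \<in> cartier_ideal p e R (Idl J1)"
        using cartier_map_mem_cartier_ideal[OF _ \<psi>(2) gJ(1)] additive_subgroup.a_subset[OF ideal.axioms(1)[OF ideal1]] by blast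
      then show "z \<in> V" using le' \<psi>(1) by blast
    qed
    then have "g \<in> V" using generated[OF gJ(2)] genideal_minimal[OF V] by blast
    then have "f (\<one> \<otimes> g) \<in> C" unfolding V_def by blast
    then show "\<phi> g \<in> C" using gJ by (simp add: f_def \<beta>(4))
  qed
  then show ?thesis
    unfolding cartier_ideal_def[of p e ?B J1] C_def[symmetric]
    by (intro B.genideal_minimal[OF C.is_ideal]) blast
qed


lemma (in noetherian_cring) increasing_ideals_stabilize:
  assumes "\<And>e. ideal (f e) R" "\<And>e. f e \<subseteq> f (Suc e)"
  obtains E where "\<And>e. E \<le> e \<Longrightarrow> f e = (\<Union>e::nat. f e)"
proof -
  have mono: "f a \<subseteq> f b" if "a \<le> b" for a b
    using that by (rule lift_Suc_mono_le[of f, OF assms(2)])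
  have "f a \<subseteq> f b \<or> f b \<subseteq> f a" for a b
    using mono[of a b] mono[of b a] nat_le_linear[of a b] by blast
  then have "subset.chain {I. ideal I R} (range f)"
    unfolding subset_chain_def using assms(1) by blast
  then have "(\<Union>e. f e) \<in> range f" by (intro ideal_chain_is_trivial) auto
  then obtain E where "f E = (\<Union>e. f e)" by auto
  then have "f e = (\<Union>e. f e)" if "E \<le> e" for e using mono[OF that] by blast
  then show ?thesis by (rule that)
qed

lemma char_p_cringI:
  assumes "cring R" "Factorial_Ring.prime p" "contains_field_of_char p R"
  shows "char_p_cring R p"
  using assms by (auto simp: char_p_cring_def char_p_cring_axioms_def contains_field_of_char_def)

text \<open>
  The inclusion over \<open>S\<close> between unions becomes an inclusion at every sufficiently large level \<open>e\<close>, because the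
  union for \<open>l2\<close> is attained at level \<open>e\<close>. There it descends to \<open>R\<close>, and the level \<open>e0\<close> that one starts
  from is contained in a larger one.
\<close>

lemma test_ideal_descends_to_summand:
  fixes S :: "('a, 'm) ring_scheme" and R I :: "'a set" and p :: nat and l1 l2 :: real
  assumes p: "Factorial_Ring.prime p"
    and S: "domain S" "regular_ring S" "contains_field_of_char p S" "F_finite p S"
    and R: "subcring R S" "contains_field_of_char p (S\<lparr>carrier := R\<rparr>)" "direct_summand R S"
    and I: "ideal I (S\<lparr>carrier := R\<rparr>)"
    and le: "test_ideal p S (Idl\<^bsub>S\<^esub> I) l1 \<subseteq> test_ideal p S (Idl\<^bsub>S\<^esub> I) l2"
  shows "test_ideal p (S\<lparr>carrier := R\<rparr>) I l1 \<subseteq> test_ideal p (S\<lparr>carrier := R\<rparr>) I l2"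
proof -
  let ?R = "S\<lparr>carrier := R\<rparr>"
  interpret S: domain S by (rule S(1))
  have "char_p_cring S p" by (rule char_p_cringI[OF S.is_cring p S(3)])
  moreover have "noetherian_ring S" using S(2) by (simp add: regular_ring_def)
  ultimately interpret S: noetherian_char_p_domain S p
    by (simp add: noetherian_char_p_domain_def noetherian_cring_def S.is_cring S(1))
  have Rc: "R \<subseteq> carrier S" and one_R: "\<one>\<^bsub>S\<^esub> \<in> R" using subcringE[OF R(1)] by auto
  have "cring ?R" using S.subcring_iff[OF Rc] R(1) by blast
  then have char_R: "char_p_cring ?R p" using p R(2) by (rule char_p_cringI)
  interpret R: char_p_cring ?R p by (rule char_R)
  obtain \<beta> where \<beta>: "\<beta> \<in> carrier S \<rightarrow> R"
      "\<And>x y. x \<in> carrier S \<Longrightarrow> y \<in> carrier S \<Longrightarrow> \<beta> (x \<oplus>\<^bsub>S\<^esub> y) = \<beta> x \<oplus>\<^bsub>S\<^esub> \<beta> y"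
      "\<And>r x. r \<in> R \<Longrightarrow> x \<in> carrier S \<Longrightarrow> \<beta> (r \<otimes>\<^bsub>S\<^esub> x) = r \<otimes>\<^bsub>S\<^esub> \<beta> x"
      "\<And>r. r \<in> R \<Longrightarrow> \<beta> r = r"
    using R(3) unfolding direct_summand_def by blast
  note one = S.mem_frobenius_ideal_of_cartier_values[OF S(2,4)]
  note generated = S.mem_frobenius_power_of_cartier_values[OF one]
  obtain \<theta> where \<theta>: "\<theta> \<in> cartier_maps p 1 S" "\<theta> \<one>\<^bsub>S\<^esub> = \<one>\<^bsub>S\<^esub>"
    by (rule S.frobenius_splitting[OF one[OF S.one_closed]])
  note \<theta>' = S.cartier_mapsD[OF \<theta>(1)]
  have \<theta>R: "(\<lambda>x. \<beta> (\<theta> x)) \<in> cartier_maps p 1 ?R" "\<beta> (\<theta> \<one>\<^bsub>?R\<^esub>) = \<one>\<^bsub>?R\<^esub>"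
  proof -
    have pow: "x [^]\<^bsub>?R\<^esub> (n::nat) = x [^]\<^bsub>S\<^esub> n" for x n by (simp add: S.nat_pow_consistent[symmetric])
    show "(\<lambda>x. \<beta> (\<theta> x)) \<in> cartier_maps p 1 ?R"
      unfolding cartier_maps_def using \<theta>' \<beta> Rc by (auto simp: pow subset_iff)
    show "\<beta> (\<theta> \<one>\<^bsub>?R\<^esub>) = \<one>\<^bsub>?R\<^esub>" using \<theta>(2) \<beta>(4)[OF one_R] by simp
  qed
  have Ic: "I \<subseteq> carrier S"
    using additive_subgroup.a_subset[OF ideal.axioms(1)[OF I]] Rc by auto
  note IS = S.genideal_ideal[OF Ic]
  define n where "n l e = nat \<lceil>real p ^ e * l\<rceil>" for l e
  define fS where "fS l e = cartier_ideal p e S ((Idl\<^bsub>S\<^esub> I) [^]\<^bsub>ideals_set S\<^esub> n l e)" for l e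
  define fR where "fR l e = cartier_ideal p e ?R (I [^]\<^bsub>ideals_set ?R\<^esub> n l e)" for l e
  have test_S: "test_ideal p S (Idl\<^bsub>S\<^esub> I) l = (\<Union>e. fS l e)" and test_R: "test_ideal p ?R I l = (\<Union>e. fR l e)" for l
    by (simp_all add: test_ideal_def fS_def fR_def n_def)
  have fS_ideal: "ideal (fS l e) S" for l e
    unfolding fS_def
    by (rule S.ideal_cartier_ideal[OF additive_subgroup.a_subset[OF ideal.axioms(1)[OF S.ideal_power_ideal[OF IS]]]])
  have fS_Suc: "fS l e \<subseteq> fS l (Suc e)" for l e
    unfolding fS_def n_def by (rule S.cartier_ideal_Suc_mono[OF \<theta> IS])
  have fR_Suc: "fR l e \<subseteq> fR l (Suc e)" for l e
    unfolding fR_def n_def by (rule R.cartier_ideal_Suc_mono[OF \<theta>R I])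
  obtain E where E: "\<And>e. E \<le> e \<Longrightarrow> fS l2 e = (\<Union>e. fS l2 e)"
    using S.increasing_ideals_stabilize[of "fS l2", OF fS_ideal fS_Suc] by blast
  have "fR l1 e0 \<subseteq> (\<Union>e. fR l2 e)" for e0
  proof -
    define e where "e = max E e0"
    have "fS l1 e \<subseteq> (\<Union>e. fS l1 e)" by blast
    also have "\<dots> \<subseteq> (\<Union>e. fS l2 e)" using le by (simp only: test_S)
    also have "\<dots> = fS l2 e" using E[of e] by (simp add: e_def)
    finally have le_e: "fS l1 e \<subseteq> fS l2 e" .
    have pow_R: "I [^]\<^bsub>ideals_set ?R\<^esub> (k::nat) \<subseteq> R" for k
      using additive_subgroup.a_subset[OF ideal.axioms(1)[OF R.ideal_power_ideal[OF I, of k]]] by simp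
    have "fR l1 e \<subseteq> fR l2 e"
      unfolding fR_def
      by (rule S.cartier_ideal_descends_to_summand[OF R(1) \<beta> char_R generated pow_R pow_R])
         (use le_e in \<open>simp_all add: fS_def S.extension_ideal_power[OF R(1) I]\<close>)
    moreover have "fR l1 e0 \<subseteq> fR l1 e"
      by (rule lift_Suc_mono_le[of "fR l1", OF fR_Suc]) (simp add: e_def)
    ultimately show ?thesis by blast
  qed
  then show ?thesis unfolding test_R by blast
qed

theorem theorem4p12:
  fixes S :: "('a, 'm) ring_scheme" and R I :: "'a set" and p :: nat and l1 l2 :: real
  assumes "Factorial_Ring.prime p"
    and "domain S" and "regular_ring S"
    and "contains_field_of_char p S" and "F_finite p S"
    and "subcring R S"
    and "noetherian_ring (S\<lparr>carrier := R\<rparr>)"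
    and "contains_field_of_char p (S\<lparr>carrier := R\<rparr>)" and "F_finite p (S\<lparr>carrier := R\<rparr>)"
    and "direct_summand R S"
    and "ideal I (S\<lparr>carrier := R\<rparr>)"
    and "l1 > 0" and "l2 > 0"
    and "test_ideal p S (Idl\<^bsub>S\<^esub> I) l1 = test_ideal p S (Idl\<^bsub>S\<^esub> I) l2"
  shows "test_ideal p (S\<lparr>carrier := R\<rparr>) I l1 = test_ideal p (S\<lparr>carrier := R\<rparr>) I l2"
proof
  note summand = test_ideal_descends_to_summand[OF assms(1-6,8,10,11)]
  show "test_ideal p (S\<lparr>carrier := R\<rparr>) I l1 \<subseteq> test_ideal p (S\<lparr>carrier := R\<rparr>) I l2"
    by (rule summand) (simp only: assms(14) subset_refl)
  show "test_ideal p (S\<lparr>carrier := R\<rparr>) I l2 \<subseteq> test_ideal p (S\<lparr>carrier := R\<rparr>) I l1"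
    by (rule summand) (simp only: assms(14) subset_refl)
qed

end
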